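(* Let $N\ge 11$ and let $f$ satisfy the standing assumptions given in the context. Assume that the finite limit $q_0=\lim_{u\to 0+}f'(u)F(u)$ exists and that $1<q_0<q_{JL}$. Then the equation $\Delta u+f(u)=0$ in $\mathbb{R}^N$ has stable solutions of the form $u(|x|,\alpha)$ with $\alpha>0$, and hence one of the following holds: (II) for any $\alpha>0$, $u(r,\alpha)$ is stable, and $u(r,\alpha)$ is strictly increasing in $\alpha>0$ for each fixed $r>0$; or (III) there exists $\alpha^*\in(0,\infty)$ such that $u(r,\alpha)$ is stable if $\alpha\in(0,\alpha^*]$ and unstable if $\alpha>\alpha^*$, and $u(r,\alpha)$ is strictly increasing in $\alpha\in(0,\alpha^* )$ for each fixed $r>0$.
   Context: Standing assumptions on $f:\mathbb{R}\to\mathbb{R}$: $f\in C^2(\mathbb{R}\setminus\{0\})\cap C^1(\mathbb{R})$; $f$ is odd (so $f(0)=0$); and for all $u>0$, $f(u)>0$, $f'(u)>0$, $f''(u)>0$ and $F(u):=\int_u^\infty \frac{ds}{f(s)}<\infty$. $q_{JL}:=\frac{N-2\sqrt{N-1}}{4}$. For $\alpha>0$, $u(r,\alpha)$ denotes the unique solution of $u''+\frac{N-1}{r}u'+f(u)=0$ for $r>0$, $u(0)=\alpha$, $u'(0)=0$. A solution $u\in C^2(\mathbb{R}^N)$ of $\Delta u+f(u)=0$ in $\mathbb{R}^N$ is called stable if $\int_{\mathbb{R}^N}(|\nabla\phi|^2-f'(u)\phi^2)\,dx\ge 0$ for every $\phi\in C^1_0(\mathbb{R}^N)$ ($C^1$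 functions with compact support), and unstable if it is not stable. We say $u(r,\alpha)$ is stable (unstable) if $x\mapsto u(|x|,\alpha)$ is. *)

theory Defs
  imports "HOL-Analysis.Analysis"
begin

text \<open>Partial derivative in direction \<open>b\<close>; only applied to differentiable functions,
  since \<open>frechet_derivative\<close> is unspecified otherwise.\<close>

definition partial_deriv ::
    "'a::euclidean_space \<Rightarrow> ('a \<Rightarrow> real) \<Rightarrow> 'a \<Rightarrow> real" where
  "partial_deriv b w x = frechet_derivative w (at x) b"

definition grad :: "('a::euclidean_space \<Rightarrow> real) \<Rightarrow> 'a \<Rightarrow> 'a" where
  "grad w x = (\<Sum>b\<in>Basis. partial_deriv b w x *\<^sub>R b)"

definition laplacian :: "('a::euclidean_space \<Rightarrow> real) \<Rightarrow> 'a \<Rightarrow> real" where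
  "laplacian w x = (\<Sum>b\<in>Basis. partial_deriv b (partial_deriv b w) x)"

definition C1 :: "('a::euclidean_space \<Rightarrow> real) \<Rightarrow> bool" where
  "C1 w \<longleftrightarrow> (\<forall>x. w differentiable (at x)) \<and>
     (\<forall>b\<in>Basis. continuous_on UNIV (partial_deriv b w))"

definition C2 :: "('a::euclidean_space \<Rightarrow> real) \<Rightarrow> bool" where
  "C2 w \<longleftrightarrow> C1 w \<and> (\<forall>b\<in>Basis. C1 (partial_deriv b w))"

definition C1_compact_support :: "('a::euclidean_space \<Rightarrow> real) \<Rightarrow> bool" where
  "C1_compact_support \<phi> \<longleftrightarrow> C1 \<phi> \<and> compact (closure {x. \<phi> x \<noteq> 0})"

text \<open>Finiteness of \<open>tail_integral f u\<close> is the separate integrability condition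
  in \<open>standing_assumptions\<close>, because the Lebesgue integral of a non-integrable
  function is 0 by convention.\<close>

definition tail_integral :: "(real \<Rightarrow> real) \<Rightarrow> real \<Rightarrow> real" where
  "tail_integral f u = (LBINT s:{u..}. 1 / f s)"

definition standing_assumptions :: "(real \<Rightarrow> real) \<Rightarrow> bool" where
  "standing_assumptions f \<longleftrightarrow>
     (\<forall>u. f differentiable (at u)) \<and> continuous_on UNIV (deriv f) \<and>
     (\<forall>u. u \<noteq> 0 \<longrightarrow> deriv f differentiable (at u)) \<and>
     continuous_on (- {0}) (deriv (deriv f)) \<and>
     (\<forall>u. f (- u) = - f u) \<and>
     (\<forall>u>0. f u > 0 \<and> deriv f u > 0 \<and> deriv (deriv f) u > 0 \<and>
        set_integrable lborel {u..} (\<lambda>s. 1 / f s))"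

definition q_JL :: "nat \<Rightarrow> real" where
  "q_JL N = (real N - 2 * sqrt (real N - 1)) / 4"

definition radial_ivp :: "nat \<Rightarrow> (real \<Rightarrow> real) \<Rightarrow> real \<Rightarrow> (real \<Rightarrow> real) \<Rightarrow> bool" where
  "radial_ivp N f \<alpha> w \<longleftrightarrow>
     w 0 = \<alpha> \<and> (w has_real_derivative 0) (at 0 within {0..}) \<and>
     (\<forall>r>0. w differentiable (at r) \<and> deriv w differentiable (at r) \<and>
        deriv (deriv w) r + (real N - 1) / r * deriv w r + f (w r) = 0)"

text \<open>A solution of the initial value problem is a function on \<open>[0, \<infinity>)\<close>;
  extensionality fixes its irrelevant values on the negative half-line.\<close>

definition radial_sol :: "nat \<Rightarrow> (real \<Rightarrow> real) \<Rightarrow> real \<Rightarrow> real \<Rightarrow> real" where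
  "radial_sol N f r \<alpha> = (THE w. radial_ivp N f \<alpha> w \<and> w \<in> extensional {0..}) r"

definition entire_solution ::
    "(real \<Rightarrow> real) \<Rightarrow> ('a::euclidean_space \<Rightarrow> real) \<Rightarrow> bool" where
  "entire_solution f U \<longleftrightarrow> C2 U \<and> (\<forall>x. laplacian U x + f (U x) = 0)"

definition stable_solution ::
    "(real \<Rightarrow> real) \<Rightarrow> ('a::euclidean_space \<Rightarrow> real) \<Rightarrow> bool" where
  "stable_solution f U \<longleftrightarrow> entire_solution f U \<and>
     (\<forall>\<phi>. C1_compact_support \<phi> \<longrightarrow>
        (\<integral>x. ((norm (grad \<phi> x))\<^sup>2 - deriv f (U x) * (\<phi> x)\<^sup>2) \<partial>lborel) \<ge> 0)"

definition unstable_solution ::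
    "(real \<Rightarrow> real) \<Rightarrow> ('a::euclidean_space \<Rightarrow> real) \<Rightarrow> bool" where
  "unstable_solution f U \<longleftrightarrow> entire_solution f U \<and> \<not> stable_solution f U"

end

theory Submission
  imports Defs
begin

text \<open>
  Existence of a stable solution. Put \<open>v = F(u)\<close> and \<open>q = f'(u) F(u)\<close>. Then
  \<open>v'' + (N-1)/r v' = 1 + q v'\<^sup>2/v\<close>, and in the variables \<open>y = r\<^sup>2/v\<close>, \<open>z = r v'/v\<close>, \<open>t = ln r\<close>
  this is the planar system \<open>dy/dt = y(2 - z)\<close>, \<open>dz/dt = y - (N-2) z + (q-1) z\<^sup>2\<close>. For small \<open>\<alpha>\<close>
  the coefficient \<open>q\<close> stays close to \<open>q\<^sub>0 < q\<^sub>J\<^sub>L\<close>, so the rest point \<open>(2N - 4q, 2)\<close> is a node and a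
  straight line through a point slightly to its right keeps \<open>y\<close> below some \<open>Y\<close> near \<open>2N - 4q\<^sub>0\<close>.
  Hence \<open>f'(u) = q y / r\<^sup>2 \<le> \<kappa> / r\<^sup>2\<close> with \<open>\<kappa> < (N-2)\<^sup>2/4\<close>, and Hardy's inequality gives stability.

  Ordering. Let \<open>u(\<cdot>,\<alpha>)\<close> be stable and \<open>\<beta> < \<alpha>\<close>. If \<open>|u(\<cdot>,\<beta>)|\<close> met \<open>u(\<cdot>,\<alpha>)\<close>, then either the difference
  of the two or \<open>u(\<cdot>,\<beta>)\<close> itself would be a positive strict subsolution of the linearised equation on a
  ball, vanishing on the boundary; its powers with exponent \<open>p \<rightarrow> 1+\<close> are \<open>C\<^sup>1\<close> test functions that
  violate stability. So \<open>|u(\<cdot>,\<beta>)| < u(\<cdot>,\<alpha>)\<close>, and \<open>u(\<cdot>,\<beta>)\<close> is stable because \<open>f'\<close> is even and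
  increasing on \<open>[0,\<infinity>)\<close>. The set of stable parameters is closed by continuous dependence.
\<close>

section \<open>Gradients and the divergence theorem\<close>

text \<open>The number \<open>q_JL\<close> enters through one polynomial. With
  \<open>Y = 2 N - 4 q\<close>, the condition \<open>4 Y < (N + 2 - 4 q)^2\<close> for two distinct
  real eigenvalues at the rest point and the Hardy condition \<open>q Y < (N - 2)^2 / 4\<close> both
  read \<open>16 q^2 - 8 N q + (N - 2)^2 > 0\<close>, and \<open>q_JL\<close> is the smaller root.
  So one strict inequality for \<open>q0\<close> leaves room in both, and this room absorbs the
  variation of \<open>q\<close> along the orbit, of which only bounds are known. Two obstacles shape
  the rest. The substitution \<open>v = F(u)\<close> makes sense only while \<open>u > 0\<close>, so
  the planar system lives up to a possible first zero of \<open>u\<close>, and positivity has to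
  come out of the barrier itself. And since the equation is singular at the origin, every monotone
  quantity starts from a limit at \<open>0+\<close> instead of a value at 0. In the ordering step
  the sign of \<open>u(.,\<beta>)\<close> is unknown. This is why its absolute value is compared; it
  is also the form in which the even function \<open>f'\<close> can be compared.\<close>

lemma partial_deriv_eq_grad_inner: "b \<in> Basis \<Longrightarrow> partial_deriv b w x = grad w x \<bullet> b"
  by (simp add: grad_def inner_sum_left inner_Basis if_distrib sum.delta cong: if_cong)

lemma GDERIV_unique_grad:
  assumes "GDERIV w x :> G" shows "grad w x = G"
proof -
  have "frechet_derivative w (at x) = (\<lambda>h. h \<bullet> G)"
    using assms frechet_derivative_at unfolding gderiv_def by metis
  then show ?thesis
    by (simp add: grad_def partial_deriv_def inner_commute[of _ G] euclidean_representation)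
qed

lemma GDERIV_grad:
  assumes "w differentiable (at x)" shows "GDERIV w x :> grad w x"
proof -
  have D: "(w has_derivative frechet_derivative w (at x)) (at x)"
    using assms frechet_derivative_works by blast
  interpret D: linear "frechet_derivative w (at x)"
    using D has_derivative_linear by blast
  have "frechet_derivative w (at x) h = h \<bullet> grad w x" for h
  proof -
    have "frechet_derivative w (at x) h = frechet_derivative w (at x) (\<Sum>b\<in>Basis. (h \<bullet> b) *\<^sub>R b)"
      by (simp add: euclidean_representation)
    also have "\<dots> = h \<bullet> grad w x"
      unfolding D.sum D.scaleR grad_def partial_deriv_def inner_sum_right by (simp add: mult.commute)
    finally show ?thesis .
  qed
  then have "frechet_derivative w (at x) = (\<lambda>h. h \<bullet> grad w x)" by blast
  then show ?thesis using D unfolding gderiv_def by simp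
qed

text \<open>Replaces the coordinatewise definition by a single continuous gradient field, so that
  the product, inverse and chain rules for \<open>GDERIV\<close> become available.\<close>

lemma C1_iff_grad: "C1 w \<longleftrightarrow> (\<forall>x. GDERIV w x :> grad w x) \<and> continuous_on UNIV (grad w)"
proof
  assume C: "C1 w"
  then have "\<forall>x. GDERIV w x :> grad w x" by (simp add: C1_def GDERIV_grad)
  moreover have "continuous_on UNIV (grad w)"
    using C unfolding C1_def grad_def[abs_def] by (intro continuous_intros) auto
  ultimately show "(\<forall>x. GDERIV w x :> grad w x) \<and> continuous_on UNIV (grad w)" by blast
next
  assume C: "(\<forall>x. GDERIV w x :> grad w x) \<and> continuous_on UNIV (grad w)"
  then have "continuous_on UNIV (partial_deriv b w)" if "b \<in> Basis" for b
  proof -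
    have "partial_deriv b w = (\<lambda>x. grad w x \<bullet> b)"
      using that by (simp add: fun_eq_iff partial_deriv_eq_grad_inner)
    then show ?thesis using C by (auto intro!: continuous_intros)
  qed
  then show "C1 w" using C unfolding C1_def gderiv_def differentiable_def by blast
qed

text \<open>The pattern behind most \<open>C1\<close> claims below: a pointwise gradient candidate
  that is continuous as a field delivers both the regularity and the value of \<open>grad w\<close>,
  which \<open>frechet_derivative\<close> hides behind a choice.\<close>

lemma C1_from_GDERIV:
  assumes "\<And>x. GDERIV w x :> G x" "continuous_on UNIV G"
  shows "C1 w" "grad w = G"
proof -
  show g: "grad w = G" using GDERIV_unique_grad[OF assms(1)] by blast
  show "C1 w" using assms unfolding C1_iff_grad g by blast
qed

lemma GDERIV_continuous: "GDERIV w x :> G \<Longrightarrow> isCont w x"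
  unfolding gderiv_def using has_derivative_continuous by blast

lemma C1_continuous_on: "C1 w \<Longrightarrow> continuous_on UNIV w"
  by (auto simp: C1_iff_grad intro: GDERIV_continuous continuous_at_imp_continuous_on)

lemma C1_mult:
  assumes "C1 v" "C1 w"
  shows "C1 (\<lambda>x. v x * w x)" "grad (\<lambda>x. v x * w x) x = v x *\<^sub>R grad w x + w x *\<^sub>R grad v x"
proof -
  have G: "GDERIV (\<lambda>x. v x * w x) x :> v x *\<^sub>R grad w x + w x *\<^sub>R grad v x" for x
    using assms by (intro GDERIV_mult) (auto simp: C1_iff_grad)
  have "continuous_on UNIV (\<lambda>x. v x *\<^sub>R grad w x + w x *\<^sub>R grad v x)"
    using assms C1_continuous_on by (intro continuous_intros) (auto simp: C1_iff_grad)
  from C1_from_GDERIV[OF G this]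
  show "C1 (\<lambda>x. v x * w x)" "grad (\<lambda>x. v x * w x) x = v x *\<^sub>R grad w x + w x *\<^sub>R grad v x"
    by auto
qed

lemma C1_diff:
  assumes "C1 v" "C1 w"
  shows "C1 (\<lambda>x. v x - w x)" "grad (\<lambda>x. v x - w x) x = grad v x - grad w x"
proof -
  have G: "GDERIV (\<lambda>x. v x - w x) x :> grad v x - grad w x" for x
    using assms by (intro GDERIV_diff) (auto simp: C1_iff_grad)
  have "continuous_on UNIV (\<lambda>x. grad v x - grad w x)"
    using assms by (intro continuous_intros) (auto simp: C1_iff_grad)
  from C1_from_GDERIV[OF G this]
  show "C1 (\<lambda>x. v x - w x)" "grad (\<lambda>x. v x - w x) x = grad v x - grad w x" by auto
qed

lemma C2_diff:
  assumes "C2 v" "C2 w"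
  shows "C2 (\<lambda>x. v x - w x)" "laplacian (\<lambda>x. v x - w x) x = laplacian v x - laplacian w x"
proof -
  have 1: "C1 v" "C1 w" using assms by (auto simp: C2_def)
  have p: "partial_deriv b (\<lambda>x. v x - w x) = (\<lambda>x. partial_deriv b v x - partial_deriv b w x)"
    if "b \<in> Basis" for b
    using that 1 by (simp add: fun_eq_iff partial_deriv_eq_grad_inner C1_diff inner_diff_left)
  show "C2 (\<lambda>x. v x - w x)"
    using assms 1 by (auto simp: C2_def p intro!: C1_diff)
  show "laplacian (\<lambda>x. v x - w x) x = laplacian v x - laplacian w x"
    using assms unfolding laplacian_def sum_subtractf[symmetric] C2_def
    by (intro sum.cong refl) (simp add: p partial_deriv_eq_grad_inner[of _ "\<lambda>x. _ x - _ x"]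
        partial_deriv_eq_grad_inner[of _ "partial_deriv _ _"] C1_diff inner_diff_left)
qed

lemma C2_continuous_on_laplacian:
  assumes "C2 w" shows "continuous_on UNIV (laplacian w)"
  using assms unfolding C2_def C1_def laplacian_def[abs_def] by (intro continuous_intros) blast

section \<open>Functions with compact support and their integrals\<close>

lemma C1_compact_support_iff:
  "C1_compact_support g \<longleftrightarrow> C1 g \<and> (\<exists>r. \<forall>x. norm x > r \<longrightarrow> g x = 0)"
proof
  assume C: "C1_compact_support g"
  then have "bounded {x. g x \<noteq> 0}"
    unfolding C1_compact_support_def by (metis bounded_subset closure_subset compact_imp_bounded)
  then obtain r where "\<forall>x\<in>{x. g x \<noteq> 0}. norm x \<le> r" unfolding bounded_iff by blast
  then have "\<forall>x. norm x > r \<longrightarrow> g x = 0" by force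
  then show "C1 g \<and> (\<exists>r. \<forall>x. norm x > r \<longrightarrow> g x = 0)" using C by (auto simp: C1_compact_support_def)
next
  assume C: "C1 g \<and> (\<exists>r. \<forall>x. norm x > r \<longrightarrow> g x = 0)"
  then obtain r where "\<forall>x. norm x > r \<longrightarrow> g x = 0" by blast
  then have "bounded {x. g x \<noteq> 0}" unfolding bounded_iff by (metis (mono_tags) mem_Collect_eq not_le)
  then show "C1_compact_support g" using C by (auto simp: C1_compact_support_def)
qed

lemma grad_zero_outside:
  assumes "\<And>x. norm x > r \<Longrightarrow> g x = 0" "norm x > r"
  shows "grad g x = 0"
proof (rule GDERIV_unique_grad)
  have "GDERIV (\<lambda>x. 0) x :> (0::'a)" by (rule GDERIV_const)
  then show "GDERIV g x :> 0" unfolding gderiv_def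
  proof (rule has_derivative_transform_within_open)
    show "open {x::'a. norm x > r}" by (intro open_Collect_less continuous_intros)
  qed (use assms in auto)
qed

lemma integrable_continuous_compact_support:
  fixes h :: "'a::euclidean_space \<Rightarrow> real"
  assumes "continuous_on UNIV h" "\<And>x. norm x > r \<Longrightarrow> h x = 0"
  shows "integrable lborel h"
proof -
  have "integrable lborel (\<lambda>x. indicator (cball 0 r) x *\<^sub>R h x)"
    by (intro borel_integrable_compact continuous_on_subset[OF assms(1)] compact_cball subset_UNIV)
  moreover have "(\<lambda>x. indicator (cball 0 r) x *\<^sub>R h x) = h"
    using assms(2) by (auto simp: fun_eq_iff indicator_def)
  ultimately show ?thesis by simp
qed

lemma bounded_continuous_compact_support:
  fixes h :: "'a::euclidean_space \<Rightarrow> 'b::real_normed_vector"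
  assumes "continuous_on UNIV h" "\<And>x. norm x > r \<Longrightarrow> h x = 0"
  obtains M where "M \<ge> 0" "\<And>x. norm (h x) \<le> M"
proof -
  have "compact (h ` cball 0 r)"
    by (intro compact_continuous_image continuous_on_subset[OF assms(1)] compact_cball subset_UNIV)
  then have "bounded (h ` cball 0 r)" by (rule compact_imp_bounded)
  then obtain M where M: "\<And>x. x \<in> cball 0 r \<Longrightarrow> norm (h x) \<le> M"
    unfolding bounded_iff ball_simps by blast
  have "norm (h x) \<le> max M 0" for x
    using M[of x] assms(2)[of x] by (cases "norm x \<le> r") auto
  then show ?thesis using that[of "max M 0"] by auto
qed

text \<open>The integral of a translate of \<open>g\<close> is constant; differentiate it along \<open>b\<close>.\<close>

lemma integral_partial_deriv_eq_0:
  fixes g :: "'a::euclidean_space \<Rightarrow> real"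
  assumes "C1_compact_support g" "b \<in> Basis"
  shows "integrable lborel (partial_deriv b g)" "(\<integral>x. partial_deriv b g x \<partial>lborel) = 0"
proof -
  from assms obtain r where C: "C1 g" and r: "\<And>x. norm x > r \<Longrightarrow> g x = 0"
    unfolding C1_compact_support_iff by blast
  have p: "partial_deriv b g = (\<lambda>x. grad g x \<bullet> b)"
    using assms(2) by (simp add: fun_eq_iff partial_deriv_eq_grad_inner)
  have G: "\<And>x. GDERIV g x :> grad g x" and cG: "continuous_on UNIV (grad g)"
    using C by (auto simp: C1_iff_grad)
  have zG: "\<And>x. norm x > r \<Longrightarrow> grad g x = 0" using grad_zero_outside r by blast
  obtain M where M: "M \<ge> 0" "\<And>x. norm (grad g x) \<le> M"
    using bounded_continuous_compact_support[OF cG zG] by blast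
  have ig: "integrable lborel g"
    using C1_continuous_on[OF C] r by (rule integrable_continuous_compact_support)
  show "integrable lborel (partial_deriv b g)" unfolding p
    using cG zG by (intro integrable_continuous_compact_support[of _ r] continuous_intros) auto
  \<comment> \<open>The steps stay at most 1, so all shifted copies of \<open>g\<close> vanish
    outside the ball of radius \<open>|r| + 1\<close>; together with the Lipschitz bound
    \<open>M\<close> this gives the dominating function.\<close>
  define t where "t n = inverse (real (Suc n))" for n
  have t: "0 < t n" "t n \<le> 1" for n by (auto simp: t_def field_simps)
  have t0: "t \<longlonglongrightarrow> 0" unfolding t_def by (rule LIMSEQ_inverse_real_of_nat)
  define s where "s n x = (g (t n *\<^sub>R b + x) - g x) / t n" for n x
  have shift: "integrable lborel (\<lambda>x. g (c + x))" "(\<integral>x. g (c + x) \<partial>lborel) = (\<integral>x. g x \<partial>lborel)" for c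
  proof -
    have gm: "g \<in> borel_measurable borel" using ig by auto
    have "integrable (distr lborel borel ((+) c)) g" using ig by (simp add: lborel_distr_plus)
    then show "integrable lborel (\<lambda>x. g (c + x))" using gm by (subst (asm) integrable_distr_eq) auto
    show "(\<integral>x. g (c + x) \<partial>lborel) = (\<integral>x. g x \<partial>lborel)"
      using integral_distr[of "(+) c" lborel borel g] gm by (simp add: lborel_distr_plus)
  qed
  have s0: "(\<integral>x. s n x \<partial>lborel) = 0" and si: "integrable lborel (s n)" for n
    unfolding s_def using shift ig by auto
  have lim: "(\<lambda>n. s n x) \<longlonglongrightarrow> grad g x \<bullet> b" for x
  proof -
    have "((\<lambda>h. g (h *\<^sub>R b + x)) has_derivative (\<lambda>h. (h *\<^sub>R b) \<bullet> grad g x)) (at 0)"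
      using G[of x] unfolding gderiv_def
      by (intro has_derivative_compose[where f="\<lambda>h. h *\<^sub>R b + x" and g=g] )
         (auto intro!: derivative_eq_intros)
    then have "((\<lambda>h. g (h *\<^sub>R b + x)) has_real_derivative b \<bullet> grad g x) (at 0)"
      unfolding has_field_derivative_def by (rule has_derivative_eq_rhs) (simp add: fun_eq_iff)
    then have "((\<lambda>h. (g (h *\<^sub>R b + x) - g x) / h) \<longlongrightarrow> b \<bullet> grad g x) (at 0)"
      by (simp add: DERIV_def)
    moreover have "filterlim t (at 0) sequentially"
      using t0 less_imp_neq[OF t(1), symmetric] by (simp add: filterlim_at)
    ultimately have "(\<lambda>n. s n x) \<longlonglongrightarrow> b \<bullet> grad g x"
      unfolding s_def by (rule filterlim_compose)
    then show ?thesis by (simp only: inner_commute)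
  qed
  have lip: "\<bar>g (t n *\<^sub>R b + x) - g x\<bar> \<le> M * t n" for n x
  proof -
    have "norm (g (t n *\<^sub>R b + x) - g x) \<le> M * norm ((t n *\<^sub>R b + x) - x)"
    proof (rule differentiable_bound[of UNIV g "\<lambda>x h. h \<bullet> grad g x"])
      show "onorm (\<lambda>h. h \<bullet> grad g x) \<le> M" for x
      proof (intro onorm_bound)
        show "norm (h \<bullet> grad g x) \<le> M * norm h" for h
          using Cauchy_Schwarz_ineq2[of h "grad g x"] mult_left_mono[OF M(2)[of x] norm_ge_zero[of h]]
          by (simp add: mult.commute)
      qed (use M in auto)
    qed (use G in \<open>auto simp: gderiv_def\<close>)
    then show ?thesis using assms(2) t(1)[of n] by simp
  qed
  have dom: "norm (s n x) \<le> M * indicator (cball 0 (\<bar>r\<bar> + 1)) x" for n x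
  proof (cases "norm x \<le> \<bar>r\<bar> + 1")
    case True
    then show ?thesis using lip[of n x] t(1)[of n] by (simp add: s_def field_simps)
  next
    case False
    have "norm x \<le> norm (t n *\<^sub>R b + x) + norm (t n *\<^sub>R b)"
      by (metis add.commute add_diff_cancel_right' norm_triangle_ineq4)
    then have "norm (t n *\<^sub>R b + x) \<ge> norm x - 1" using assms(2) t[of n] by simp
    then have "g (t n *\<^sub>R b + x) = 0" "g x = 0" using False r by auto
    then show ?thesis using M by (simp add: s_def)
  qed
  have "(\<lambda>n. \<integral>x. s n x \<partial>lborel) \<longlonglongrightarrow> (\<integral>x. grad g x \<bullet> b \<partial>lborel)"
  proof (rule integral_dominated_convergence[where w="\<lambda>x. M * indicator (cball 0 (\<bar>r\<bar> + 1)) x"])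
    show "(\<lambda>x. grad g x \<bullet> b) \<in> borel_measurable lborel"
      using cG by (auto intro!: borel_measurable_continuous_onI continuous_intros)
    show "integrable lborel (\<lambda>x. M * indicator (cball (0::'a) (\<bar>r\<bar> + 1)) x)"
      using emeasure_lborel_cball_finite
      by (intro integrable_mult_right integrable_real_indicator) auto
  qed (use si lim dom in auto)
  then have "(\<integral>x. grad g x \<bullet> b \<partial>lborel) = 0" by (simp add: s0 LIMSEQ_const_iff)
  then show "(\<integral>x. partial_deriv b g x \<partial>lborel) = 0" unfolding p .
qed

lemma integrable_quadratic_form:
  assumes \<phi>: "C1_compact_support \<phi>" and V: "continuous_on UNIV V"
  shows "integrable lborel (\<lambda>x. (norm (grad \<phi> x))\<^sup>2 - V x * (\<phi> x)\<^sup>2)"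
proof -
  from \<phi> obtain r where C: "C1 \<phi>" and r: "\<And>x. norm x > r \<Longrightarrow> \<phi> x = 0"
    unfolding C1_compact_support_iff by blast
  have "\<And>x. norm x > r \<Longrightarrow> grad \<phi> x = 0" using grad_zero_outside r by blast
  moreover have "continuous_on UNIV (grad \<phi>)" "continuous_on UNIV \<phi>"
    using C C1_continuous_on by (auto simp: C1_iff_grad)
  ultimately show ?thesis
    using V r by (intro integrable_continuous_compact_support[of _ r] continuous_intros) auto
qed

section \<open>Stability criteria\<close>

text \<open>Hardy's inequality, regularised at the origin: integrate
  \<open>|\<nabla>\<phi> + a \<phi> x / (|x|\<^sup>2 + \<epsilon>)|\<^sup>2 \<ge> 0\<close> with \<open>a = (N - 2)/2\<close>.\<close>

lemma stability_from_Hardy: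
  fixes V :: "'a::euclidean_space \<Rightarrow> real"
  assumes \<phi>: "C1_compact_support \<phi>" and V: "continuous_on UNIV V" and \<epsilon>: "\<epsilon> > 0" and N: "DIM('a) \<ge> 2"
    and bound: "\<And>x. V x \<le> (real DIM('a) - 2)\<^sup>2 / 4 / (x \<bullet> x + \<epsilon>)"
  shows "(\<integral>x. ((norm (grad \<phi> x))\<^sup>2 - V x * (\<phi> x)\<^sup>2) \<partial>lborel) \<ge> 0"
proof -
  define N where "N = real DIM('a)"
  define a where "a = (N - 2) / 2"
  define \<rho> where "\<rho> x = x \<bullet> x + \<epsilon>" for x :: 'a
  have \<rho>: "\<rho> x > 0" "x \<bullet> x \<le> \<rho> x" for x using \<epsilon> by (auto simp: \<rho>_def intro: add_nonneg_pos)
  from \<phi> obtain r where C: "C1 \<phi>" and r: "\<And>x. norm x > r \<Longrightarrow> \<phi> x = 0"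
    unfolding C1_compact_support_iff by blast
  define h where "h b x = (x \<bullet> b) * inverse (\<rho> x)" for b x :: 'a
  have lin: "C1 (\<lambda>x::'a. x \<bullet> b)" "grad (\<lambda>x. x \<bullet> b) x = b" for b x :: 'a
  proof -
    have "GDERIV (\<lambda>x. x \<bullet> b) x :> b" for x :: 'a
      unfolding gderiv_def by (auto intro!: derivative_eq_intros)
    from C1_from_GDERIV[OF this] show "C1 (\<lambda>x::'a. x \<bullet> b)" "grad (\<lambda>x. x \<bullet> b) x = b"
      by (auto simp: fun_eq_iff)
  qed
  have inv: "C1 (\<lambda>x. inverse (\<rho> x))" "grad (\<lambda>x. inverse (\<rho> x)) x = - ((inverse (\<rho> x))\<^sup>2 *\<^sub>R (2 *\<^sub>R x))" for x
  proof -
    have "GDERIV (\<lambda>x. \<rho> x) x :> 2 *\<^sub>R x" for x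
      unfolding gderiv_def \<rho>_def by (auto intro!: derivative_eq_intros simp: inner_commute)
    then have G: "GDERIV (\<lambda>x. inverse (\<rho> x)) x :> - ((inverse (\<rho> x))\<^sup>2 *\<^sub>R (2 *\<^sub>R x))" for x
      using GDERIV_inverse[of \<rho> x "2 *\<^sub>R x"] \<rho>(1)[of x] by simp
    have "continuous_on UNIV (\<lambda>x::'a. - ((inverse (\<rho> x))\<^sup>2 *\<^sub>R (2 *\<^sub>R x)))"
      using \<rho>(1) unfolding \<rho>_def by (intro continuous_intros) (auto simp: less_imp_neq[symmetric])
    from C1_from_GDERIV[OF G this]
    show "C1 (\<lambda>x. inverse (\<rho> x))" "grad (\<lambda>x. inverse (\<rho> x)) x = - ((inverse (\<rho> x))\<^sup>2 *\<^sub>R (2 *\<^sub>R x))"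
      by (auto simp: fun_eq_iff)
  qed
  have h: "C1 (h b)" "grad (h b) x = inverse (\<rho> x) *\<^sub>R b - ((x \<bullet> b) * (inverse (\<rho> x))\<^sup>2 * 2) *\<^sub>R x" for b x
    unfolding h_def using lin inv by (auto simp: C1_mult)
  \<comment> \<open>\<open>g b\<close> is the component along \<open>b\<close> of the field
    \<open>\<phi>^2 x / (|x|^2 + \<epsilon>)\<close>. Its divergence \<open>D\<close> has integral
    zero and can be added to the integrand at no cost.\<close>
  define g where "g b x = (\<phi> x * \<phi> x) * h b x" for b x
  have gC: "C1 (g b)" for b unfolding g_def using C h by (intro C1_mult)
  have g: "C1_compact_support (g b)" for b
    using gC r unfolding C1_compact_support_iff g_def by auto
  have gp: "partial_deriv b (g b) x = (\<phi> x)\<^sup>2 * (inverse (\<rho> x) - 2 * (x \<bullet> b)\<^sup>2 * (inverse (\<rho> x))\<^sup>2)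
      + 2 * \<phi> x * inverse (\<rho> x) * ((x \<bullet> b) * (grad \<phi> x \<bullet> b))" if b: "b \<in> Basis" for b x
  proof -
    have "partial_deriv b (g b) x = grad (g b) x \<bullet> b" using b by (rule partial_deriv_eq_grad_inner)
    also have "grad (g b) x = (\<phi> x * \<phi> x) *\<^sub>R grad (h b) x + h b x *\<^sub>R (\<phi> x *\<^sub>R grad \<phi> x + \<phi> x *\<^sub>R grad \<phi> x)"
      unfolding g_def using C h by (simp add: C1_mult)
    also have "\<dots> \<bullet> b = (\<phi> x)\<^sup>2 * (inverse (\<rho> x) - 2 * (x \<bullet> b)\<^sup>2 * (inverse (\<rho> x))\<^sup>2)
      + 2 * \<phi> x * inverse (\<rho> x) * ((x \<bullet> b) * (grad \<phi> x \<bullet> b))"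
      using b unfolding h h_def by (simp add: inner_add_left inner_diff_left algebra_simps power2_eq_square)
    finally show ?thesis .
  qed
  define D where "D x = (\<Sum>b\<in>Basis. partial_deriv b (g b) x)" for x
  have D: "D x = (\<phi> x)\<^sup>2 * (N * inverse (\<rho> x) - 2 * (x \<bullet> x) * (inverse (\<rho> x))\<^sup>2)
      + 2 * \<phi> x * inverse (\<rho> x) * (x \<bullet> grad \<phi> x)" for x
  proof -
    have sq: "(\<Sum>b\<in>Basis. (x \<bullet> b)\<^sup>2) = x \<bullet> x"
      by (subst euclidean_inner[of x x]) (simp add: power2_eq_square)
    have mx: "(\<Sum>b\<in>Basis. (x \<bullet> b) * (grad \<phi> x \<bullet> b)) = x \<bullet> grad \<phi> x"
      by (subst euclidean_inner[of x "grad \<phi> x"]) simp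
    have "D x = (\<Sum>b\<in>Basis. (\<phi> x)\<^sup>2 * (inverse (\<rho> x) - 2 * (x \<bullet> b)\<^sup>2 * (inverse (\<rho> x))\<^sup>2)
      + 2 * \<phi> x * inverse (\<rho> x) * ((x \<bullet> b) * (grad \<phi> x \<bullet> b)))"
      unfolding D_def using gp by (intro sum.cong) auto
    also have "\<dots> = (\<phi> x)\<^sup>2 * (N * inverse (\<rho> x) - 2 * (\<Sum>b\<in>Basis. (x \<bullet> b)\<^sup>2) * (inverse (\<rho> x))\<^sup>2)
      + 2 * \<phi> x * inverse (\<rho> x) * (\<Sum>b\<in>Basis. (x \<bullet> b) * (grad \<phi> x \<bullet> b))"
      by (simp add: sum.distrib sum_subtractf sum_distrib_left[symmetric] sum_distrib_right[symmetric] N_def)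
    finally show ?thesis unfolding sq mx .
  qed
  have Di: "integrable lborel D" "(\<integral>x. D x \<partial>lborel) = 0"
    unfolding D_def using integral_partial_deriv_eq_0[OF g] by auto
  have Qi: "integrable lborel (\<lambda>x. (norm (grad \<phi> x))\<^sup>2 - V x * (\<phi> x)\<^sup>2)"
    using \<phi> V by (rule integrable_quadratic_form)
  \<comment> \<open>Adding \<open>a * D\<close> supplies the cross term of the square. What remains
    next to \<open>- V\<close> is \<open>a N i - (2 a + a^2) i^2 |x|^2\<close> times
    \<open>\<phi>^2\<close>; by \<open>i |x|^2 \<le> 1\<close> it is at least
    \<open>(a N - 2 a - a^2) i\<close>, and \<open>a = (N - 2) / 2\<close> maximises this
    coefficient.\<close>
  have "(norm (grad \<phi> x))\<^sup>2 - V x * (\<phi> x)\<^sup>2 + a * D x \<ge> 0" for x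
  proof -
    define i where "i = inverse (\<rho> x)"
    have i: "i > 0" "i * (x \<bullet> x) \<le> 1" using \<rho>[of x] by (auto simp: i_def field_simps)
    have "0 \<le> (norm (grad \<phi> x + (a * \<phi> x * i) *\<^sub>R x))\<^sup>2" by simp
    also have "\<dots> = (norm (grad \<phi> x))\<^sup>2 + 2 * a * \<phi> x * i * (x \<bullet> grad \<phi> x) + a\<^sup>2 * (\<phi> x)\<^sup>2 * i\<^sup>2 * (x \<bullet> x)"
      unfolding power2_norm_eq_inner
      by (simp add: inner_add_left inner_add_right algebra_simps power2_eq_square inner_commute)
    finally have 1: "(norm (grad \<phi> x))\<^sup>2 + 2 * a * \<phi> x * i * (x \<bullet> grad \<phi> x) \<ge> - (a\<^sup>2 * (\<phi> x)\<^sup>2 * i\<^sup>2 * (x \<bullet> x))"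
      by simp
    have a: "a \<ge> 0" using N by (simp add: a_def N_def)
    have "(2 * a + a\<^sup>2) * i * (i * (x \<bullet> x)) \<le> (2 * a + a\<^sup>2) * i * 1"
      using a i by (intro mult_left_mono) auto
    moreover have "V x \<le> (a * N - 2 * a - a\<^sup>2) * i"
    proof -
      have "V x \<le> (N - 2)\<^sup>2 / 4 * i" using bound[of x] unfolding i_def \<rho>_def N_def divide_inverse .
      also have "(N - 2)\<^sup>2 / 4 = a * N - 2 * a - a\<^sup>2" by (simp add: a_def diff_divide_distrib algebra_simps power2_eq_square)
      finally show ?thesis .
    qed
    ultimately have "V x \<le> a * N * i - (2 * a + a\<^sup>2) * i * (i * (x \<bullet> x))" by (simp add: algebra_simps)
    then have "V x * (\<phi> x)\<^sup>2 \<le> (a * N * i - (2 * a + a\<^sup>2) * i * (i * (x \<bullet> x))) * (\<phi> x)\<^sup>2"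
      by (rule mult_right_mono) simp
    then show ?thesis using 1 unfolding D i_def[symmetric]
      by (simp add: algebra_simps power2_eq_square)
  qed
  then have "0 \<le> (\<integral>x. ((norm (grad \<phi> x))\<^sup>2 - V x * (\<phi> x)\<^sup>2 + a * D x) \<partial>lborel)" by simp
  also have "\<dots> = (\<integral>x. ((norm (grad \<phi> x))\<^sup>2 - V x * (\<phi> x)\<^sup>2) \<partial>lborel)"
    using Qi Di by simp
  finally show ?thesis .
qed

text \<open>At a frontier point \<open>W\<close> vanishes and is differentiable, so
  \<open>W0 y\<close> is \<open>O(|y - x|)\<close>. The extra factor
  \<open>W0 y powr (p - 1)\<close> tends to 0 and makes the power \<open>o(|y - x|)\<close>, with a
  gradient that fades out continuously. For \<open>p = 1\<close> the gradient could jump across the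
  frontier.\<close>

lemma cutoff_powr_C1:
  fixes W :: "'a::euclidean_space \<Rightarrow> real"
  assumes W: "C1 W" and \<Omega>: "open \<Omega>" and pos: "\<And>x. x \<in> \<Omega> \<Longrightarrow> W x > 0"
    and zero: "\<And>x. x \<in> frontier \<Omega> \<Longrightarrow> W x = 0" and p: "p > 1"
  defines "W0 \<equiv> (\<lambda>x. if x \<in> \<Omega> then W x else 0)"
  shows "continuous_on UNIV W0" "C1 (\<lambda>x. W0 x powr p)"
    "grad (\<lambda>x. W0 x powr p) x = (p * W0 x powr (p - 1)) *\<^sub>R grad W x"
proof -
  have GW: "\<And>x. GDERIV W x :> grad W x" and CW: "continuous_on UNIV (grad W)" "continuous_on UNIV W"
    using W C1_continuous_on by (auto simp: C1_iff_grad)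
  have "continuous_on (closure \<Omega> \<union> - \<Omega>) (\<lambda>x. if x \<in> \<Omega> then W x else 0)"
    using \<Omega> zero continuous_on_subset[OF CW(2), of "closure \<Omega>"]
    by (intro continuous_on_cases) (auto simp: frontier_def interior_open)
  moreover have "closure \<Omega> \<union> - \<Omega> = UNIV" using closure_subset by auto
  ultimately show cont: "continuous_on UNIV W0" unfolding W0_def by simp
  have W0nn: "W0 x \<ge> 0" for x using pos by (auto simp: W0_def less_imp_le)
  have contp: "continuous_on UNIV (\<lambda>x. W0 x powr q)" if "q > 0" for q
    using that W0nn cont by (intro continuous_on_powr') auto
  have G: "GDERIV (\<lambda>x. W0 x powr p) x :> (p * W0 x powr (p - 1)) *\<^sub>R grad W x" for x
  proof (cases "x \<in> \<Omega>")
    case True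
    have "DERIV (\<lambda>t. t powr p) (W x) :> p * W x powr (p - 1)"
      using pos[OF True] by (rule has_real_derivative_powr)
    from GDERIV_DERIV_compose[OF GW this]
    have "GDERIV (\<lambda>x. W x powr p) x :> (p * W0 x powr (p - 1)) *\<^sub>R grad W x"
      using True by (simp add: W0_def)
    then show ?thesis unfolding gderiv_def
      by (rule has_derivative_transform_within_open[OF _ \<Omega> True]) (simp add: W0_def)
  next
    case False
    then have x0: "W0 x = 0" by (simp add: W0_def)
    have "((\<lambda>x. W0 x powr p) has_derivative (\<lambda>h. 0)) (at x)"
    proof (cases "x \<in> closure \<Omega>")
      case False
      have "((\<lambda>x. 0::real) has_derivative (\<lambda>h. 0)) (at x)" by simp
      then show ?thesis
        by (rule has_derivative_transform_within_open[of _ _ _ _ "- closure \<Omega>"])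
           (use False closure_subset in \<open>auto simp: W0_def\<close>)
    next
      case True
      then have Wx: "W x = 0" using False \<Omega> zero by (simp add: frontier_def interior_open)
      \<comment> \<open>Majorant of the difference quotient on \<open>\<Omega>\<close>: split
        \<open>W y\<close> into its first-order remainder and its linear part, divide by
        \<open>|y - x|\<close>, and keep one factor \<open>W0 y powr (p - 1)\<close>.\<close>
      define H where "H y = (norm ((W y - W x) - (y - x) \<bullet> grad W x) / norm (y - x) + norm (grad W x)) * W0 y powr (p - 1)" for y
      show ?thesis
      proof (rule has_derivativeI_sandwich[of 1 _ _ _ _ H])
        fix y assume "y \<noteq> x"
        then have n: "norm (y - x) > 0" by simp
        show "norm (W0 y powr p - W0 x powr p - 0) / norm (y - x) \<le> H y"
        proof (cases "y \<in> \<Omega>")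
          case True
          have "W y \<le> norm ((W y - W x) - (y - x) \<bullet> grad W x) + \<bar>(y - x) \<bullet> grad W x\<bar>" using Wx by simp
          also have "\<dots> \<le> norm ((W y - W x) - (y - x) \<bullet> grad W x) + norm (y - x) * norm (grad W x)"
            using Cauchy_Schwarz_ineq2 by simp
          also have "\<dots> = norm (y - x) * (norm ((W y - W x) - (y - x) \<bullet> grad W x) / norm (y - x) + norm (grad W x))"
            using n by (simp add: field_simps)
          finally have "W y * W y powr (p - 1) \<le> norm (y - x) * (norm ((W y - W x) - (y - x) \<bullet> grad W x) / norm (y - x) + norm (grad W x)) * W y powr (p - 1)"
            by (rule mult_right_mono) simp
          moreover have "W y * W y powr (p - 1) = W y powr p"
            using pos[OF True] by (simp add: powr_mult_base)
          ultimately have "W y powr p \<le> norm (y - x) * H y"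
            using True by (simp add: H_def W0_def mult.assoc)
          then show ?thesis using n True x0 by (simp add: W0_def field_simps)
        next
          case False
          then show ?thesis using x0 by (simp add: W0_def H_def)
        qed
      next
        have "((\<lambda>y. norm ((W y - W x) - (y - x) \<bullet> grad W x) / norm (y - x)) \<longlongrightarrow> 0) (at x)"
          using GW[of x] unfolding gderiv_def has_derivative_iff_norm by simp
        moreover have "((\<lambda>y. W0 y powr (p - 1)) \<longlongrightarrow> W0 x powr (p - 1)) (at x)"
          using contp[of "p - 1"] p by (simp add: continuous_on_def)
        ultimately have "(H \<longlongrightarrow> (0 + norm (grad W x)) * W0 x powr (p - 1)) (at x)"
          unfolding H_def by (intro tendsto_mult tendsto_add tendsto_const)
        then show "(H \<longlongrightarrow> 0) (at x)" using x0 by simp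
      qed auto
    qed
    then show ?thesis using x0 p by (simp add: gderiv_def)
  qed
  have "continuous_on UNIV (\<lambda>x. (p * W0 x powr (p - 1)) *\<^sub>R grad W x)"
    using contp[of "p - 1"] p CW by (intro continuous_on_scaleR continuous_on_mult continuous_on_const) auto
  from C1_from_GDERIV[OF G this] show "C1 (\<lambda>x. W0 x powr p)"
    "grad (\<lambda>x. W0 x powr p) x = (p * W0 x powr (p - 1)) *\<^sub>R grad W x" by (auto simp: fun_eq_iff)
qed

lemma integral_pos_continuous:
  fixes h :: "'a::euclidean_space \<Rightarrow> real"
  assumes h: "continuous_on UNIV h" "integrable lborel h" "\<And>x. h x \<ge> 0" and x0: "h x0 > 0"
  shows "(\<integral>x. h x \<partial>lborel) > 0"
proof -
  have "open (h -` {h x0 / 2<..})" using h(1) by (intro open_vimage) auto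
  then obtain e where e: "e > 0" "ball x0 e \<subseteq> h -` {h x0 / 2<..}"
    using x0 by (force elim: openE)
  have fin: "emeasure lborel (ball x0 e) < \<infinity>" using emeasure_lborel_ball_finite by blast
  have "0 < h x0 / 2 * measure lborel (ball x0 e)"
    using content_ball_pos[OF e(1), of x0] x0 by (simp add: measure_completion)
  also have "\<dots> = (\<integral>x. h x0 / 2 * indicator (ball x0 e) x \<partial>lborel)"
    using fin by simp
  also have "\<dots> \<le> (\<integral>x. h x \<partial>lborel)"
  proof (rule integral_mono)
    show "integrable lborel (\<lambda>x. h x0 / 2 * indicator (ball x0 e) x)"
      using fin by (intro integrable_mult_right integrable_real_indicator) auto
    show "h x0 / 2 * indicator (ball x0 e) x \<le> h x" for x
      using e(2) h(3)[of x] by (auto simp: indicator_def)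
  qed (use h in auto)
  finally show ?thesis .
qed

text \<open>The function \<open>W\<close>, cut off outside \<open>\<Omega>\<close>, is not \<open>C\<^sup>1\<close>, but its powers with exponent \<open>p > 1\<close> are.
  Testing with them and letting \<open>p\<close> tend to 1 gives the contradiction.\<close>

lemma exists_destabilizing_function:
  fixes W V :: "'a::euclidean_space \<Rightarrow> real"
  assumes W: "C2 W" and \<Omega>: "open \<Omega>" "bounded \<Omega>" and pos: "\<And>x. x \<in> \<Omega> \<Longrightarrow> W x > 0"
    and zero: "\<And>x. x \<in> frontier \<Omega> \<Longrightarrow> W x = 0" and V: "continuous_on UNIV V"
    and sub: "\<And>x. x \<in> \<Omega> \<Longrightarrow> - laplacian W x \<le> V x * W x"
    and c: "c \<in> \<Omega>" "- laplacian W c < V c * W c"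
  shows "\<exists>\<phi>. C1_compact_support \<phi> \<and> (\<integral>x. ((norm (grad \<phi> x))\<^sup>2 - V x * (\<phi> x)\<^sup>2) \<partial>lborel) < 0"
proof (rule ccontr)
  assume "\<not> ?thesis"
  then have stab: "(\<integral>x. ((norm (grad \<phi> x))\<^sup>2 - V x * (\<phi> x)\<^sup>2) \<partial>lborel) \<ge> 0" if "C1_compact_support \<phi>" for \<phi>
    using that by force
  have W1: "C1 W" and Wp: "\<And>b. b \<in> Basis \<Longrightarrow> C1 (partial_deriv b W)" using W by (auto simp: C2_def)
  have Wl: "continuous_on UNIV (laplacian W)" using W by (rule C2_continuous_on_laplacian)
  define W0 where "W0 = (\<lambda>x. if x \<in> \<Omega> then W x else 0)"
  have cut: "continuous_on UNIV W0" "C1 (\<lambda>x. W0 x powr p)"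
    "grad (\<lambda>x. W0 x powr p) x = (p * W0 x powr (p - 1)) *\<^sub>R grad W x" if "p > 1" for p x
    unfolding W0_def using cutoff_powr_C1[OF W1 \<Omega>(1) pos zero that] by auto
  have W0c: "continuous_on UNIV W0" using cut(1)[of 2] by simp
  have W0nn: "W0 x \<ge> 0" for x using pos by (auto simp: W0_def less_imp_le)
  obtain r where r: "\<And>x. norm x > r \<Longrightarrow> x \<notin> \<Omega>"
    using \<Omega>(2) unfolding bounded_iff by (meson not_le)
  have W0z: "\<And>x. norm x > r \<Longrightarrow> W0 x = 0" using r by (simp add: W0_def)
  \<comment> \<open>What is left of the quadratic form of \<open>W0 powr p\<close> after integration
    by parts: the divergence of \<open>W0^(2p-1) grad W\<close> contains
    \<open>(2p-1) W0^(2p-2) |grad W|^2\<close>, which is \<open>|grad (W0^p)|^2\<close> up to the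
    factor \<open>p^2 / (2p-1)\<close>.\<close>
  define s where "s p x = p\<^sup>2 / (2 * p - 1) * (W0 x powr (2 * p - 1) * (- laplacian W x)) - V x * W0 x powr (2 * p)" for p x
  have W0p: "continuous_on UNIV (\<lambda>x. W0 x powr q)" if "q > 0" for q
    using that W0nn W0c by (intro continuous_on_powr') auto
  have sc: "continuous_on UNIV (s p)" if "p \<ge> 1" for p
    unfolding s_def using that Wl V W0p[of "2 * p"] W0p[of "2 * p - 1"]
    by (intro continuous_on_diff continuous_on_mult continuous_on_minus continuous_on_const) auto
  have sz: "s p x = 0" if "norm x > r" for p x
    using W0z[OF that] by (simp add: s_def)
  have si: "integrable lborel (s p)" if "p \<ge> 1" for p
    using sc[OF that] sz by (rule integrable_continuous_compact_support)
  have s_nonneg: "(\<integral>x. s p x \<partial>lborel) \<ge> 0" if p: "p > 1" for p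
  proof -
    define \<phi> where "\<phi> = (\<lambda>x. W0 x powr p)"
    have \<phi>: "C1 \<phi>" "grad \<phi> x = (p * W0 x powr (p - 1)) *\<^sub>R grad W x" for x
      unfolding \<phi>_def using cut(2,3)[OF p] by auto
    have \<phi>z: "norm x > r \<Longrightarrow> \<phi> x = 0" for x using W0z by (simp add: \<phi>_def)
    then have \<phi>s: "C1_compact_support \<phi>" unfolding C1_compact_support_iff using \<phi> by blast
    \<comment> \<open>The exponent \<open>2 p - 1\<close> again exceeds 1, so the weight of the
      vector field is itself a \<open>C1\<close> cut-off power.\<close>
    define \<psi> where "\<psi> = (\<lambda>x. W0 x powr (2 * p - 1))"
    have \<psi>: "C1 \<psi>" "grad \<psi> x = ((2 * p - 1) * W0 x powr (2 * p - 2)) *\<^sub>R grad W x" for x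
      unfolding \<psi>_def using cut(2,3)[of "2 * p - 1"] p by auto
    define g where "g b x = \<psi> x * partial_deriv b W x" for b x
    have g: "C1_compact_support (g b)" if "b \<in> Basis" for b
      unfolding C1_compact_support_iff g_def using \<psi>(1) Wp[OF that] W0z
      by (auto intro!: C1_mult exI[of _ r] simp: \<psi>_def)
    define D where "D x = (\<Sum>b\<in>Basis. partial_deriv b (g b) x)" for x
    have Di: "integrable lborel D" "(\<integral>x. D x \<partial>lborel) = 0"
      unfolding D_def using integral_partial_deriv_eq_0[OF g] by auto
    have D: "D x = (2 * p - 1) * W0 x powr (2 * p - 2) * (norm (grad W x))\<^sup>2 + W0 x powr (2 * p - 1) * laplacian W x" for x
    proof -
      have "D x = (\<Sum>b\<in>Basis. \<psi> x * partial_deriv b (partial_deriv b W) x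
          + (2 * p - 1) * W0 x powr (2 * p - 2) * ((grad W x \<bullet> b) * (grad W x \<bullet> b)))"
        unfolding D_def
      proof (intro sum.cong refl)
        fix b :: 'a assume b: "b \<in> Basis"
        have "partial_deriv b (g b) x = grad (g b) x \<bullet> b" using b by (rule partial_deriv_eq_grad_inner)
        also have "grad (g b) x = \<psi> x *\<^sub>R grad (partial_deriv b W) x + partial_deriv b W x *\<^sub>R grad \<psi> x"
          unfolding g_def using \<psi>(1) Wp[OF b] by (rule C1_mult)
        also have "\<dots> \<bullet> b = \<psi> x * (grad (partial_deriv b W) x \<bullet> b) + (grad W x \<bullet> b) * (grad \<psi> x \<bullet> b)"
          by (simp add: inner_add_left partial_deriv_eq_grad_inner[OF b, of W])
        also have "grad (partial_deriv b W) x \<bullet> b = partial_deriv b (partial_deriv b W) x"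
          by (rule partial_deriv_eq_grad_inner[OF b, symmetric])
        finally show "partial_deriv b (g b) x = \<psi> x * partial_deriv b (partial_deriv b W) x
          + (2 * p - 1) * W0 x powr (2 * p - 2) * ((grad W x \<bullet> b) * (grad W x \<bullet> b))"
          unfolding \<psi>(2) by simp
      qed
      also have "\<dots> = \<psi> x * laplacian W x + (2 * p - 1) * W0 x powr (2 * p - 2) * (grad W x \<bullet> grad W x)"
        unfolding laplacian_def sum.distrib euclidean_inner[of "grad W x" "grad W x"] sum_distrib_left ..
      finally show ?thesis by (simp add: \<psi>_def power2_norm_eq_inner)
    qed
    have "(norm (grad \<phi> x))\<^sup>2 - V x * (\<phi> x)\<^sup>2 = s p x + p\<^sup>2 / (2 * p - 1) * D x" for x
    proof -
      have a: "(W0 x powr (p - 1))\<^sup>2 = W0 x powr (2 * p - 2)"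
        using W0nn[of x] powr_powr[of "W0 x" "p - 1" 2] by (simp add: algebra_simps)
      have b: "(W0 x powr p)\<^sup>2 = W0 x powr (2 * p)"
        using W0nn[of x] powr_powr[of "W0 x" p 2] by (simp add: algebra_simps)
      have "(norm (grad \<phi> x))\<^sup>2 = p\<^sup>2 * W0 x powr (2 * p - 2) * (norm (grad W x))\<^sup>2"
        using p unfolding \<phi>(2) by (simp add: power_mult_distrib a)
      moreover have "p\<^sup>2 / (2 * p - 1) * D x = p\<^sup>2 * W0 x powr (2 * p - 2) * (norm (grad W x))\<^sup>2
          + p\<^sup>2 / (2 * p - 1) * (W0 x powr (2 * p - 1) * laplacian W x)"
        unfolding D using p by (simp add: field_simps)
      ultimately show ?thesis unfolding s_def \<phi>_def b by simp
    qed
    then have "(\<integral>x. ((norm (grad \<phi> x))\<^sup>2 - V x * (\<phi> x)\<^sup>2) \<partial>lborel) = (\<integral>x. (s p x + p\<^sup>2 / (2 * p - 1) * D x) \<partial>lborel)"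
      by simp
    also have "\<dots> = (\<integral>x. s p x \<partial>lborel)" using Di si[of p] p by simp
    finally show ?thesis using stab[OF \<phi>s] by simp
  qed
  define q where "q n = 1 + inverse (real (Suc n))" for n
  have q: "1 < q n" "q n \<le> 2" for n by (auto simp: q_def field_simps)
  have q1: "q \<longlonglongrightarrow> 1" unfolding q_def using LIMSEQ_inverse_real_of_nat_add[of 1] by simp
  obtain M1 where M1: "M1 \<ge> 0" "\<And>x. \<bar>W0 x\<bar> \<le> M1"
    using bounded_continuous_compact_support[OF W0c W0z] by auto
  have bd: "\<exists>M\<ge>0. \<forall>x. norm x \<le> r \<longrightarrow> \<bar>h x\<bar> \<le> M" if "continuous_on UNIV h" for h :: "'a \<Rightarrow> real"
  proof -
    have "compact (h ` cball 0 r)"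
      by (intro compact_continuous_image continuous_on_subset[OF that] compact_cball subset_UNIV)
    then have "bounded (h ` cball 0 r)" by (rule compact_imp_bounded)
    then obtain M where "\<forall>x\<in>cball 0 r. \<bar>h x\<bar> \<le> M" unfolding bounded_iff ball_simps real_norm_def by blast
    then have "\<forall>x. norm x \<le> r \<longrightarrow> \<bar>h x\<bar> \<le> M" by simp
    then show ?thesis by (intro exI[of _ "max M 0"]) (auto simp: max_def)
  qed
  from bd[OF Wl] obtain M2 where M2: "M2 \<ge> 0" "\<And>x. norm x \<le> r \<Longrightarrow> \<bar>laplacian W x\<bar> \<le> M2" by blast
  from bd[OF V] obtain M3 where M3: "M3 \<ge> 0" "\<And>x. norm x \<le> r \<Longrightarrow> \<bar>V x\<bar> \<le> M3" by blast
  \<comment> \<open>The base is at least 1, so one constant bounds all powers of \<open>W0\<close>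
    with exponent in \<open>[0, 4]\<close>; since \<open>p \<le> 2\<close>, the exponents
    \<open>2 p - 1\<close> and \<open>2 p\<close> lie there.\<close>
  define P where "P = (M1 + 1) powr 4"
  have P: "W0 x powr t \<le> P" if "0 \<le> t" "t \<le> 4" for x t
  proof -
    have "W0 x powr t \<le> (M1 + 1) powr t" using M1(2)[of x] W0nn[of x] that by (intro powr_mono2) auto
    also have "\<dots> \<le> P" unfolding P_def using M1(1) that by (intro powr_mono) auto
    finally show ?thesis .
  qed
  have P0: "P \<ge> 0" by (simp add: P_def)
  have dom: "norm (s (q n) x) \<le> (4 * (P * M2) + M3 * P) * indicator (cball 0 r) x" for n x
  proof (cases "norm x \<le> r")
    case True
    define p where "p = q n"
    have p: "1 < p" "p \<le> 2" using q by (auto simp: p_def)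
    have k: "0 \<le> p\<^sup>2 / (2 * p - 1)" "p\<^sup>2 / (2 * p - 1) \<le> 4"
    proof -
      have "p\<^sup>2 \<le> 2\<^sup>2" using p by (intro power_mono) auto
      then show "0 \<le> p\<^sup>2 / (2 * p - 1)" "p\<^sup>2 / (2 * p - 1) \<le> 4" using p by (auto simp: field_simps)
    qed
    have "\<bar>s p x\<bar> \<le> p\<^sup>2 / (2 * p - 1) * (W0 x powr (2 * p - 1) * \<bar>laplacian W x\<bar>) + \<bar>V x\<bar> * W0 x powr (2 * p)"
      unfolding s_def by (rule order_trans[OF abs_triangle_ineq4]) (use k p in \<open>simp add: abs_mult\<close>)
    also have "\<dots> \<le> 4 * (P * M2) + M3 * P"
      using k p P[of "2 * p - 1" x] P[of "2 * p" x] P0 M2 M3 True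
      by (intro add_mono mult_mono) auto
    finally show ?thesis using True by (simp add: p_def)
  next
    case False
    then show ?thesis using sz by simp
  qed
  have lim: "(\<lambda>n. s (q n) x) \<longlonglongrightarrow> s 1 x" for x
  proof (cases "W0 x = 0")
    case True
    then show ?thesis by (simp add: s_def)
  next
    case False
    show ?thesis unfolding s_def using q1 False by (intro tendsto_intros) auto
  qed
  have "(\<lambda>n. \<integral>x. s (q n) x \<partial>lborel) \<longlonglongrightarrow> (\<integral>x. s 1 x \<partial>lborel)"
  proof (rule integral_dominated_convergence[where w="\<lambda>x. (4 * (P * M2) + M3 * P) * indicator (cball 0 r) x"])
    show "integrable lborel (\<lambda>x. (4 * (P * M2) + M3 * P) * indicator (cball (0::'a) r) x)"
      using emeasure_lborel_cball_finite
      by (intro integrable_mult_right integrable_real_indicator) auto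
    show "s 1 \<in> borel_measurable lborel" "s (q n) \<in> borel_measurable lborel" for n
      using si[of 1] si[of "q n"] q(1)[of n] by (auto intro: borel_measurable_integrable)
  qed (use lim dom in auto)
  then have "(\<integral>x. s 1 x \<partial>lborel) \<ge> 0"
    by (rule LIMSEQ_le_const) (use s_nonneg q in auto)
  moreover have "(\<integral>x. - s 1 x \<partial>lborel) > 0"
  proof (rule integral_pos_continuous)
    \<comment> \<open>In the limit the integrand is the defect of the subsolution inequality times
      \<open>W0\<close>: nonnegative everywhere and positive at \<open>c\<close>.\<close>
    have eq: "- s 1 x = (V x * W0 x + laplacian W x) * W0 x" for x
      using W0nn[of x] by (simp add: s_def power2_eq_square algebra_simps)
    show "continuous_on UNIV (\<lambda>x. - s 1 x)" "integrable lborel (\<lambda>x. - s 1 x)"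
      using sc[of 1] si[of 1] by (auto intro: continuous_intros)
    show "- s 1 x \<ge> 0" for x
      unfolding eq using sub[of x] pos[of x] by (auto simp: W0_def)
    show "- s 1 c > 0"
      unfolding eq using c pos[of c] by (auto simp: W0_def)
  qed
  ultimately show False using si[of 1] by simp
qed

section \<open>The radial initial value problem\<close>

lemma DERIV_le_imp_le:
  fixes A B :: "real \<Rightarrow> real"
  assumes "a \<le> b" "continuous_on {a..b} A" "continuous_on {a..b} B"
    and "\<And>x. a < x \<Longrightarrow> x < b \<Longrightarrow> (A has_real_derivative A' x) (at x)"
    and "\<And>x. a < x \<Longrightarrow> x < b \<Longrightarrow> (B has_real_derivative B' x) (at x)"
    and "\<And>x. a < x \<Longrightarrow> x < b \<Longrightarrow> A' x \<le> B' x" and "A a \<le> B a"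
  shows "A b \<le> B b"
proof (cases "a = b")
  case False
  have "B a - A a \<le> B b - A b"
  proof (rule DERIV_nonneg_imp_increasing_open[of a b "\<lambda>x. B x - A x"])
    fix x assume "a < x" "x < b"
    then show "\<exists>y. ((\<lambda>x. B x - A x) has_real_derivative y) (at x) \<and> 0 \<le> y"
      using assms(4-6)[of x] by (intro exI[of _ "B' x - A' x"]) (auto intro!: derivative_intros)
  qed (use assms in \<open>auto intro!: continuous_intros\<close>)
  then show ?thesis using assms(7) by simp
qed (use assms in simp)

text \<open>In divergence form \<open>(t^(N-1) w')' = - t^(N-1) g \<le> - c t^(N-1)\<close>, so
  \<open>h\<close> below is nonincreasing. The initial condition only says that \<open>w\<close> has
  one-sided derivative 0 at 0, not that \<open>w'\<close> has a limit there, so the smallness of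
  \<open>h\<close> near 0 has to be extracted separately.\<close>

lemma radial_deriv_upper_bound:
  fixes w w' g :: "real \<Rightarrow> real" and N :: nat
  assumes w0: "(w has_real_derivative 0) (at 0 within {0..})"
    and w: "\<And>t. 0 < t \<Longrightarrow> t \<le> r \<Longrightarrow> (w has_real_derivative w' t) (at t)"
    and w': "\<And>t. 0 < t \<Longrightarrow> t \<le> r \<Longrightarrow> (w' has_real_derivative - ((real N - 1) / t * w' t) - g t) (at t)"
    and g: "\<And>t. 0 < t \<Longrightarrow> t \<le> r \<Longrightarrow> c \<le> g t" and N: "N \<ge> 1" and r: "r > 0"
  shows "w' r \<le> - c * r / N"
proof -
  define h where "h t = t ^ (N - 1) * w' t + c * t ^ N / N" for t
  have h': "(h has_real_derivative t ^ (N - 1) * (c - g t)) (at t)" if "0 < t" "t \<le> r" for t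
  proof -
    obtain n where n: "N = Suc n" using N by (cases N) auto
    show ?thesis
    proof (cases n)
      case 0
      then show ?thesis unfolding h_def using n w'[OF that]
        by (auto intro!: derivative_eq_intros)
    next
      case (Suc m)
      have "((\<lambda>t. t ^ n) has_real_derivative real n * t ^ m) (at t)"
        "((\<lambda>t. t ^ N) has_real_derivative real N * t ^ n) (at t)"
        using DERIV_pow[of n t] DERIV_pow[of N t] n Suc by auto
      then have "((\<lambda>t. t ^ n * w' t + c * t ^ N / N) has_real_derivative
        t ^ n * (- ((real N - 1) / t * w' t) - g t) + real n * t ^ m * w' t + c * (real N * t ^ n) / N) (at t)"
        by (intro DERIV_add DERIV_mult' DERIV_cdivide DERIV_cmult w'[OF that])
      moreover have "t ^ n * (- ((real N - 1) / t * w' t) - g t) + real n * t ^ m * w' t + c * (real N * t ^ n) / N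
        = t ^ (N - 1) * (c - g t)"
        using that n Suc by (simp add: field_simps)
      ultimately show ?thesis unfolding h_def using n by simp
    qed
  qed
  have dec: "h r \<le> h \<xi>" if "0 < \<xi>" "\<xi> \<le> r" for \<xi>
  proof (rule DERIV_nonpos_imp_nonincreasing[OF that(2)])
    fix x assume "\<xi> \<le> x" "x \<le> r"
    then show "\<exists>y. (h has_real_derivative y) (at x) \<and> y \<le> 0"
      using h'[of x] g[of x] that
      by (intro exI[of _ "x ^ (N - 1) * (c - g x)"]) (auto intro!: mult_nonneg_nonpos)
  qed
  \<comment> \<open>The mean value theorem turns a small difference quotient at 0 into a single
    point \<open>z\<close> near 0 with \<open>w' z < \<epsilon>\<close>. Because \<open>h\<close> is
    monotone, one such point is enough.\<close>
  have "h r \<le> \<epsilon> * (1 + \<bar>c\<bar>)" if \<epsilon>: "0 < \<epsilon>" "\<epsilon> < 1" for \<epsilon>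
  proof -
    have "((\<lambda>t. (w t - w 0) / (t - 0)) \<longlongrightarrow> 0) (at 0 within {0..})"
      using w0 by (simp add: has_field_derivative_iff)
    then have "eventually (\<lambda>t. (w t - w 0) / t < \<epsilon>) (at 0 within {0..})"
      using \<epsilon> by (auto dest: order_tendstoD(2))
    then obtain d where d: "d > 0" "\<And>t. 0 < t \<Longrightarrow> t < d \<Longrightarrow> (w t - w 0) / t < \<epsilon>"
      by (auto simp: eventually_at)
    define t where "t = min (d / 2) (min \<epsilon> r)"
    have t: "0 < t" "t < d" "t \<le> \<epsilon>" "t \<le> r" using d \<epsilon> r by (auto simp: t_def)
    have "continuous_on {0..t} w"
    proof (rule continuous_on_subset)
      show "continuous_on {0..r} w" unfolding continuous_on_eq_continuous_within
      proof
        fix x assume x: "x \<in> {0..r}"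
        show "continuous (at x within {0..r}) w"
        proof (cases "x = 0")
          case True
          have "continuous (at 0 within {0..}) w" using w0 by (rule DERIV_continuous)
          then show ?thesis using True continuous_within_subset[of 0 "{0..}" w "{0..r}"] by auto
        next
          case False
          then have "isCont w x" using w[of x] x by (auto intro: DERIV_isCont)
          then show ?thesis by (rule continuous_at_imp_continuous_at_within)
        qed
      qed
    qed (use t in auto)
    moreover have "w differentiable (at x)" if "0 < x" "x < t" for x
      using w[of x] that t by (auto simp: real_differentiable_def)
    ultimately obtain l z where z: "0 < z" "z < t" "(w has_real_derivative l) (at z)" "w t - w 0 = (t - 0) * l"
      using MVT[of 0 t w] t by blast
    have "l = w' z" using z w[of z] t DERIV_unique by fastforce
    then have "w' z < \<epsilon>" using z(4) d(2)[OF t(1,2)] t by simp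
    have "h z \<le> \<epsilon> * 1 + \<bar>c\<bar> * \<epsilon>" unfolding h_def
    proof (rule add_mono)
      have "z ^ (N - 1) * w' z \<le> z ^ (N - 1) * \<epsilon>" using z \<open>w' z < \<epsilon>\<close> by (intro mult_left_mono) auto
      also have "\<dots> \<le> 1 * \<epsilon>" using z t \<epsilon> by (intro mult_right_mono power_le_one) auto
      finally show "z ^ (N - 1) * w' z \<le> \<epsilon> * 1" by simp
      have "c * z ^ N / N \<le> \<bar>c\<bar> * z ^ N / N" using z by (intro divide_right_mono mult_right_mono) auto
      also have "\<dots> \<le> \<bar>c\<bar> * z ^ N / 1" using z N by (intro divide_left_mono) auto
      also have "\<dots> \<le> \<bar>c\<bar> * z ^ 1 / 1" using z t \<epsilon> N by (intro divide_right_mono mult_left_mono power_decreasing) auto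
      also have "\<dots> \<le> \<bar>c\<bar> * \<epsilon>" using z t by (auto intro: mult_left_mono)
      finally show "c * z ^ N / N \<le> \<bar>c\<bar> * \<epsilon>" .
    qed
    then show ?thesis using dec[of z] z t by (simp add: algebra_simps)
  qed
  note small = this
  have "h r \<le> 0"
  proof (rule ccontr)
    assume "\<not> h r \<le> 0"
    define \<epsilon> where "\<epsilon> = min (1/2) (h r / (2 * (1 + \<bar>c\<bar>)))"
    have "0 < \<epsilon>" "\<epsilon> < 1" using \<open>\<not> h r \<le> 0\<close> by (auto simp: \<epsilon>_def)
    from small[OF this] have "h r \<le> \<epsilon> * (1 + \<bar>c\<bar>)" .
    also have "\<dots> \<le> h r / (2 * (1 + \<bar>c\<bar>)) * (1 + \<bar>c\<bar>)" by (intro mult_right_mono) (auto simp: \<epsilon>_def)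
    also have "\<dots> = h r / 2" by (simp add: field_simps)
    finally show False using \<open>\<not> h r \<le> 0\<close> by simp
  qed
  moreover have "h r = r ^ (N - 1) * (w' r + c * r / N)"
    unfolding h_def using N by (cases N) (auto simp: algebra_simps)
  moreover have "r ^ (N - 1) > 0" using r by simp
  ultimately have "w' r + c * r / N \<le> 0" by (metis mult_pos_pos not_le)
  then show ?thesis by simp
qed

lemma radial_ivp_DERIV:
  assumes "radial_ivp N g \<alpha> w" "r > 0"
  shows "(w has_real_derivative deriv w r) (at r)"
    "(deriv w has_real_derivative - ((real N - 1) / r * deriv w r) - g (w r)) (at r)"
proof -
  have d: "w differentiable (at r)" "deriv w differentiable (at r)"
    "deriv (deriv w) r = - ((real N - 1) / r * deriv w r) - g (w r)"
    using assms unfolding radial_ivp_def by (auto simp: algebra_simps eq_neg_iff_add_eq_0)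
  then show "(w has_real_derivative deriv w r) (at r)"
    "(deriv w has_real_derivative - ((real N - 1) / r * deriv w r) - g (w r)) (at r)"
    using DERIV_deriv_iff_real_differentiable by metis+
qed

lemma radial_ivp_continuous_on:
  assumes "radial_ivp N g \<alpha> w" shows "continuous_on {0..} w"
  unfolding continuous_on_eq_continuous_within
proof
  fix x :: real assume "x \<in> {0..}"
  then consider "x = 0" | "x > 0" by force
  then show "continuous (at x within {0..}) w"
  proof cases
    case 1
    then show ?thesis using assms unfolding radial_ivp_def by (auto intro: DERIV_continuous)
  next
    case 2
    show ?thesis
      using DERIV_isCont[OF radial_ivp_DERIV(1)[OF assms 2]] by (rule continuous_at_imp_continuous_at_within)
  qed
qed

lemma radial_ivp_deriv_bounds:
  assumes w: "radial_ivp N g \<alpha> w" and N: "N \<ge> 1" and r: "r > 0"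
    and c: "\<And>t. 0 < t \<Longrightarrow> t \<le> r \<Longrightarrow> c1 \<le> g (w t) \<and> g (w t) \<le> c2"
  shows "c1 * r / N \<le> - deriv w r" "- deriv w r \<le> c2 * r / N"
proof -
  have w0: "(w has_real_derivative 0) (at 0 within {0..})" using w by (simp add: radial_ivp_def)
  have "deriv w r \<le> - c1 * r / N"
    using radial_ivp_DERIV[OF w] c N r
    by (intro radial_deriv_upper_bound[where g="\<lambda>t. g (w t)", OF w0]) blast+
  then show "c1 * r / N \<le> - deriv w r" by simp
  \<comment> \<open>The other side is the same estimate for \<open>- w\<close>, whose source term is
    \<open>- g (w t)\<close>.\<close>
  have "- deriv w r \<le> - (- c2) * r / N"
  proof (rule radial_deriv_upper_bound[where g="\<lambda>t. - g (w t)" and w="\<lambda>t. - w t" and w'="\<lambda>t. - deriv w t"])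
    show "((\<lambda>t. - w t) has_real_derivative 0) (at 0 within {0..})"
      using w0 by (auto intro!: derivative_eq_intros)
    fix t assume t: "0 < t" "t \<le> r"
    show "((\<lambda>t. - w t) has_real_derivative - deriv w t) (at t)"
      using radial_ivp_DERIV(1)[OF w t(1)] by (rule DERIV_minus)
    show "((\<lambda>t. - deriv w t) has_real_derivative - ((real N - 1) / t * - deriv w t) - - g (w t)) (at t)"
      by (rule DERIV_cong[OF DERIV_minus[OF radial_ivp_DERIV(2)[OF w t(1)]]]) simp
    show "- c2 \<le> - g (w t)" using c[OF t] by simp
  qed (use N r in auto)
  then show "- deriv w r \<le> c2 * r / N" by simp
qed

text \<open>Near 0 the source is within \<open>e / 2\<close> of \<open>g \<alpha>\<close>, and
  integrating \<open>t^(N-1)\<close> produces the factor \<open>1 / N\<close>. The limit is the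
  common value of the pure second derivatives at the origin, and it is what makes the radial
  function twice differentiable there.\<close>

lemma radial_ivp_deriv_quotient_limit:
  assumes w: "radial_ivp N g \<alpha> w" and N: "N \<ge> 1" and g: "isCont g \<alpha>"
  shows "((\<lambda>r. deriv w r / r) \<longlongrightarrow> - g \<alpha> / N) (at_right 0)"
proof (rule tendstoI)
  fix e :: real assume e: "e > 0"
  have w0: "w 0 = \<alpha>" using w by (simp add: radial_ivp_def)
  have "(w \<longlongrightarrow> \<alpha>) (at 0 within {0..})"
    using radial_ivp_continuous_on[OF w] w0 by (auto simp: continuous_on_def)
  then have "((\<lambda>t. g (w t)) \<longlongrightarrow> g \<alpha>) (at 0 within {0..})"
    using g by (rule isCont_tendsto_compose[rotated])
  then have "eventually (\<lambda>t. dist (g (w t)) (g \<alpha>) < e / 2) (at 0 within {0..})"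
    using e by (intro tendstoD) auto
  then obtain d where d: "d > 0" "\<And>t. 0 < t \<Longrightarrow> t < d \<Longrightarrow> \<bar>g (w t) - g \<alpha>\<bar> < e / 2"
    by (auto simp: eventually_at dist_real_def)
  have "\<bar>deriv w r / r - - g \<alpha> / N\<bar> < e" if r: "0 < r" "r < d" for r
  proof -
    have "g \<alpha> - e / 2 \<le> g (w t) \<and> g (w t) \<le> g \<alpha> + e / 2" if "0 < t" "t \<le> r" for t
      using d(2)[of t] that r by (auto simp: abs_if split: if_splits)
    from radial_ivp_deriv_bounds[OF w N r(1) this]
    have 1: "(g \<alpha> - e / 2) * r / N \<le> - deriv w r" "- deriv w r \<le> (g \<alpha> + e / 2) * r / N" by auto
    have "(g \<alpha> - e / 2) / N \<le> - deriv w r / r" "- deriv w r / r \<le> (g \<alpha> + e / 2) / N"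
      using 1 r by (auto simp: field_simps)
    moreover have "e / 2 / N \<le> e / 2" using N e by (simp add: field_simps)
    ultimately show ?thesis using e by (simp add: diff_divide_distrib add_divide_distrib abs_less_iff)
  qed
  then show "eventually (\<lambda>r. dist (deriv w r / r) (- g \<alpha> / N) < e) (at_right 0)"
    using d(1) by (auto simp: eventually_at_right dist_real_def)
qed

lemma radial_ivp_deriv_limit:
  assumes w: "radial_ivp N g \<alpha> w" and N: "N \<ge> 1" and g: "isCont g \<alpha>"
  shows "(deriv w \<longlongrightarrow> 0) (at_right 0)"
proof -
  have "((\<lambda>r. deriv w r / r * r) \<longlongrightarrow> - g \<alpha> / N * 0) (at_right 0)"
    by (intro tendsto_mult radial_ivp_deriv_quotient_limit[OF assms] tendsto_ident_at)
  then have "((\<lambda>r. deriv w r / r * r) \<longlongrightarrow> 0) (at_right 0)" by simp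
  moreover have "eventually (\<lambda>r. deriv w r / r * r = deriv w r) (at_right (0::real))"
    by (rule eventually_mono[OF eventually_at_right_less]) simp
  ultimately show ?thesis by (rule Lim_transform_eventually)
qed

text \<open>The energies below are differentiable only for positive \<open>t\<close>; this lets
  their limit at \<open>0+\<close> act as the initial value.\<close>

lemma nonincreasing_from_right_limit:
  fixes G :: "real \<Rightarrow> real"
  assumes "\<And>t. 0 < t \<Longrightarrow> \<exists>y. (G has_real_derivative y) (at t) \<and> y \<le> 0"
    and "(G \<longlongrightarrow> l) (at_right 0)" and "r > 0"
  shows "G r \<le> l"
proof (rule tendsto_lowerbound[OF assms(2)])
  have "G r \<le> G t" if "0 < t" "t < r" for t
    by (rule DERIV_nonpos_imp_nonincreasing) (use assms(1) that in auto)
  then show "eventually (\<lambda>t. G r \<le> G t) (at_right 0)"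
    using assms(3) by (auto simp: eventually_at_right intro!: exI[of _ r])
qed simp

lemma radial_ivp_tendsto_0:
  assumes w: "radial_ivp N g \<alpha> w" shows "(w \<longlongrightarrow> \<alpha>) (at_right 0)"
proof -
  have "(w \<longlongrightarrow> \<alpha>) (at 0 within {0..})"
    using radial_ivp_continuous_on[OF w] w by (auto simp: continuous_on_def radial_ivp_def)
  then show ?thesis by (rule tendsto_within_subset) auto
qed

text \<open>For \<open>d = w - v\<close> and \<open>e = w' - v'\<close> the weighted energy
  \<open>(d^2 + e^2) exp (- (1 + L) t)\<close> decreases: the singular friction term
  \<open>- (N - 1) e^2 / t\<close> has the good sign, and the remaining terms are at most
  \<open>(1 + L) 2 |d| |e|\<close>. Equal initial values give uniqueness.\<close>

lemma radial_ivp_continuous_dependence: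
  assumes w: "radial_ivp N g \<alpha> w" and v: "radial_ivp N g \<beta> v" and N: "N \<ge> 1"
    and g: "isCont g \<alpha>" "isCont g \<beta>"
    and lip: "\<And>t. t > 0 \<Longrightarrow> \<bar>g (w t) - g (v t)\<bar> \<le> L * \<bar>w t - v t\<bar>" and L: "L \<ge> 0" and r: "r \<ge> 0"
  shows "(w r - v r)\<^sup>2 \<le> (\<alpha> - \<beta>)\<^sup>2 * exp ((1 + L) * r)"
proof (cases "r = 0")
  case True
  then show ?thesis using w v by (simp add: radial_ivp_def)
next
  case False
  then have r: "r > 0" using r by simp
  define E where "E t = ((w t - v t)\<^sup>2 + (deriv w t - deriv v t)\<^sup>2) * exp (- (1 + L) * t)" for t
  have "E r \<le> ((\<alpha> - \<beta>)\<^sup>2 + (0 - 0)\<^sup>2) * exp (- (1 + L) * 0)"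
  proof (rule nonincreasing_from_right_limit[OF _ _ r])
    show "(E \<longlongrightarrow> ((\<alpha> - \<beta>)\<^sup>2 + (0 - 0)\<^sup>2) * exp (- (1 + L) * 0)) (at_right 0)"
      unfolding E_def by (intro tendsto_intros radial_ivp_tendsto_0[OF w] radial_ivp_tendsto_0[OF v]
        radial_ivp_deriv_limit[OF w N g(1)] radial_ivp_deriv_limit[OF v N g(2)])
    fix t :: real assume t: "t > 0"
    define d e k where "d = w t - v t" and "e = deriv w t - deriv v t" and "k = g (w t) - g (v t)"
    define y where "y = (2 * d * e + 2 * e * (- ((real N - 1) / t * e) - k)) * exp (- (1 + L) * t)
      + (- (1 + L)) * (d\<^sup>2 + e\<^sup>2) * exp (- (1 + L) * t)"
    have "(E has_real_derivative y) (at t)"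
    proof -
      have "((\<lambda>t. w t - v t) has_real_derivative e) (at t)"
        unfolding e_def by (intro DERIV_diff radial_ivp_DERIV(1)[OF w t] radial_ivp_DERIV(1)[OF v t])
      moreover have "((\<lambda>t. deriv w t - deriv v t) has_real_derivative - ((real N - 1) / t * e) - k) (at t)"
        unfolding e_def k_def
        by (rule DERIV_cong[OF DERIV_diff[OF radial_ivp_DERIV(2)[OF w t] radial_ivp_DERIV(2)[OF v t]]])
           (simp add: algebra_simps diff_divide_distrib)
      moreover have "((\<lambda>t. ((p t)\<^sup>2 + (q t)\<^sup>2) * exp (c * t)) has_real_derivative
          (2 * p t * p' + 2 * q t * q') * exp (c * t) + c * ((p t)\<^sup>2 + (q t)\<^sup>2) * exp (c * t)) (at t)"
        if "(p has_real_derivative p') (at t)" "(q has_real_derivative q') (at t)" for p q p' q' c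
        using that by (auto intro!: derivative_eq_intros simp: algebra_simps)
      ultimately have "(E has_real_derivative
          (2 * (w t - v t) * e + 2 * (deriv w t - deriv v t) * (- ((real N - 1) / t * e) - k)) * exp (- (1 + L) * t)
          + (- (1 + L)) * ((w t - v t)\<^sup>2 + (deriv w t - deriv v t)\<^sup>2) * exp (- (1 + L) * t)) (at t)"
        unfolding E_def by blast
      then show ?thesis
        unfolding d_def[symmetric] e_def[symmetric] y_def .
    qed
    moreover have "y \<le> 0"
    proof -
      have "2 * d * e + 2 * e * (- ((real N - 1) / t * e) - k) = 2 * d * e - 2 * ((real N - 1) / t * e\<^sup>2) - 2 * e * k"
        by (simp add: algebra_simps power2_eq_square)
      also have "\<dots> \<le> 2 * \<bar>d\<bar> * \<bar>e\<bar> + 2 * \<bar>e\<bar> * (L * \<bar>d\<bar>)"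
      proof -
        have "2 * d * e \<le> 2 * \<bar>d\<bar> * \<bar>e\<bar>" by (metis abs_ge_self abs_mult abs_numeral)
        moreover have "- (2 * e * k) \<le> 2 * \<bar>e\<bar> * (L * \<bar>d\<bar>)"
        proof -
          have "- (2 * e * k) \<le> \<bar>2 * e * k\<bar>" by simp
          also have "\<dots> = 2 * \<bar>e\<bar> * \<bar>k\<bar>" by (simp add: abs_mult)
          also have "\<dots> \<le> 2 * \<bar>e\<bar> * (L * \<bar>d\<bar>)" using lip[OF t] by (intro mult_left_mono) (auto simp: k_def d_def)
          finally show ?thesis .
        qed
        moreover have "(real N - 1) / t * e\<^sup>2 \<ge> 0" using N t by simp
        ultimately show ?thesis by linarith
      qed
      also have "\<dots> = (1 + L) * (2 * \<bar>d\<bar> * \<bar>e\<bar>)" by (simp add: algebra_simps)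
      also have "\<dots> \<le> (1 + L) * (d\<^sup>2 + e\<^sup>2)"
        using L sum_squares_bound[of "\<bar>d\<bar>" "\<bar>e\<bar>"] by (intro mult_left_mono) auto
      finally have le: "2 * d * e + 2 * e * (- ((real N - 1) / t * e) - k) \<le> (1 + L) * (d\<^sup>2 + e\<^sup>2)" .
      show ?thesis unfolding y_def using mult_right_mono[OF le exp_ge_zero[of "- (1 + L) * t"]]
        unfolding mult_minus_left by linarith
    qed
    ultimately show "\<exists>y. (E has_real_derivative y) (at t) \<and> y \<le> 0" by blast
  qed
  then have "((w r - v r)\<^sup>2 + (deriv w r - deriv v r)\<^sup>2) * exp (- (1 + L) * r) \<le> (\<alpha> - \<beta>)\<^sup>2" by (simp add: E_def)
  then have "((w r - v r)\<^sup>2 + (deriv w r - deriv v r)\<^sup>2) \<le> (\<alpha> - \<beta>)\<^sup>2 * exp ((1 + L) * r)"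
    by (simp add: exp_minus field_simps exp_diff exp_add)
  then show ?thesis using zero_le_power2[of "deriv w r - deriv v r"] by linarith
qed

text \<open>With \<open>\<Phi>' = g\<close>, friction makes \<open>w'^2 / 2 + \<Phi> w\<close>
  nonincreasing from its starting value \<open>\<Phi> \<alpha>\<close>. Oddness of \<open>g\<close>
  makes \<open>\<Phi>\<close> even, and positivity makes it increasing on the positive axis, so
  \<open>|w|\<close> cannot exceed \<open>\<alpha>\<close>. A general \<open>g\<close> is kept
  because the bound serves both \<open>f\<close> and its truncation.\<close>

lemma radial_ivp_energy_bound:
  assumes w: "radial_ivp N g \<alpha> w" and N: "N \<ge> 1" and \<alpha>: "\<alpha> > 0" and r: "r \<ge> 0"
    and g: "continuous_on UNIV g" "\<And>u. g (- u) = - g u" "\<And>u. u > 0 \<Longrightarrow> g u > 0"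
  shows "\<bar>w r\<bar> \<le> \<alpha>"
proof (cases "r = 0")
  case True
  then show ?thesis using w \<alpha> by (simp add: radial_ivp_def)
next
  case False
  then have r: "r > 0" using r by simp
  have gc: "isCont g u" for u using g(1) by (simp add: continuous_on_eq_continuous_at)
  obtain \<Phi> where "\<forall>u. (\<Phi> has_vector_derivative g u) (at u)"
    using einterval_antiderivative[of "-\<infinity>" "\<infinity>" g] gc by auto
  then have \<Phi>: "(\<Phi> has_real_derivative g u) (at u)" for u by (simp add: has_real_derivative_iff_has_vector_derivative)
  have "((\<lambda>u. \<Phi> (- u) - \<Phi> u) has_real_derivative 0) (at u)" for u
    by (rule DERIV_cong[OF DERIV_diff[OF \<Phi>[of "- u", unfolded DERIV_mirror] \<Phi>[of u]]]) (simp add: g(2))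
  then have "\<Phi> (- u) - \<Phi> u = \<Phi> (- 0) - \<Phi> 0" for u
    using DERIV_isconst_all[of "\<lambda>u. \<Phi> (- u) - \<Phi> u" u 0] by blast
  then have even: "\<Phi> \<bar>u\<bar> = \<Phi> u" for u by (auto simp: abs_if)
  have inc: "\<Phi> a < \<Phi> b" if "0 \<le> a" "a < b" for a b
  proof (rule DERIV_pos_imp_increasing_open[OF that(2)])
    show "\<exists>y. (\<Phi> has_real_derivative y) (at x) \<and> 0 < y" if "a < x" for x
      using \<Phi>[of x] g(3)[of x] that \<open>0 \<le> a\<close> by auto
    show "continuous_on {a..b} \<Phi>"
      using \<Phi> by (intro continuous_at_imp_continuous_on ballI DERIV_isCont)
  qed
  define G where "G t = (deriv w t)\<^sup>2 / 2 + \<Phi> (w t)" for t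
  have "G r \<le> 0\<^sup>2 / 2 + \<Phi> \<alpha>"
  proof (rule nonincreasing_from_right_limit[OF _ _ r])
    have "((\<lambda>t. \<Phi> (w t)) \<longlongrightarrow> \<Phi> \<alpha>) (at_right 0)"
      using radial_ivp_tendsto_0[OF w] \<Phi> by (intro isCont_tendsto_compose[of _ \<Phi>] DERIV_isCont)
    then show "(G \<longlongrightarrow> 0\<^sup>2 / 2 + \<Phi> \<alpha>) (at_right 0)"
      unfolding G_def by (intro tendsto_intros radial_ivp_deriv_limit[OF w N gc]) auto
    fix t :: real assume t: "t > 0"
    have "((\<lambda>t. \<Phi> (w t)) has_real_derivative g (w t) * deriv w t) (at t)"
      using DERIV_chain2[OF \<Phi> radial_ivp_DERIV(1)[OF w t]] .
    moreover have "((\<lambda>t. (p t)\<^sup>2 / 2) has_real_derivative p t * p') (at t)"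
      if "(p has_real_derivative p') (at t)" for p p'
      using that by (auto intro!: derivative_eq_intros)
    ultimately have "(G has_real_derivative deriv w t * (- ((real N - 1) / t * deriv w t) - g (w t)) + g (w t) * deriv w t) (at t)"
      unfolding G_def using radial_ivp_DERIV(2)[OF w t] by (intro DERIV_add)
    then have "(G has_real_derivative - ((real N - 1) / t * (deriv w t)\<^sup>2)) (at t)"
      by (rule DERIV_cong) (simp add: algebra_simps power2_eq_square)
    moreover have "- ((real N - 1) / t * (deriv w t)\<^sup>2) \<le> 0" using N t by simp
    ultimately show "\<exists>y. (G has_real_derivative y) (at t) \<and> y \<le> 0" by blast
  qed
  moreover have "\<Phi> \<bar>w r\<bar> \<le> G r" by (simp add: G_def even)
  ultimately have "\<Phi> \<bar>w r\<bar> \<le> \<Phi> \<alpha>" by simp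
  then show ?thesis using inc[of \<alpha> "\<bar>w r\<bar>"] \<alpha> by fastforce
qed

text \<open>The derivative at 0 is one-sided and the equation concerns positive \<open>r\<close>
  only; this permits passing to the extensional representative.\<close>

lemma radial_ivp_cong:
  assumes w: "radial_ivp N g \<alpha> w" and eq: "\<And>r. r \<ge> 0 \<Longrightarrow> v r = w r"
  shows "radial_ivp N g \<alpha> v"
proof -
  have ev: "eventually (\<lambda>t. v t = w t) (nhds r)" if "r > 0" for r
  proof -
    have "eventually (\<lambda>t. t > 0) (nhds r)" using that by (intro eventually_nhds_in_open[of "{0<..}", simplified]) auto
    then show ?thesis by (rule eventually_mono) (use eq in auto)
  qed
  have d: "deriv v r = deriv w r" if "r > 0" for r
    using ev[OF that] by (intro deriv_cong_ev) auto
  have ev2: "eventually (\<lambda>t. deriv v t = deriv w t) (nhds r)" if "r > 0" for r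
  proof -
    have "eventually (\<lambda>t. t > 0) (nhds r)" using that by (intro eventually_nhds_in_open[of "{0<..}", simplified]) auto
    then show ?thesis by (rule eventually_mono) (use d in auto)
  qed
  have "(v has_real_derivative 0) (at 0 within {0..})"
    using w unfolding radial_ivp_def
    by (auto intro!: has_field_derivative_transform_within[of w 0 0 "{0..}" 1 v] simp: eq)
  moreover have "v differentiable (at r) \<and> deriv v differentiable (at r) \<and>
        deriv (deriv v) r + (real N - 1) / r * deriv v r + g (v r) = 0" if r: "r > 0" for r
  proof -
    have "(v has_real_derivative deriv w r) (at r)"
      using DERIV_cong_ev[OF refl ev[OF r] refl, of "deriv w r"] radial_ivp_DERIV(1)[OF w r] by blast
    moreover have 2: "(deriv v has_real_derivative - ((real N - 1) / r * deriv w r) - g (w r)) (at r)"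
      using DERIV_cong_ev[OF refl ev2[OF r] refl, of "- ((real N - 1) / r * deriv w r) - g (w r)"]
        radial_ivp_DERIV(2)[OF w r] by blast
    ultimately show ?thesis using DERIV_imp_deriv[OF 2] d[OF r] eq[of r] r
      by (auto simp: real_differentiable_def)
  qed
  ultimately show ?thesis using w eq[of 0] unfolding radial_ivp_def by auto
qed

text \<open>Banach's fixed point theorem for \<open>y(r) = exp (- k r) w(r)\<close>: with \<open>k\<^sup>2 = 2 L\<close> the weight makes the
  integral operator a contraction on all of \<open>[0, \<infinity>)\<close>. The values on the negative half-line are
  frozen at \<open>r = 0\<close> to work with bounded continuous functions on the real line.\<close>

lemma radial_ivp_exists_bounded:
  fixes g :: "real \<Rightarrow> real" and N :: nat
  assumes N: "N \<ge> 1" and B: "\<And>u. \<bar>g u\<bar> \<le> B" and L: "L > 0" "\<And>u v. \<bar>g u - g v\<bar> \<le> L * \<bar>u - v\<bar>"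
  shows "\<exists>w. radial_ivp N g \<alpha> w"
proof -
  have "L-lipschitz_on UNIV g" using L by (auto simp: lipschitz_on_def dist_real_def)
  then have gc: "continuous_on UNIV g" by (rule lipschitz_on_continuous_on)
  have B0: "B \<ge> 0" using B[of 0] by linarith
  define k where "k = sqrt (2 * L)"
  have k: "k > 0" "k\<^sup>2 = 2 * L" using L by (auto simp: k_def)
  define h where "h y t = g (exp (k * t) * apply_bcontfun y t)" for y :: "real \<Rightarrow>\<^sub>C real" and t
  \<comment> \<open>Multiplying the equation by \<open>s^(N-1)\<close> and integrating gives
    \<open>s^(N-1) w'(s) = - J y s\<close>. So \<open>- I\<close> is the future derivative,
    \<open>K\<close> integrates once more, and the problem becomes
    \<open>w = \<alpha> - K\<close>.\<close>
  define J where "J y s = integral {0..s} (\<lambda>t. t ^ (N - 1) * h y t)" for y s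
  define I where "I y s = J y s / s ^ (N - 1)" for y s
  define K where "K y r = integral {0..r} (I y)" for y r
  have hc: "continuous_on UNIV (h y)" for y
    unfolding h_def by (intro continuous_on_compose2[OF gc] continuous_intros) auto
  have intc: "continuous_on {0..b} (\<lambda>t. t ^ (N - 1) * h y t)" for y b
    by (intro continuous_intros continuous_on_subset[OF hc subset_UNIV])
  have J0: "J y 0 = 0" for y by (simp add: J_def)
  have J': "(J y has_real_derivative s ^ (N - 1) * h y s) (at s)" if "s > 0" for y s
  proof -
    have "(J y has_real_derivative s ^ (N - 1) * h y s) (at s within {0..s + 1})"
      unfolding J_def using that by (intro integral_has_real_derivative[OF intc]) auto
    then show ?thesis using that by (simp add: at_within_Icc_at)
  qed
  have Jc: "continuous_on {0..b} (J y)" for y b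
    unfolding J_def using integrable_continuous_interval[OF intc] by (rule indefinite_integral_continuous_1)
  have Jb: "J y s \<le> B * s ^ N / N \<and> - J y s \<le> B * s ^ N / N" if "s \<ge> 0" for y s
  proof -
    have p: "((\<lambda>s. B * s ^ N / N) has_real_derivative B * s ^ (N - 1)) (at s)" for s :: real
      using N by (auto intro!: derivative_eq_intros)
    have c: "continuous_on {0..s} (\<lambda>s. B * s ^ N / N)" by (intro continuous_intros) (use N in auto)
    have z: "s ^ (N - 1) * h y s \<le> B * s ^ (N - 1)" "- (s ^ (N - 1) * h y s) \<le> B * s ^ (N - 1)" if "s > 0" for s
    proof -
      have "\<bar>h y s\<bar> \<le> B" unfolding h_def by (rule B)
      then have "h y s \<le> B" "- h y s \<le> B" by auto
      then show "s ^ (N - 1) * h y s \<le> B * s ^ (N - 1)" "- (s ^ (N - 1) * h y s) \<le> B * s ^ (N - 1)"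
        using mult_left_mono[of "h y s" B "s ^ (N - 1)"] mult_left_mono[of "- h y s" B "s ^ (N - 1)"] that
        by (auto simp: mult.commute)
    qed
    show ?thesis
      using DERIV_le_imp_le[OF that Jc c J' p z(1)] DERIV_le_imp_le[OF that continuous_on_minus[OF Jc] c DERIV_minus[OF J'] p z(2)]
        J0 N by (simp add: power_0_left)
  qed
  have Ib: "\<bar>I y s\<bar> \<le> B * s" if "s \<ge> 0" for y s
  proof (cases "s = 0")
    case True
    then show ?thesis by (simp add: I_def J0)
  next
    case False
    then have s: "s > 0" using that by simp
    have "\<bar>J y s\<bar> \<le> B * s ^ N / N" using Jb[OF that, of y] by auto
    also have "\<dots> \<le> B * s ^ N / 1" using N B0 s by (intro divide_left_mono) auto
    also have "\<dots> = B * s * s ^ (N - 1)" using N by (cases N) auto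
    finally show ?thesis unfolding I_def using s by (simp add: field_simps)
  qed
  have I': "(I y has_real_derivative h y s - (real N - 1) / s * I y s) (at s)" if s: "s > 0" for y s
  proof -
    have "((\<lambda>s. s ^ (N - 1)) has_real_derivative real (N - 1) * s ^ (N - 1) / s) (at s)"
    proof (cases "N - 1")
      case (Suc m)
      then show ?thesis using DERIV_pow[of "Suc m" s UNIV] s unfolding Suc by simp
    qed simp
    from DERIV_divide[OF J'[OF s] this]
    have "((\<lambda>s. J y s / s ^ (N - 1)) has_real_derivative
      (s ^ (N - 1) * h y s * s ^ (N - 1) - J y s * (real (N - 1) * s ^ (N - 1) / s)) / (s ^ (N - 1) * s ^ (N - 1))) (at s)"
      using s by simp
    moreover have "(s ^ (N - 1) * h y s * s ^ (N - 1) - J y s * (real (N - 1) * s ^ (N - 1) / s)) / (s ^ (N - 1) * s ^ (N - 1))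
      = h y s - (real N - 1) / s * I y s"
      unfolding I_def using s N by (simp add: field_simps of_nat_diff)
    ultimately show ?thesis unfolding I_def by simp
  qed
  \<comment> \<open>At 0 the quotient \<open>I y 0\<close> is 0, because \<open>J y 0 = 0\<close>
    and 0 divided by anything, even by 0, is 0. The linear bound \<open>Ib\<close> makes this
    default the continuous value.\<close>
  have Ic: "continuous_on {0..} (I y)" for y
    unfolding continuous_on_def
  proof
    fix x :: real assume "x \<in> {0..}"
    then consider "x = 0" | "x > 0" by force
    then show "(I y \<longlongrightarrow> I y x) (at x within {0..})"
    proof cases
      case 1
      have "(I y \<longlongrightarrow> 0) (at 0 within {0..})"
      proof (rule Lim_null_comparison)
        show "eventually (\<lambda>s. norm (I y s) \<le> B * s) (at 0 within {0..})"
          using Ib by (auto simp: eventually_at_filter)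
        have "((\<lambda>s. B * s) \<longlongrightarrow> B * 0) (at 0 within {0..})" by (intro tendsto_intros)
        then show "((\<lambda>s. B * s) \<longlongrightarrow> 0) (at 0 within {0..})" by simp
      qed
      then show ?thesis using 1 by (simp add: I_def J0)
    next
      case 2
      have "isCont (I y) x" using I'[OF 2] by (rule DERIV_isCont)
      then show ?thesis unfolding isCont_def by (rule tendsto_within_subset) simp
    qed
  qed
  have Icb: "continuous_on {0..b} (I y)" for y b by (rule continuous_on_subset[OF Ic]) auto
  have K0: "K y 0 = 0" for y by (simp add: K_def)
  have K'w: "(K y has_real_derivative I y r) (at r within {0..b})" if "r \<in> {0..b}" for y r b
    unfolding K_def by (rule integral_has_real_derivative[OF Icb that])
  have K': "(K y has_real_derivative I y r) (at r)" if "r > 0" for y r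
    using K'w[of r "r + 1" y] that by (simp add: at_within_Icc_at)
  have Kcb: "continuous_on {0..b} (K y)" for y b
    unfolding K_def using integrable_continuous_interval[OF Icb] by (rule indefinite_integral_continuous_1)
  have Kb: "\<bar>K y r\<bar> \<le> B * r\<^sup>2 / 2" if "r \<ge> 0" for y r
  proof -
    have p: "((\<lambda>s. B * s\<^sup>2 / 2) has_real_derivative B * s) (at s)" for s :: real
      by (auto intro!: derivative_eq_intros)
    have c: "continuous_on {0..r} (\<lambda>s. B * s\<^sup>2 / 2)" by (intro continuous_intros) auto
    have z: "I y s \<le> B * s" "- I y s \<le> B * s" if "s > 0" for s using Ib[of s y] that by auto
    show ?thesis
      using DERIV_le_imp_le[OF that Kcb c K' p z(1)] DERIV_le_imp_le[OF that continuous_on_minus[OF Kcb] c DERIV_minus[OF K'] p z(2)]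
        K0 by (auto simp: abs_le_iff)
  qed
  define S where "S y r = exp (- k * max r 0) * (\<alpha> - K y (max r 0))" for y r
  have Kc: "continuous_on {0..} (K y)" for y
    unfolding continuous_on_eq_continuous_within
  proof
    fix x :: real assume x: "x \<in> {0..}"
    have "(K y has_real_derivative I y x) (at x within {0..x + 1})" using x by (intro K'w) auto
    then have "continuous (at x within {0..x + 1}) (K y)" by (rule DERIV_continuous)
    moreover have "at x within {0..x + 1} = at x within {0..}"
      by (rule at_within_nhd[of _ "{..<x + 1}"]) auto
    ultimately show "continuous (at x within {0..}) (K y)" by simp
  qed
  have Sb: "S y \<in> bcontfun" for y
  proof (rule bcontfun_normI)
    have "continuous_on UNIV (\<lambda>r. K y (max r 0))"
      by (intro continuous_on_compose2[OF Kc] continuous_intros) auto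
    then show "continuous_on UNIV (S y)" unfolding S_def by (intro continuous_intros)
    \<comment> \<open>\<open>K\<close> grows at most like \<open>B t^2 / 2\<close>, while the
      quadratic term of the exponential series gives
      \<open>t^2 / 2 \<le> exp (k t) / k^2\<close>.\<close>
    show "norm (S y r) \<le> \<bar>\<alpha>\<bar> + B / k\<^sup>2" for r
    proof -
      define t where "t = max r 0"
      have t: "t \<ge> 0" by (simp add: t_def)
      have e1: "exp (- k * t) \<le> 1" using t k by simp
      have "(k * t)\<^sup>2 / 2 \<le> exp (k * t)"
        using exp_lower_Taylor_quadratic[of "k * t"] t k by (smt (verit) mult_nonneg_nonneg)
      then have e2: "exp (- k * t) * (t\<^sup>2 / 2) \<le> 1 / k\<^sup>2"
        using k L(1) by (simp add: exp_minus field_simps power_mult_distrib)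
      have "norm (S y r) = exp (- k * t) * \<bar>\<alpha> - K y t\<bar>" by (simp add: S_def t_def abs_mult)
      also have "\<dots> \<le> exp (- k * t) * (\<bar>\<alpha>\<bar> + B * t\<^sup>2 / 2)"
        using Kb[OF t, of y] by (intro mult_left_mono) auto
      also have "\<dots> = exp (- k * t) * \<bar>\<alpha>\<bar> + B * (exp (- k * t) * (t\<^sup>2 / 2))" by (simp add: algebra_simps)
      also have "\<dots> \<le> 1 * \<bar>\<alpha>\<bar> + B * (1 / k\<^sup>2)" using e1 e2 B0 by (intro add_mono mult_right_mono mult_left_mono) auto
      finally show ?thesis by simp
    qed
  qed
  define T where "T y = Bcontfun (S y)" for y
  have T: "apply_bcontfun (T y) = S y" for y unfolding T_def by (rule Bcontfun_inverse[OF Sb])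
  have "dist (T y) (T z) \<le> 1 / 2 * dist y z" for y z
  proof (rule dist_bound)
    fix r :: real
    define t where "t = max r 0"
    define d where "d = dist y z"
    have t: "t \<ge> 0" and d: "d \<ge> 0" by (auto simp: t_def d_def)
    have hd: "\<bar>h y s - h z s\<bar> \<le> L * d * exp (k * s)" for s
    proof -
      have "\<bar>h y s - h z s\<bar> \<le> L * \<bar>exp (k * s) * y s - exp (k * s) * z s\<bar>" unfolding h_def by (rule L)
      also have "\<dots> = L * (exp (k * s) * dist (y s) (z s))"
        by (simp add: dist_real_def right_diff_distrib[symmetric] abs_mult)
      also have "\<dots> \<le> L * (exp (k * s) * d)"
        unfolding d_def using L dist_bounded[of y s z] by (intro mult_left_mono) auto
      finally show ?thesis by (simp add: mult_ac)
    qed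
    \<comment> \<open>Each of the two integrations costs a factor \<open>1 / k\<close> and keeps the
      exponential: \<open>s^(N-1) exp (k s) / k\<close> has derivative at least
      \<open>s^(N-1) exp (k s)\<close>. The one-sided bounds carry \<open>hd\<close> as a premise so
      that \<open>y\<close> and \<open>z\<close> can be exchanged at the end.\<close>
    have Jd: "J y s - J z s \<le> L * d / k * (s ^ (N - 1) * exp (k * s))" if s: "s \<ge> 0"
      and hd: "\<And>s. \<bar>h y s - h z s\<bar> \<le> L * d * exp (k * s)" for s y z
    proof (rule DERIV_le_imp_le[OF s])
      show "continuous_on {0..s} (\<lambda>s. J y s - J z s)" by (intro continuous_on_diff Jc)
      show "continuous_on {0..s} (\<lambda>s. L * d / k * (s ^ (N - 1) * exp (k * s)))" by (intro continuous_intros) (use k in auto)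
      fix x :: real assume x: "0 < x" "x < s"
      show "((\<lambda>s. J y s - J z s) has_real_derivative x ^ (N - 1) * h y x - x ^ (N - 1) * h z x) (at x)"
        by (intro DERIV_diff J' x)
      show "((\<lambda>s. L * d / k * (s ^ (N - 1) * exp (k * s))) has_real_derivative
          L * d / k * (x ^ (N - 1) * (exp (k * x) * k) + (real (N - 1) * x ^ (N - 1 - 1)) * exp (k * x))) (at x)"
        using k(1) by (auto intro!: derivative_eq_intros)
      have "x ^ (N - 1) * h y x - x ^ (N - 1) * h z x = x ^ (N - 1) * (h y x - h z x)" by (simp add: algebra_simps)
      also have "\<dots> \<le> x ^ (N - 1) * (L * d * exp (k * x))"
        using x hd[of x] by (intro mult_left_mono) auto
      also have "\<dots> = L * d / k * (x ^ (N - 1) * (exp (k * x) * k))" using k by simp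
      also have "\<dots> \<le> L * d / k * (x ^ (N - 1) * (exp (k * x) * k) + (real (N - 1) * x ^ (N - 1 - 1)) * exp (k * x))"
        using x L d k by (intro mult_left_mono) auto
      finally show "x ^ (N - 1) * h y x - x ^ (N - 1) * h z x \<le> L * d / k * (x ^ (N - 1) * (exp (k * x) * k) + (real (N - 1) * x ^ (N - 1 - 1)) * exp (k * x))" .
    qed (use J0 L d k in auto)
    have Id: "I y s - I z s \<le> L * d / k * exp (k * s)" if s: "s > 0"
      and hd: "\<And>s. \<bar>h y s - h z s\<bar> \<le> L * d * exp (k * s)" for s y z
      using Jd[OF less_imp_le[OF s] hd] s unfolding I_def diff_divide_distrib[symmetric]
      by (simp add: divide_le_eq mult_ac)
    have Kd: "K y s - K z s \<le> L * d / k\<^sup>2 * exp (k * s)" if s: "s \<ge> 0"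
      and hd: "\<And>s. \<bar>h y s - h z s\<bar> \<le> L * d * exp (k * s)" for s y z
    proof (rule DERIV_le_imp_le[OF s])
      show "continuous_on {0..s} (\<lambda>s. K y s - K z s)" by (intro continuous_on_diff Kcb)
      show "continuous_on {0..s} (\<lambda>s. L * d / k\<^sup>2 * exp (k * s))" by (intro continuous_intros) (use k in auto)
      fix x :: real assume x: "0 < x" "x < s"
      show "((\<lambda>s. K y s - K z s) has_real_derivative I y x - I z x) (at x)" by (intro DERIV_diff K' x)
      show "((\<lambda>s. L * d / k\<^sup>2 * exp (k * s)) has_real_derivative L * d / k * exp (k * x)) (at x)"
        using k(1) by (auto intro!: derivative_eq_intros simp: power2_eq_square)
      show "I y x - I z x \<le> L * d / k * exp (k * x)" using x hd by (intro Id)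
    qed (use K0 L d k in auto)
    have "\<bar>K y t - K z t\<bar> \<le> L * d / k\<^sup>2 * exp (k * t)"
      using Kd[OF t hd] Kd[of t z y] t hd by (auto simp: abs_le_iff abs_minus_commute)
    then have "exp (- k * t) * \<bar>K y t - K z t\<bar> \<le> exp (- k * t) * (L * d / k\<^sup>2 * exp (k * t))"
      by (intro mult_left_mono) auto
    also have "\<dots> = d / 2" using L k(2) by (simp add: exp_minus)
    finally show "dist (T y r) (T z r) \<le> 1 / 2 * dist y z"
      unfolding T S_def dist_real_def t_def[symmetric] d_def[symmetric]
      by (simp add: right_diff_distrib[symmetric] abs_mult abs_minus_commute)
  qed
  then obtain y where y: "T y = y"
    using banach_fix_type[of "1/2" T] by auto
  define w where "w r = exp (k * r) * y r" for r
  have w: "w r = \<alpha> - K y r" if "r \<ge> 0" for r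
  proof -
    have "y r = exp (- k * r) * (\<alpha> - K y r)" using y T[of y] that by (simp add: S_def max_def)
    then show ?thesis by (simp add: w_def exp_minus)
  qed
  have hw: "h y r = g (w r)" for r by (simp add: h_def w_def)
  have w': "(w has_real_derivative - I y r) (at r)" if r: "r > 0" for r
  proof -
    have "((\<lambda>r. \<alpha> - K y r) has_real_derivative 0 - I y r) (at r)" by (intro DERIV_diff DERIV_const K' r)
    then have "((\<lambda>r. \<alpha> - K y r) has_real_derivative - I y r) (at r)" by simp
    then show ?thesis
      by (rule has_field_derivative_transform_within_open[of _ _ _ "{0<..}"]) (use w r in auto)
  qed
  have dw: "deriv w r = - I y r" if "r > 0" for r using w'[OF that] by (rule DERIV_imp_deriv)
  have w'': "(deriv w has_real_derivative - (h y r - (real N - 1) / r * I y r)) (at r)" if r: "r > 0" for r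
    using DERIV_minus[OF I'[OF r, of y]]
    by (rule has_field_derivative_transform_within_open[of _ _ _ "{0<..}"]) (use dw r in auto)
  have "radial_ivp N g \<alpha> w"
    unfolding radial_ivp_def
  proof (intro conjI allI impI)
    show "w 0 = \<alpha>" using w[of 0] K0 by simp
    have "((\<lambda>r. \<alpha> - K y r) has_real_derivative 0 - I y 0) (at 0 within {0..1})"
      by (intro DERIV_diff DERIV_const K'w) auto
    then have "((\<lambda>r. \<alpha> - K y r) has_real_derivative 0) (at 0 within {0..1})" by (simp add: I_def J0)
    moreover have "at 0 within {0..1::real} = at 0 within {0..}"
      by (rule at_within_nhd[of _ "{..<1}"]) auto
    ultimately have "((\<lambda>r. \<alpha> - K y r) has_real_derivative 0) (at 0 within {0..})" by simp
    then show "(w has_real_derivative 0) (at 0 within {0..})"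
      by (rule has_field_derivative_transform_within[of _ _ _ _ 1]) (use w in auto)
    fix r :: real assume r: "r > 0"
    show "w differentiable (at r)" "deriv w differentiable (at r)"
      using w'[OF r] w''[OF r] by (auto simp: real_differentiable_def)
    show "deriv (deriv w) r + (real N - 1) / r * deriv w r + g (w r) = 0"
      using DERIV_imp_deriv[OF w''[OF r]] dw[OF r] hw[of r] by simp
  qed
  then show ?thesis by blast
qed

section \<open>Radial functions in space\<close>

text \<open>At the origin the norm is not differentiable, but the one-sided derivative 0 of
  \<open>h\<close> makes \<open>h (norm x) - h 0\<close> of smaller order than
  \<open>norm x\<close>. Since \<open>sgn 0 = 0\<close>, the gradient formula holds there too, and
  \<open>h'0\<close> makes it continuous.\<close>

lemma radial_C1:
  fixes h h' :: "real \<Rightarrow> real"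
  assumes h: "\<And>r. r > 0 \<Longrightarrow> (h has_real_derivative h' r) (at r)"
    and h0: "(h has_real_derivative 0) (at 0 within {0..})"
    and h'c: "continuous_on {0<..} h'" and h'0: "(h' \<longlongrightarrow> 0) (at_right 0)"
  shows "C1 (\<lambda>x::'a::euclidean_space. h (norm x))"
    "grad (\<lambda>x::'a. h (norm x)) x = h' (norm x) *\<^sub>R sgn x"
proof -
  have G: "GDERIV (\<lambda>x. h (norm x)) x :> h' (norm x) *\<^sub>R sgn x" for x :: 'a
  proof (cases "x = 0")
    case True
    have "((\<lambda>t. (h t - h 0) / (t - 0)) \<longlongrightarrow> 0) (at 0 within {0..})"
      using h0 by (simp add: has_field_derivative_iff)
    moreover have "filterlim (norm :: 'a \<Rightarrow> real) (at 0 within {0..}) (at 0)"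
      unfolding filterlim_at by (auto intro!: tendsto_eq_intros simp: eventually_at_filter)
    ultimately have "((\<lambda>y::'a. (h (norm y) - h 0) / (norm y - 0)) \<longlongrightarrow> 0) (at 0)"
      by (rule filterlim_compose)
    then have "((\<lambda>y::'a. norm ((h (norm y) - h 0) / (norm y - 0))) \<longlongrightarrow> 0) (at 0)"
      by (rule tendsto_norm_zero)
    then show ?thesis using True by (simp add: gderiv_def has_derivative_iff_norm)
  next
    case False
    then show ?thesis
      using GDERIV_DERIV_compose[OF GDERIV_norm[OF False] h] by simp
  qed
  have "continuous_on UNIV (\<lambda>x::'a. h' (norm x) *\<^sub>R sgn x)"
    unfolding continuous_on_def
  proof
    fix x :: 'a
    show "((\<lambda>x. h' (norm x) *\<^sub>R sgn x) \<longlongrightarrow> h' (norm x) *\<^sub>R sgn x) (at x)"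
    proof (cases "x = 0")
      case True
      have "filterlim (norm :: 'a \<Rightarrow> real) (at_right 0) (at 0)"
        unfolding filterlim_at by (auto intro!: tendsto_eq_intros simp: eventually_at_filter)
      then have "((\<lambda>y::'a. h' (norm y)) \<longlongrightarrow> 0) (at 0)" by (rule filterlim_compose[OF h'0])
      then have "((\<lambda>y::'a. h' (norm y) *\<^sub>R sgn y) \<longlongrightarrow> 0) (at 0)"
        by (rule tendsto_0_le[of _ _ _ 1]) (auto simp: norm_sgn intro!: always_eventually)
      then show ?thesis using True by simp
    next
      case False
      have "isCont h' (norm x)" using h'c False by (auto simp: continuous_on_eq_continuous_at)
      then have "((\<lambda>y. h' (norm y)) \<longlongrightarrow> h' (norm x)) (at x)"
        by (rule isCont_tendsto_compose) (intro tendsto_intros)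
      then show ?thesis using False by (intro tendsto_intros) auto
    qed
  qed
  from C1_from_GDERIV[OF G this]
  show "C1 (\<lambda>x::'a. h (norm x))" "grad (\<lambda>x::'a. h (norm x)) x = h' (norm x) *\<^sub>R sgn x"
    by (auto simp: fun_eq_iff)
qed

text \<open>Meant for \<open>k = w' / r\<close>: the partial derivative of \<open>w (norm x)\<close>
  along \<open>b\<close> is \<open>k (norm x) * (x \<bullet> b)\<close>. In its gradient the first
  summand has size at most \<open>r |k' r|\<close> for unit \<open>b\<close>, whence the hypothesis
  on \<open>r * k' r\<close>.\<close>

lemma radial_times_linear_C1:
  fixes k k' :: "real \<Rightarrow> real" and b :: "'a::euclidean_space"
  assumes k: "\<And>r. r > 0 \<Longrightarrow> (k has_real_derivative k' r) (at r)"
    and k0: "(k \<longlongrightarrow> k 0) (at_right 0)"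
    and k'c: "continuous_on {0<..} k'" and k'0: "((\<lambda>r. r * k' r) \<longlongrightarrow> 0) (at_right 0)"
  shows "C1 (\<lambda>x. k (norm x) * (x \<bullet> b))"
    "grad (\<lambda>x. k (norm x) * (x \<bullet> b)) x = (k' (norm x) * (x \<bullet> b)) *\<^sub>R sgn x + k (norm x) *\<^sub>R b"
proof -
  have norm0: "filterlim (norm :: 'a \<Rightarrow> real) (at_right 0) (at 0)"
    unfolding filterlim_at by (auto intro!: tendsto_eq_intros simp: eventually_at_filter)
  have kn: "((\<lambda>y::'a. k (norm y)) \<longlongrightarrow> k 0) (at 0)" by (rule filterlim_compose[OF k0 norm0])
  have G: "GDERIV (\<lambda>x. k (norm x) * (x \<bullet> b)) x :> (k' (norm x) * (x \<bullet> b)) *\<^sub>R sgn x + k (norm x) *\<^sub>R b" for x :: 'a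
  proof (cases "x = 0")
    case True
    have "((\<lambda>x. k (norm x) * (x \<bullet> b)) has_derivative (\<lambda>h. h \<bullet> (k 0 *\<^sub>R b))) (at 0)"
    proof (rule has_derivativeI_sandwich[of 1 _ _ _ _ "\<lambda>y. \<bar>k (norm y) - k 0\<bar> * norm b"])
      fix y :: 'a assume "y \<noteq> 0"
      have "k (norm y) * (y \<bullet> b) - k (norm (0::'a)) * (0 \<bullet> b) - (y - 0) \<bullet> (k 0 *\<^sub>R b) = (k (norm y) - k 0) * (y \<bullet> b)"
        by (simp add: algebra_simps)
      then have "norm (k (norm y) * (y \<bullet> b) - k (norm (0::'a)) * (0 \<bullet> b) - (y - 0) \<bullet> (k 0 *\<^sub>R b))
        = \<bar>k (norm y) - k 0\<bar> * \<bar>y \<bullet> b\<bar>" by (simp only: real_norm_def abs_mult)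
      also have "\<dots> \<le> \<bar>k (norm y) - k 0\<bar> * (norm y * norm b)"
        using Cauchy_Schwarz_ineq2[of y b] by (intro mult_left_mono) auto
      finally show "norm (k (norm y) * (y \<bullet> b) - k (norm (0::'a)) * (0 \<bullet> b) - (y - 0) \<bullet> (k 0 *\<^sub>R b)) / norm (y - 0)
        \<le> \<bar>k (norm y) - k 0\<bar> * norm b"
        using \<open>y \<noteq> 0\<close> by (simp add: field_simps)
    next
      have "((\<lambda>y::'a. \<bar>k (norm y) - k 0\<bar> * norm b) \<longlongrightarrow> \<bar>k 0 - k 0\<bar> * norm b) (at 0)"
        by (intro tendsto_intros kn)
      then show "((\<lambda>y::'a. \<bar>k (norm y) - k 0\<bar> * norm b) \<longlongrightarrow> 0) (at 0)" by simp
    qed (simp, rule bounded_linear_inner_left)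
    then show ?thesis using True by (simp add: gderiv_def)
  next
    case False
    have "GDERIV (\<lambda>x. k (norm x)) x :> k' (norm x) *\<^sub>R sgn x"
      using GDERIV_DERIV_compose[OF GDERIV_norm[OF False] k] False by simp
    moreover have "GDERIV (\<lambda>x. x \<bullet> b) x :> b"
      unfolding gderiv_def by (auto intro!: derivative_eq_intros)
    ultimately have "GDERIV (\<lambda>x. k (norm x) * (x \<bullet> b)) x :> k (norm x) *\<^sub>R b + (x \<bullet> b) *\<^sub>R (k' (norm x) *\<^sub>R sgn x)"
      by (rule GDERIV_mult)
    then show ?thesis by (rule GDERIV_subst) (simp add: mult.commute)
  qed
  have "continuous_on UNIV (\<lambda>x::'a. (k' (norm x) * (x \<bullet> b)) *\<^sub>R sgn x + k (norm x) *\<^sub>R b)"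
    unfolding continuous_on_def
  proof
    fix x :: 'a
    show "((\<lambda>x. (k' (norm x) * (x \<bullet> b)) *\<^sub>R sgn x + k (norm x) *\<^sub>R b) \<longlongrightarrow>
      (k' (norm x) * (x \<bullet> b)) *\<^sub>R sgn x + k (norm x) *\<^sub>R b) (at x)"
    proof (cases "x = 0")
      case True
      have "((\<lambda>y::'a. norm y * k' (norm y)) \<longlongrightarrow> 0) (at 0)" by (rule filterlim_compose[OF k'0 norm0])
      then have "((\<lambda>y::'a. (k' (norm y) * (y \<bullet> b)) *\<^sub>R sgn y) \<longlongrightarrow> 0) (at 0)"
      proof (rule tendsto_0_le[of _ _ _ "norm b"], intro always_eventually allI)
        fix y :: 'a
        have "norm ((k' (norm y) * (y \<bullet> b)) *\<^sub>R sgn y) \<le> \<bar>k' (norm y)\<bar> * \<bar>y \<bullet> b\<bar>"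
          by (simp add: norm_sgn abs_mult)
        also have "\<dots> \<le> \<bar>k' (norm y)\<bar> * (norm y * norm b)"
          using Cauchy_Schwarz_ineq2[of y b] by (intro mult_left_mono) auto
        finally show "norm ((k' (norm y) * (y \<bullet> b)) *\<^sub>R sgn y) \<le> norm (norm y * k' (norm y)) * norm b"
          by (simp add: abs_mult mult_ac)
      qed
      then have "((\<lambda>y::'a. (k' (norm y) * (y \<bullet> b)) *\<^sub>R sgn y + k (norm y) *\<^sub>R b) \<longlongrightarrow> 0 + k 0 *\<^sub>R b) (at 0)"
        by (intro tendsto_add tendsto_scaleR kn tendsto_const)
      then show ?thesis using True by simp
    next
      case False
      have "isCont k' (norm x)" using k'c False by (auto simp: continuous_on_eq_continuous_at)
      then have 1: "((\<lambda>y. k' (norm y)) \<longlongrightarrow> k' (norm x)) (at x)"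
        by (rule isCont_tendsto_compose) (intro tendsto_intros)
      have "isCont k (norm x)" using k[of "norm x"] False by (auto intro: DERIV_isCont)
      then have 2: "((\<lambda>y. k (norm y)) \<longlongrightarrow> k (norm x)) (at x)"
        by (rule isCont_tendsto_compose) (intro tendsto_intros)
      show ?thesis using 1 2 False by (intro tendsto_intros) auto
    qed
  qed
  from C1_from_GDERIV[OF G this]
  show "C1 (\<lambda>x. k (norm x) * (x \<bullet> b))"
    "grad (\<lambda>x. k (norm x) * (x \<bullet> b)) x = (k' (norm x) * (x \<bullet> b)) *\<^sub>R sgn x + k (norm x) *\<^sub>R b"
    by (auto simp: fun_eq_iff)
qed

lemma radial_ivp_entire_solution:
  assumes w: "radial_ivp DIM('a) g \<alpha> w" and g: "continuous_on UNIV g"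
  shows "entire_solution g (\<lambda>x::'a::euclidean_space. w (norm x))"
proof -
  define N where "N = real DIM('a)"
  have N: "N \<ge> 1" "N > 0" using DIM_positive[where 'a='a] by (auto simp: N_def Suc_le_eq)
  have gc: "isCont g u" for u using g by (simp add: continuous_on_eq_continuous_at)
  have D: "(w has_real_derivative deriv w r) (at r)"
    "(deriv w has_real_derivative - ((N - 1) / r * deriv w r) - g (w r)) (at r)" if "r > 0" for r
    using radial_ivp_DERIV[OF w that] by (auto simp: N_def)
  have wc: "continuous_on {0<..} w" and w'c: "continuous_on {0<..} (deriv w)"
    using D by (auto intro!: continuous_at_imp_continuous_on DERIV_isCont)
  have gwc: "continuous_on {0<..} (\<lambda>r. g (w r))" by (rule continuous_on_compose2[OF g wc]) auto
  have w0: "w 0 = \<alpha>" "(w has_real_derivative 0) (at 0 within {0..})" using w by (auto simp: radial_ivp_def)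
  \<comment> \<open>The value at 0 is the limit of \<open>w' / r\<close>; then
    \<open>N * k 0 = - g \<alpha>\<close> is the equation at the origin.\<close>
  define k where "k r = (if r = 0 then - g \<alpha> / N else deriv w r / r)" for r
  define k' where "k' r = (- ((N - 1) / r * deriv w r) - g (w r)) / r - deriv w r / r\<^sup>2" for r
  have k: "(k has_real_derivative k' r) (at r)" if r: "r > 0" for r
  proof -
    have "((\<lambda>r. deriv w r / r) has_real_derivative k' r) (at r)"
      using DERIV_divide[OF D(2)[OF r] DERIV_ident] r by (simp add: k'_def diff_divide_distrib power2_eq_square)
    then show ?thesis
      by (rule has_field_derivative_transform_within_open[of _ _ _ "{0<..}"]) (use r in \<open>auto simp: k_def\<close>)
  qed
  have lim: "((\<lambda>r. deriv w r / r) \<longlongrightarrow> - g \<alpha> / N) (at_right 0)"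
    using radial_ivp_deriv_quotient_limit[OF w _ gc] by (simp add: N_def Suc_le_eq)
  have k0: "(k \<longlongrightarrow> k 0) (at_right 0)"
  proof (rule Lim_transform_eventually)
    show "((\<lambda>r. deriv w r / r) \<longlongrightarrow> k 0) (at_right 0)" using lim by (simp add: k_def)
    show "eventually (\<lambda>r. deriv w r / r = k r) (at_right 0)"
      by (rule eventually_mono[OF eventually_at_right_less]) (simp add: k_def)
  qed
  have k'c: "continuous_on {0<..} k'"
    unfolding k'_def by (intro continuous_intros gwc w'c) auto
  have gw0: "((\<lambda>r. g (w r)) \<longlongrightarrow> g \<alpha>) (at_right 0)"
    by (rule isCont_tendsto_compose[OF gc radial_ivp_tendsto_0[OF w]])
  \<comment> \<open>This is \<open>r * k' r = w'' - w' / r\<close>, with \<open>w''\<close>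
    eliminated by the equation. The limits of the three terms cancel.\<close>
  have "((\<lambda>r. - (N - 1) * (deriv w r / r) - g (w r) - deriv w r / r) \<longlongrightarrow> - (N - 1) * (- g \<alpha> / N) - g \<alpha> - (- g \<alpha> / N)) (at_right 0)"
    by (intro tendsto_diff tendsto_mult tendsto_const lim gw0)
  moreover have "- (N - 1) * (- g \<alpha> / N) - g \<alpha> - (- g \<alpha> / N) = 0" using N by (simp add: field_simps)
  ultimately have "((\<lambda>r. - (N - 1) * (deriv w r / r) - g (w r) - deriv w r / r) \<longlongrightarrow> 0) (at_right 0)" by simp
  then have k'0: "((\<lambda>r. r * k' r) \<longlongrightarrow> 0) (at_right 0)"
    by (rule Lim_transform_eventually)
       (rule eventually_mono[OF eventually_at_right_less], simp add: k'_def field_simps power2_eq_square)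
  define U where "U = (\<lambda>x::'a. w (norm x))"
  have U1: "C1 U" "grad U x = deriv w (norm x) *\<^sub>R sgn x" for x
    unfolding U_def using radial_ivp_deriv_limit[OF w _ gc]
    by (auto intro!: radial_C1 D(1) w0 w'c simp: Suc_le_eq)
  have p: "partial_deriv b U = (\<lambda>x. k (norm x) * (x \<bullet> b))" if "b \<in> Basis" for b
    using that by (auto simp: fun_eq_iff partial_deriv_eq_grad_inner U1 k_def sgn_div_norm divide_inverse)
  note P = radial_times_linear_C1[OF k k0 k'c k'0]
  have "C2 U" unfolding C2_def using U1(1) P(1) p by auto
  moreover have "laplacian U x + g (U x) = 0" for x
  proof -
    have "laplacian U x = (\<Sum>b\<in>Basis. (k' (norm x) * (x \<bullet> b)) * (sgn x \<bullet> b) + k (norm x))"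
      unfolding laplacian_def by (intro sum.cong refl)
        (simp add: p partial_deriv_eq_grad_inner[of _ "\<lambda>x. k (norm x) * (x \<bullet> _)"] P(2) inner_add_left)
    also have "\<dots> = k' (norm x) * (x \<bullet> sgn x) + N * k (norm x)"
      by (simp add: sum.distrib euclidean_inner[of x "sgn x"] sum_distrib_left N_def mult.assoc)
    also have "x \<bullet> sgn x = norm x" by (simp add: sgn_div_norm power2_norm_eq_inner[symmetric] power2_eq_square field_simps)
    finally have lap: "laplacian U x = k' (norm x) * norm x + N * k (norm x)" .
    show ?thesis
    proof (cases "x = 0")
      case True
      then show ?thesis using lap N w0 by (simp add: k_def U_def)
    next
      case False
      then show ?thesis using lap by (simp add: k_def k'_def U_def field_simps power2_eq_square)
    qed
  qed
  ultimately show ?thesis unfolding entire_solution_def U_def by blast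
qed

section \<open>Solutions for the given nonlinearity\<close>

locale nonlinearity =
  fixes f :: "real \<Rightarrow> real"
  assumes standing: "standing_assumptions f"
begin

lemma DERIV_f: "(f has_real_derivative deriv f u) (at u)"
  using standing unfolding standing_assumptions_def by (simp add: DERIV_deriv_iff_real_differentiable)

lemma continuous_f: "continuous_on UNIV f"
  by (rule continuous_at_imp_continuous_on) (blast intro: DERIV_isCont DERIV_f)

lemma continuous_f': "continuous_on UNIV (deriv f)"
  using standing unfolding standing_assumptions_def by blast

lemma f_odd: "f (- u) = - f u"
  using standing unfolding standing_assumptions_def by blast

lemma f_0 [simp]: "f 0 = 0"
  using f_odd[of 0] by simp

lemma f_pos: "u > 0 \<Longrightarrow> f u > 0"
  using standing unfolding standing_assumptions_def by blast

lemma f'_even: "deriv f (- u) = deriv f u"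
proof -
  have "((\<lambda>u. f (- u)) has_real_derivative - deriv f (- u)) (at u)"
    using DERIV_f[of "- u"] by (simp add: DERIV_mirror)
  then have "((\<lambda>u. - f u) has_real_derivative - deriv f (- u)) (at u)" by (simp only: f_odd)
  from DERIV_unique[OF this DERIV_minus[OF DERIV_f]] show ?thesis by simp
qed

lemma f'_strict_mono:
  assumes "0 \<le> a" "a < b" shows "deriv f a < deriv f b"
proof (rule DERIV_pos_imp_increasing_open[OF assms(2)])
  fix x assume "a < x" "x < b"
  then have "x > 0" using assms by simp
  then have "deriv f differentiable (at x)" "deriv (deriv f) x > 0"
    using standing unfolding standing_assumptions_def by auto
  then show "\<exists>y. (deriv f has_real_derivative y) (at x) \<and> 0 < y"
    using DERIV_deriv_iff_real_differentiable by blast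
qed (rule continuous_on_subset[OF continuous_f' subset_UNIV])

lemma f'_nonneg: "deriv f u \<ge> 0"
proof -
  have pos: "deriv f v > 0" if "v > 0" for v
    using that standing unfolding standing_assumptions_def by blast
  have "isCont (deriv f) 0" using continuous_f' by (simp add: continuous_on_eq_continuous_at)
  then have "(deriv f \<longlongrightarrow> deriv f 0) (at_right 0)" unfolding isCont_def by (rule tendsto_within_subset) simp
  then have "deriv f 0 \<ge> 0"
  proof (rule tendsto_lowerbound)
    show "eventually (\<lambda>u. 0 \<le> deriv f u) (at_right 0)"
      by (rule eventually_mono[OF eventually_at_right_less]) (use pos in \<open>auto intro: less_imp_le\<close>)
  qed simp
  then show ?thesis using pos[of u] pos[of "- u"] f'_even[of u] by (cases u "0::real" rule: linorder_cases) auto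
qed

lemma f'_mono:
  assumes "\<bar>a\<bar> \<le> b" shows "deriv f a \<le> deriv f b"
proof -
  have "deriv f a = deriv f \<bar>a\<bar>" using f'_even[of a] by (simp add: abs_if)
  also have "\<dots> \<le> deriv f b" using f'_strict_mono[of "\<bar>a\<bar>" b] assms by (cases "\<bar>a\<bar> = b") auto
  finally show ?thesis .
qed

lemma f'_pos: "u > 0 \<Longrightarrow> deriv f u > 0"
  using standing unfolding standing_assumptions_def by blast

text \<open>On \<open>[- a, a]\<close> the slope of \<open>f\<close> never exceeds
  \<open>f' a\<close>, because \<open>f'\<close> is even and increasing in the modulus. So the
  tangent inequality reaches negative \<open>b\<close>, where \<open>f\<close> is concave.\<close>

lemma f_secant_le:
  assumes "\<bar>b\<bar> \<le> a" shows "f a - f b \<le> deriv f a * (a - b)"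
proof (cases "a = b")
  case False
  then have "b < a" using assms by auto
  from MVT2[OF this DERIV_f] obtain z where z: "b < z" "z < a" "f a - f b = (a - b) * deriv f z" by blast
  then have "deriv f z \<le> deriv f a" using assms by (intro f'_mono) auto
  then show ?thesis using z \<open>b < a\<close> by (simp add: mult.commute)
qed simp

lemma f_secant_less:
  assumes "0 \<le> b" "b < a" shows "f a - f b < deriv f a * (a - b)"
proof -
  from MVT2[OF assms(2) DERIV_f] obtain z where z: "b < z" "z < a" "f a - f b = (a - b) * deriv f z" by blast
  then have "deriv f z < deriv f a" using assms by (intro f'_strict_mono) auto
  then show ?thesis using z assms(2) by (simp add: mult.commute)
qed

lemma f_lipschitz:
  assumes "\<bar>a\<bar> \<le> c" "\<bar>b\<bar> \<le> c" shows "\<bar>f a - f b\<bar> \<le> deriv f c * \<bar>a - b\<bar>"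
proof -
  have *: "\<bar>f a - f b\<bar> \<le> deriv f c * \<bar>a - b\<bar>" if "a < b" "\<bar>a\<bar> \<le> c" "\<bar>b\<bar> \<le> c" for a b
  proof -
    from MVT2[OF that(1) DERIV_f] obtain z where z: "a < z" "z < b" "f b - f a = (b - a) * deriv f z" by blast
    have "deriv f z \<le> deriv f c" using z that by (intro f'_mono) auto
    moreover have "\<bar>f a - f b\<bar> = deriv f z * \<bar>a - b\<bar>"
    proof -
      have "\<bar>f a - f b\<bar> = \<bar>(b - a) * deriv f z\<bar>" using z(3) by (metis abs_minus_commute)
      then show ?thesis using f'_nonneg[of z] by (simp add: abs_mult abs_minus_commute mult.commute)
    qed
    ultimately show ?thesis by (simp add: mult_right_mono)
  qed
  show ?thesis
    using *[of a b] *[of b a] assms by (cases a b rule: linorder_cases) (auto simp: abs_minus_commute)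
qed

section \<open>Well-posedness of the radial problem for \<open>f\<close>\<close>

lemma radial_ivp_abs_le:
  assumes "radial_ivp N f \<alpha> w" "N \<ge> 1" "\<alpha> > 0" "r \<ge> 0"
  shows "\<bar>w r\<bar> \<le> \<alpha>"
  using radial_ivp_energy_bound[OF assms continuous_f f_odd f_pos] .

lemma radial_ivp_exists:
  assumes N: "N \<ge> 1" and \<alpha>: "\<alpha> > 0"
  shows "\<exists>w. radial_ivp N f \<alpha> w"
proof -
  \<comment> \<open>Truncating the nonlinearity is harmless: the energy keeps solutions in \<open>[- \<alpha>, \<alpha>]\<close>.\<close>
  define c where "c u = max (- \<alpha>) (min \<alpha> u)" for u
  have c: "\<bar>c u\<bar> \<le> \<alpha>" "\<bar>c u - c v\<bar> \<le> \<bar>u - v\<bar>" for u v using \<alpha> by (auto simp: c_def abs_le_iff)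
  have cid: "c u = u" if "\<bar>u\<bar> \<le> \<alpha>" for u using that by (auto simp: c_def)
  define g where "g u = f (c u)" for u
  have L: "deriv f \<alpha> > 0" using \<alpha> by (rule f'_pos)
  have B: "\<bar>g u\<bar> \<le> deriv f \<alpha> * \<alpha>" for u
  proof -
    have "\<bar>g u\<bar> \<le> deriv f \<alpha> * \<bar>c u\<bar>" using f_lipschitz[of "c u" \<alpha> 0] c(1) \<alpha> by (simp add: g_def)
    also have "\<dots> \<le> deriv f \<alpha> * \<alpha>" using c(1) L by (intro mult_left_mono) auto
    finally show ?thesis .
  qed
  have lip: "\<bar>g u - g v\<bar> \<le> deriv f \<alpha> * \<bar>u - v\<bar>" for u v
  proof -
    have "\<bar>g u - g v\<bar> \<le> deriv f \<alpha> * \<bar>c u - c v\<bar>" unfolding g_def using c(1) by (intro f_lipschitz)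
    also have "\<dots> \<le> deriv f \<alpha> * \<bar>u - v\<bar>" using c(2) L by (intro mult_left_mono) auto
    finally show ?thesis .
  qed
  obtain w where w: "radial_ivp N g \<alpha> w" using radial_ivp_exists_bounded[OF N B L lip] by blast
  have "\<bar>w r\<bar> \<le> \<alpha>" if "r \<ge> 0" for r
  proof (rule radial_ivp_energy_bound[OF w N \<alpha> that])
    show "continuous_on UNIV g"
      unfolding g_def c_def by (intro continuous_on_compose2[OF continuous_f] continuous_intros) auto
    show "g (- u) = - g u" for u
    proof -
      have "c (- u) = - c u" using \<alpha> by (auto simp: c_def max_def min_def)
      then show ?thesis by (simp add: g_def f_odd)
    qed
    show "g u > 0" if "u > 0" for u
      unfolding g_def using that \<alpha> by (intro f_pos) (auto simp: c_def)
  qed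
  then have "g (w r) = f (w r)" if "r > 0" for r using that cid[of "w r"] by (simp add: g_def)
  then have "radial_ivp N f \<alpha> w" using w unfolding radial_ivp_def by simp
  then show ?thesis by blast
qed

lemma radial_ivp_dependence:
  assumes w: "radial_ivp N f \<alpha> w" and v: "radial_ivp N f \<beta> v" and N: "N \<ge> 1"
    and \<alpha>: "0 < \<alpha>" "\<alpha> \<le> c" and \<beta>: "0 < \<beta>" "\<beta> \<le> c" and r: "r \<ge> 0"
  shows "(w r - v r)\<^sup>2 \<le> (\<alpha> - \<beta>)\<^sup>2 * exp ((1 + deriv f c) * r)"
proof (rule radial_ivp_continuous_dependence[OF w v N])
  show "isCont f \<alpha>" "isCont f \<beta>" using DERIV_f by (auto intro: DERIV_isCont)
  show "\<bar>f (w t) - f (v t)\<bar> \<le> deriv f c * \<bar>w t - v t\<bar>" if "t > 0" for t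
    using radial_ivp_abs_le[OF w N \<alpha>(1), of t] radial_ivp_abs_le[OF v N \<beta>(1), of t] that \<alpha> \<beta>
    by (intro f_lipschitz) auto
qed (use f'_nonneg r in auto)

text \<open>Discharges the definite description: existence, plus the dependence estimate with equal
  initial values, singles out one extensional solution.\<close>

lemma radial_sol_ivp:
  assumes N: "N \<ge> 1" and \<alpha>: "\<alpha> > 0"
  shows "radial_ivp N f \<alpha> (\<lambda>r. radial_sol N f r \<alpha>)"
proof -
  obtain w where w: "radial_ivp N f \<alpha> w" using radial_ivp_exists[OF assms] by blast
  have "\<exists>!w. radial_ivp N f \<alpha> w \<and> w \<in> extensional {0..}"
  proof (rule ex1I[of _ "restrict w {0..}"])
    show "radial_ivp N f \<alpha> (restrict w {0..}) \<and> restrict w {0..} \<in> extensional {0..}"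
      using radial_ivp_cong[OF w] by simp
    fix v assume v: "radial_ivp N f \<alpha> v \<and> v \<in> extensional {0..}"
    have "v r = w r" if "r \<ge> 0" for r
      using radial_ivp_dependence[OF w _ N \<alpha> order_refl \<alpha> order_refl that, of v] v by simp
    then show "v = restrict w {0..}" using v by (auto simp: fun_eq_iff restrict_def extensional_def)
  qed
  from theI'[OF this] show ?thesis unfolding radial_sol_def by blast
qed

text \<open>Approaching from below keeps all solutions in \<open>[- \<alpha>, \<alpha>]\<close>,
  where \<open>deriv f \<alpha>\<close> is a common Lipschitz constant.\<close>

lemma radial_sol_tendsto:
  assumes N: "N \<ge> 1" and \<alpha>: "\<alpha> > 0" and \<beta>: "\<And>n. 0 < \<beta> n" "\<And>n. \<beta> n \<le> \<alpha>" "\<beta> \<longlonglongrightarrow> \<alpha>" and r: "r \<ge> 0"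
  shows "(\<lambda>n. radial_sol N f r (\<beta> n)) \<longlonglongrightarrow> radial_sol N f r \<alpha>"
proof -
  have "(\<lambda>n. radial_sol N f r (\<beta> n) - radial_sol N f r \<alpha>) \<longlonglongrightarrow> 0"
  proof (rule tendsto_0_le[of "\<lambda>n. \<beta> n - \<alpha>" _ _ "sqrt (exp ((1 + deriv f \<alpha>) * r))"])
    show "(\<lambda>n. \<beta> n - \<alpha>) \<longlonglongrightarrow> 0" using \<beta>(3) by (simp add: LIM_zero_iff)
    have "\<bar>radial_sol N f r (\<beta> n) - radial_sol N f r \<alpha>\<bar> \<le> \<bar>\<beta> n - \<alpha>\<bar> * sqrt (exp ((1 + deriv f \<alpha>) * r))" for n
    proof -
      have "sqrt ((radial_sol N f r (\<beta> n) - radial_sol N f r \<alpha>)\<^sup>2) \<le> sqrt ((\<beta> n - \<alpha>)\<^sup>2 * exp ((1 + deriv f \<alpha>) * r))"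
        using radial_ivp_dependence[OF radial_sol_ivp[OF N \<beta>(1)] radial_sol_ivp[OF N \<alpha>] N \<beta>(1) \<beta>(2) \<alpha> order_refl r]
        by (rule real_sqrt_le_mono)
      then show ?thesis by (simp add: real_sqrt_mult)
    qed
    then show "eventually (\<lambda>n. norm (radial_sol N f r (\<beta> n) - radial_sol N f r \<alpha>) \<le> norm (\<beta> n - \<alpha>) * sqrt (exp ((1 + deriv f \<alpha>) * r))) sequentially"
      by (simp only: real_norm_def) (rule always_eventually, blast)
  qed
  then show ?thesis by (simp add: LIM_zero_iff)
qed

end

section \<open>Stable solutions for small initial values\<close>

text \<open>First-exit argument: at the first time some function vanishes, all are nonnegative and
  were positive before, so none that vanishes there can have positive derivative. The barrier
  condition may name another vanishing index \<open>k\<close>, which matters at corners of the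
  region, where the derivative of \<open>g i\<close> itself may be 0.\<close>

lemma positivity_barrier:
  fixes g g' :: "'i \<Rightarrow> real \<Rightarrow> real"
  assumes I: "finite I"
    and g: "\<And>i r. i \<in> I \<Longrightarrow> 0 < r \<Longrightarrow> r < R \<Longrightarrow> (g i has_real_derivative g' i r) (at r)"
    and init: "\<And>i. i \<in> I \<Longrightarrow> eventually (\<lambda>r. g i r > 0) (at_right 0)"
    and barrier: "\<And>i r. i \<in> I \<Longrightarrow> 0 < r \<Longrightarrow> r < R \<Longrightarrow> (\<And>j. j \<in> I \<Longrightarrow> g j r \<ge> 0) \<Longrightarrow> g i r = 0 \<Longrightarrow>
      \<exists>k\<in>I. g k r = 0 \<and> g' k r > 0"
    and r: "0 < r" "r < R" and i: "i \<in> I"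
  shows "g i r > 0"
proof (rule ccontr)
  assume neg: "\<not> g i r > 0"
  have "eventually (\<lambda>r. \<forall>i\<in>I. g i r > 0) (at_right 0)"
    using I init by (intro eventually_ball_finite) auto
  then obtain d where d: "d > 0" "\<And>t i. 0 < t \<Longrightarrow> t < d \<Longrightarrow> i \<in> I \<Longrightarrow> g i t > 0"
    by (auto simp: eventually_at_right_field)
  have dr: "d \<le> r" using d(2)[of r i] neg r i by force
  \<comment> \<open>The functions are controlled only for positive arguments; cutting at
    \<open>d / 2\<close> loses no bad time and makes the bad set compact.\<close>
  define B where "B = (\<Union>i\<in>I. {t \<in> {d/2..r}. g i t \<le> 0})"
  have "closed B" unfolding B_def
  proof (intro closed_UN I ballI)
    fix j assume j: "j \<in> I"
    have "continuous_on {d/2..r} (g j)"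
    proof (intro continuous_at_imp_continuous_on ballI)
      fix x assume "x \<in> {d/2..r}"
      then show "isCont (g j) x" using d(1) r by (intro DERIV_isCont[OF g[OF j]]) auto
    qed
    then show "closed {t \<in> {d/2..r}. g j t \<le> 0}"
      by (intro continuous_on_closed_Collect_le continuous_on_const closed_atLeastAtMost)
  qed
  moreover have "r \<in> B" using neg r i dr d(1) by (auto simp: B_def intro!: bexI[of _ i])
  then have "B \<noteq> {}" by blast
  moreover have bb: "bdd_below B" unfolding B_def by (intro bdd_belowI[of _ "d/2"]) auto
  ultimately have "Inf B \<in> B" by (intro closed_contains_Inf)
  define t where "t = Inf B"
  obtain k0 where k: "k0 \<in> I" "d/2 \<le> t" "t \<le> r" "g k0 t \<le> 0" using \<open>Inf B \<in> B\<close> by (auto simp: B_def t_def)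
  have before: "g j s > 0" if "0 < s" "s < t" "j \<in> I" for j s
  proof (rule ccontr)
    assume n: "\<not> g j s > 0"
    then have "s \<ge> d" using d(2)[of s j] that by force
    then have "s \<in> B" using n that k d(1) by (auto simp: B_def intro!: bexI[of _ j])
    then have "t \<le> s" unfolding t_def using bb by (rule cInf_lower)
    then show False using that by simp
  qed
  have t: "0 < t" "t < R" using k d(1) r by auto
  have nn: "g j t \<ge> 0" if j: "j \<in> I" for j
  proof (rule ccontr)
    assume "\<not> g j t \<ge> 0"
    then have "g j t < 0" by simp
    have "(g j \<longlongrightarrow> g j t) (at_left t)"
      using DERIV_isCont[OF g[OF j t]] unfolding isCont_def by (rule tendsto_within_subset) simp
    then have "g j t \<ge> 0"
    proof (rule tendsto_lowerbound)
      show "eventually (\<lambda>s. 0 \<le> g j s) (at_left t)"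
        using before[OF _ _ j] t by (auto simp: eventually_at_left intro!: exI[of _ 0] less_imp_le)
    qed simp
    then show False using \<open>g j t < 0\<close> by simp
  qed
  have "g k0 t = 0" using nn[OF k(1)] k(4) by simp
  from barrier[OF k(1) t nn this] obtain k where k1: "k \<in> I" "g k t = 0" "g' k t > 0" by blast
  from DERIV_pos_inc_left[OF g[OF k1(1) t] k1(3)] obtain e where e: "e > 0" "\<And>h. 0 < h \<Longrightarrow> h < e \<Longrightarrow> g k (t - h) < g k t"
    by blast
  define h where "h = min (e/2) (t/2)"
  have "0 < h" "h < e" "h < t" using e t by (auto simp: h_def)
  then have "g k (t - h) < 0" "g k (t - h) > 0" using e(2)[of h] k1 before[of "t - h" k] by auto
  then show False by simp
qed

text \<open>The second barrier function measures the distance to the line through \<open>(Y, 2)\<close> of slope \<open>m\<close>.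
  It increases on that line because a discriminant is nonnegative; this is the
  Joseph--Lundgren condition. The bound on \<open>z\<close> prevents \<open>u\<close> from reaching zero.\<close>

lemma planar_barrier:
  fixes y z q :: "real \<Rightarrow> real" and n Y qm qp :: real
  assumes y: "\<And>r. 0 < r \<Longrightarrow> r < R \<Longrightarrow> (y has_real_derivative y r * (2 - z r) / r) (at r)"
    and z: "\<And>r. 0 < r \<Longrightarrow> r < R \<Longrightarrow> (z has_real_derivative (y r - (n - 2) * z r + (q r - 1) * (z r)\<^sup>2) / r) (at r)"
    and q: "\<And>r. 0 < r \<Longrightarrow> r < R \<Longrightarrow> qm \<le> q r \<and> q r \<le> qp"
    and lim: "(y \<longlongrightarrow> 0) (at_right 0)" "(z \<longlongrightarrow> 0) (at_right 0)"
    and c: "0 \<le> qm" "1 < qp" "4 * qp < n - 2" "2 * n - 4 * qm < Y" "4 * Y \<le> (n + 2 - 4 * qp)\<^sup>2"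
      "qp * Y < (n - 2)\<^sup>2 / 4" "0 < Y"
    and r: "0 < r" "r < R"
  shows "y r < Y" "z r < (n - 2) / 2 / (qp - 1)"
proof -
  define a where "a = n + 2 - 4 * qp"
  \<comment> \<open>This slope maximises \<open>a m - m^2 Y\<close>; the maximum
    \<open>a^2 / (4 Y)\<close> is at least 1 exactly when \<open>4 Y \<le> a^2\<close>.\<close>
  define m where "m = a / (2 * Y)"
  \<comment> \<open>The vertex of the parabola \<open>Y - (n - 2) z + (qp - 1) z^2\<close>; its
    value there is negative by the bound on \<open>qp * Y\<close>, so \<open>z\<close> decreases
    whenever it reaches \<open>Z\<close>.\<close>
  define Z where "Z = (n - 2) / 2 / (qp - 1)"
  have a: "a > 4" using c by (simp add: a_def)
  have m: "m > 0" "m * Y = a / 2" using a c by (auto simp: m_def)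
  have disc: "1 \<le> a * m - m\<^sup>2 * Y"
  proof -
    have "m\<^sup>2 * Y = m * (a / 2)" using m(2) by (simp add: power2_eq_square mult.assoc)
    then have "a * m - m\<^sup>2 * Y = a\<^sup>2 / (4 * Y)" by (simp add: m_def power2_eq_square)
    moreover have "4 * Y \<le> a\<^sup>2" using c by (simp add: a_def)
    ultimately show ?thesis using c(7) by (simp add: le_divide_eq)
  qed
  have Z: "Z > 0" "Y - (n - 2) * Z + (qp - 1) * Z\<^sup>2 < 0"
  proof -
    show "Z > 0" using c by (simp add: Z_def)
    have "(qp - 1) * Z = (n - 2) / 2" 
      unfolding Z_def times_divide_eq_right[of "qp - 1" "(n - 2) / 2"]
      by (rule nonzero_mult_div_cancel_left) (use c(2) in simp)
    then have "(qp - 1) * Z\<^sup>2 = (n - 2) * Z / 2" by (simp add: power2_eq_square mult.assoc[symmetric])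
    then have "Y - (n - 2) * Z + (qp - 1) * Z\<^sup>2 = Y - (n - 2) * Z / 2" by simp
    also have "\<dots> < 0"
    proof -
      have "(qp - 1) * Y < (n - 2)\<^sup>2 / 4" using c by (simp add: algebra_simps)
      moreover have "(n - 2) * Z / 2 = (n - 2)\<^sup>2 / 4 / (qp - 1)" by (simp add: Z_def power2_eq_square)
      moreover have "Y < (n - 2)\<^sup>2 / 4 / (qp - 1)"
        using \<open>(qp - 1) * Y < (n - 2)\<^sup>2 / 4\<close> c(2) by (subst pos_less_divide_eq) (auto simp: mult.commute)
      ultimately show ?thesis by linarith
    qed
    finally show "Y - (n - 2) * Z + (qp - 1) * Z\<^sup>2 < 0" .
  qed
  define g where "g i = (\<lambda>r. if i = (0::nat) then Y - y r else if i = 1 then z r - 2 + m * (Y - y r) else Z - z r)" for i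
  define g' where "g' i = (\<lambda>r. if i = (0::nat) then - (y r * (2 - z r) / r)
     else if i = 1 then (y r - (n - 2) * z r + (q r - 1) * (z r)\<^sup>2) / r - m * (y r * (2 - z r) / r)
     else - ((y r - (n - 2) * z r + (q r - 1) * (z r)\<^sup>2) / r))" for i
  have "g i r > 0" if "i \<in> {0,1,2}" for i
  proof (rule positivity_barrier[OF _ _ _ _ r that, where g=g and g'=g'])
    fix i r assume "i \<in> {0,1,2::nat}" and r: "0 < r" "r < R"
    then show "(g i has_real_derivative g' i r) (at r)"
      unfolding g_def g'_def using y[OF r] z[OF r] by (auto intro!: derivative_eq_intros)
  next
    fix i assume "i \<in> {0,1,2::nat}"
    moreover have "((\<lambda>r. Y - y r) \<longlongrightarrow> Y - 0) (at_right 0)" "((\<lambda>r. z r - 2 + m * (Y - y r)) \<longlongrightarrow> 0 - 2 + m * (Y - 0)) (at_right 0)"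
      "((\<lambda>r. Z - z r) \<longlongrightarrow> Z - 0) (at_right 0)"
      by (intro tendsto_intros lim)+
    \<comment> \<open>The orbit starts at the origin. It lies on the right side of the line because
      \<open>m * Y - 2 = a / 2 - 2\<close> and \<open>4 * qp < n - 2\<close> says
      \<open>a > 4\<close>.\<close>
    moreover have "Y - 0 > 0" "0 - 2 + m * (Y - 0) > 0" "Z - 0 > 0" using c Z a m by auto
    ultimately show "eventually (\<lambda>r. g i r > 0) (at_right 0)"
      unfolding g_def by (auto dest!: order_tendstoD(1))
  next
    fix i r assume i: "i \<in> {0,1,2::nat}" and r: "0 < r" "r < R"
      and nn: "\<And>j. j \<in> {0,1,2} \<Longrightarrow> g j r \<ge> 0" and eq: "g i r = 0"
    define s where "s = Y - y r"
    have s: "s \<ge> 0" "y r = Y - s" using nn[of 0] by (auto simp: g_def s_def)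
    have line: "z r - 2 + m * s \<ge> 0" using nn[of 1] by (simp add: g_def s_def)
    \<comment> \<open>Substituting \<open>z = 2 - m s\<close>, \<open>y = Y - s\<close> gives a
      quadratic in \<open>s \<ge> 0\<close>. The constant term is positive since \<open>Y\<close>
      lies to the right of every rest point \<open>2 n - 4 q\<close>, the linear coefficient is
      nonnegative by \<open>disc\<close>, and the quadratic one equals \<open>q m^2\<close>.\<close>
    have line_pos: "y r - (n - 2) * z r + (q r - 1) * (z r)\<^sup>2 - m * (y r * (2 - z r)) > 0"
      if l: "z r - 2 + m * s = 0"
    proof -
      have zr: "z r = 2 - m * s" using l by simp
      have "y r - (n - 2) * z r + (q r - 1) * (z r)\<^sup>2 - m * (y r * (2 - z r))
        = (Y - 2 * n + 4 * q r) + s * ((n + 2 - 4 * q r) * m - m\<^sup>2 * Y - 1) + q r * (m * s)\<^sup>2"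
        unfolding zr s(2) by (simp add: algebra_simps power2_eq_square)
      moreover have "Y - 2 * n + 4 * q r > 0" using q[OF r] c by linarith
      moreover have "s * ((n + 2 - 4 * q r) * m - m\<^sup>2 * Y - 1) \<ge> 0"
      proof -
        have "a * m \<le> (n + 2 - 4 * q r) * m" unfolding a_def using q[OF r] m by (intro mult_right_mono) auto
        then show ?thesis using s disc by (intro mult_nonneg_nonneg) linarith+
      qed
      moreover have "q r * (m * s)\<^sup>2 \<ge> 0" using q[OF r] c by (intro mult_nonneg_nonneg) auto
      ultimately show ?thesis by linarith
    qed
    have g1: "g' 1 r > 0" if l: "z r - 2 + m * s = 0"
    proof -
      from line_pos[OF l] have "(y r - (n - 2) * z r + (q r - 1) * (z r)\<^sup>2 - m * (y r * (2 - z r))) / r > 0"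
        using r by simp
      then show ?thesis by (simp add: g'_def diff_divide_distrib)
    qed
    \<comment> \<open>On the line, index 1 is used whichever constraint was hit: at the corner
      \<open>(Y, 2)\<close> the derivative of \<open>y\<close> is 0 and index 0 would fail. Off the
      line, \<open>y = Y\<close> forces \<open>z > 2\<close>, so \<open>y\<close> decreases.\<close>
    show "\<exists>k\<in>{0,1,2}. g k r = 0 \<and> g' k r > 0"
    proof (cases "z r - 2 + m * s = 0")
      case True
      then have "g 1 r = 0" by (simp add: g_def s_def)
      then show ?thesis using g1[OF True] by blast
    next
      case False
      from i consider "i = 0" | "i = 1" | "i = 2" by auto
      then have "g' i r > 0"
      proof cases
        case 1
        then have s0: "s = 0" using eq by (simp add: g_def s_def)
        then have "z r > 2" using line False by simp
        then show ?thesis using 1 r s s0 c by (simp add: g'_def mult_pos_neg divide_neg_pos)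
      next
        case 2
        then show ?thesis using eq False by (simp add: g_def s_def)
      next
        case 3
        then have zZ: "z r = Z" using eq by (simp add: g_def)
        have "(q r - 1) * Z\<^sup>2 \<le> (qp - 1) * Z\<^sup>2" using q[OF r] by (intro mult_right_mono) auto
        then have "y r - (n - 2) * z r + (q r - 1) * (z r)\<^sup>2 < 0" using Z(2) s unfolding zZ by linarith
        then show ?thesis using 3 r by (simp add: g'_def divide_neg_pos)
      qed
      then show ?thesis using i eq by blast
    qed
  qed auto
  from this[of 0] this[of 2] show "y r < Y" "z r < (n - 2) / 2 / (qp - 1)"
    by (auto simp: g_def Z_def)
qed

section \<open>The transform \<open>F\<close> and the planar system\<close>

context nonlinearity
begin

text \<open>Writes \<open>F\<close> as a constant minus an integral over a compact interval, which
  reduces its derivative to the fundamental theorem of calculus.\<close>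

lemma tail_integral_split:
  assumes "0 < a" "a \<le> u"
  shows "tail_integral f a = integral {a..u} (\<lambda>s. 1 / f s) + tail_integral f u"
proof -
  have I: "set_integrable lborel {v..} (\<lambda>s. 1 / f s)" if "v > 0" for v
    using that standing unfolding standing_assumptions_def by blast
  have T: "tail_integral f v = integral {v..} (\<lambda>s. 1 / f s)" "(\<lambda>s. 1 / f s) integrable_on {v..}" if "v > 0" for v
    unfolding tail_integral_def using set_borel_integral_eq_integral[OF I[OF that]] by auto
  have nz: "f s \<noteq> 0" if "s > 0" for s using f_pos[OF that] by simp
  have c: "continuous_on {a..u} (\<lambda>s. 1 / f s)"
    using assms nz by (intro continuous_intros continuous_on_subset[OF continuous_f subset_UNIV]) auto
  have "{a..} = {a..u} \<union> {u..}" "{a..u} \<inter> {u..} = {u}" using assms by auto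
  then show ?thesis
    using integral_Un[OF integrable_continuous_interval[OF c] T(2)[of u]] T(1)[of a] T(1)[of u] assms by simp
qed

lemma DERIV_tail_integral:
  assumes "u > 0" shows "(tail_integral f has_real_derivative - 1 / f u) (at u)"
proof -
  define a where "a = u / 2"
  have a: "0 < a" "a < u" using assms by (auto simp: a_def)
  have nz: "f s \<noteq> 0" if "s > 0" for s using f_pos[OF that] by simp
  have c: "continuous_on {a..u + 1} (\<lambda>s. 1 / f s)"
    using a nz by (intro continuous_intros continuous_on_subset[OF continuous_f subset_UNIV]) auto
  have "((\<lambda>v. integral {a..v} (\<lambda>s. 1 / f s)) has_real_derivative 1 / f u) (at u within {a..u + 1})"
    by (rule integral_has_real_derivative[OF c]) (use a in auto)
  then have "((\<lambda>v. integral {a..v} (\<lambda>s. 1 / f s)) has_real_derivative 1 / f u) (at u)"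
    using a by (simp add: at_within_Icc_at)
  then have "((\<lambda>v. tail_integral f a - integral {a..v} (\<lambda>s. 1 / f s)) has_real_derivative 0 - 1 / f u) (at u)"
    by (intro DERIV_diff DERIV_const)
  then have "((\<lambda>v. tail_integral f a - integral {a..v} (\<lambda>s. 1 / f s)) has_real_derivative - 1 / f u) (at u)" by simp
  then show ?thesis
  proof (rule has_field_derivative_transform_within_open[of _ _ _ "{a<..}"])
    show "tail_integral f a - integral {a..x} (\<lambda>s. 1 / f s) = tail_integral f x" if "x \<in> {a<..}" for x
      using tail_integral_split[OF a(1), of x] that by simp
  qed (use a in auto)
qed

lemma tail_integral_pos:
  assumes "u > 0" shows "tail_integral f u > 0"
proof -
  have "tail_integral f (u + 1) < tail_integral f u"
  proof (rule DERIV_neg_imp_decreasing[of u "u + 1"])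
    fix x assume "u \<le> x" "x \<le> u + 1"
    then show "\<exists>y. (tail_integral f has_real_derivative y) (at x) \<and> y < 0"
      using DERIV_tail_integral[of x] f_pos[of x] assms by (intro exI[of _ "- 1 / f x"]) auto
  qed simp
  moreover have "tail_integral f (u + 1) \<ge> 0"
    unfolding tail_integral_def set_lebesgue_integral_def using assms f_pos
    by (intro integral_nonneg_AE AE_I2) (auto simp: indicator_def less_imp_le)
  ultimately show ?thesis by simp
qed

end

lemma first_zero:
  fixes w :: "real \<Rightarrow> real"
  assumes w: "continuous_on {0..} w" "w 0 > 0" and r: "r \<ge> 0" "w r \<le> 0"
  obtains R where "0 < R" "R \<le> r" "w R = 0" "\<And>t. 0 \<le> t \<Longrightarrow> t < R \<Longrightarrow> w t > 0"
proof -
  define B where "B = {t \<in> {0..r}. w t \<le> 0}"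
  have cont: "continuous_on {0..s} w" for s by (rule continuous_on_subset[OF w(1)]) auto
  have "closed B" unfolding B_def
    by (intro continuous_on_closed_Collect_le continuous_on_const closed_atLeastAtMost cont)
  moreover have "r \<in> B" using r by (simp add: B_def)
  moreover have bb: "bdd_below B" unfolding B_def by (intro bdd_belowI[of _ 0]) auto
  ultimately have "Inf B \<in> B" by (intro closed_contains_Inf) auto
  define R where "R = Inf B"
  have R: "0 \<le> R" "R \<le> r" "w R \<le> 0" using \<open>Inf B \<in> B\<close> by (auto simp: B_def R_def)
  have before: "w t > 0" if "0 \<le> t" "t < R" for t
  proof (rule ccontr)
    assume "\<not> w t > 0"
    then have "t \<in> B" using that R by (auto simp: B_def)
    then have "R \<le> t" unfolding R_def using bb by (rule cInf_lower)
    then show False using that by simp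
  qed
  have "R \<noteq> 0" using w(2) R by auto
  then have "R > 0" using R by simp
  obtain t where t: "0 \<le> t" "t \<le> R" "w t = 0"
    using IVT2'[of w R 0 0] R w(2) cont[of R] by auto
  then have "t = R" using before[of t] by force
  then show ?thesis using that[of R] \<open>R > 0\<close> R t before by blast
qed

text \<open>All required inequalities are strict at \<open>d = 0\<close>, where
  \<open>qm = qp = q0\<close>, except two that hold for every \<open>d > 0\<close> by the choice of
  \<open>Y\<close> and of the \<open>q\<close> bounds. Continuity in \<open>d\<close> gives one
  small \<open>d\<close> for all. The discriminant \<open>disc\<close> factors through
  \<open>s = sqrt (n - 1)\<close>, and both factors are positive below the smaller root.\<close>

lemma JL_constants:
  fixes n q0 :: real
  assumes n: "n > 2" and q0: "1 < q0" "q0 < (n - 2 * sqrt (n - 1)) / 4"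
  obtains qm qp Y where "0 \<le> qm" "qm < q0" "q0 < qp" "1 < qp" "4 * qp < n - 2" "2 * n - 4 * qm < Y"
    "4 * Y \<le> (n + 2 - 4 * qp)\<^sup>2" "qp * Y < (n - 2)\<^sup>2 / 4" "0 < Y"
proof -
  define s where "s = sqrt (n - 1)"
  have s: "s > 1" "s\<^sup>2 = n - 1" using n by (auto simp: s_def)
  have q4: "4 * q0 < n - 2 * s" using q0 by (simp add: s_def)
  have disc: "16 * q0\<^sup>2 - 8 * n * q0 + (n - 2)\<^sup>2 > 0"
  proof -
    have "(n - 2 * s - 4 * q0) * (n + 2 * s - 4 * q0) > 0" using q4 s by (intro mult_pos_pos) auto
    moreover have "(n - 2 * s - 4 * q0) * (n + 2 * s - 4 * q0) = 16 * q0\<^sup>2 - 8 * n * q0 + n\<^sup>2 - 4 * s\<^sup>2"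
      by (simp add: algebra_simps power2_eq_square)
    ultimately show ?thesis unfolding s(2) by (simp add: algebra_simps power2_eq_square)
  qed
  \<comment> \<open>The coefficient 5 beats the 4 in \<open>2 n - 4 (q0 - d)\<close>, which keeps
    \<open>Y\<close> to the right of all rest points.\<close>
  define Y where "Y d = 2 * n - 4 * q0 + 5 * d" for d :: real
  have "n - 2 - 4 * (q0 + 0) > 0" using q4 s by simp
  moreover have "((\<lambda>d. n - 2 - 4 * (q0 + d)) \<longlongrightarrow> n - 2 - 4 * (q0 + 0)) (at_right 0)"
    by (intro tendsto_intros)
  ultimately have 1: "eventually (\<lambda>d. n - 2 - 4 * (q0 + d) > 0) (at_right 0)" by (rule order_tendstoD(1)[rotated])
  have "(n + 2 - 4 * (q0 + 0))\<^sup>2 - 4 * Y 0 > 0" using disc by (simp add: Y_def algebra_simps power2_eq_square)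
  moreover have "((\<lambda>d. (n + 2 - 4 * (q0 + d))\<^sup>2 - 4 * Y d) \<longlongrightarrow> (n + 2 - 4 * (q0 + 0))\<^sup>2 - 4 * Y 0) (at_right 0)"
    unfolding Y_def by (intro tendsto_intros)
  ultimately have 2: "eventually (\<lambda>d. (n + 2 - 4 * (q0 + d))\<^sup>2 - 4 * Y d > 0) (at_right 0)" by (rule order_tendstoD(1)[rotated])
  have "(n - 2)\<^sup>2 / 4 - (q0 + 0) * Y 0 > 0" using disc by (simp add: Y_def field_simps power2_eq_square)
  moreover have "((\<lambda>d. (n - 2)\<^sup>2 / 4 - (q0 + d) * Y d) \<longlongrightarrow> (n - 2)\<^sup>2 / 4 - (q0 + 0) * Y 0) (at_right 0)"
    unfolding Y_def by (intro tendsto_intros) simp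
  ultimately have 3: "eventually (\<lambda>d. (n - 2)\<^sup>2 / 4 - (q0 + d) * Y d > 0) (at_right 0)" by (rule order_tendstoD(1)[rotated])
  have 4: "eventually (\<lambda>d. d < 1) (at_right (0::real))"
    unfolding eventually_at_right_field by (intro exI[of _ 1]) simp
  have "eventually (\<lambda>d. n - 2 - 4 * (q0 + d) > 0 \<and> (n + 2 - 4 * (q0 + d))\<^sup>2 - 4 * Y d > 0 \<and>
      (n - 2)\<^sup>2 / 4 - (q0 + d) * Y d > 0 \<and> d < 1 \<and> d > 0) (at_right 0)"
    by (intro eventually_conj 1 2 3 4 eventually_at_right_less)
  then obtain d where d: "n - 2 - 4 * (q0 + d) > 0" "(n + 2 - 4 * (q0 + d))\<^sup>2 - 4 * Y d > 0"
      "(n - 2)\<^sup>2 / 4 - (q0 + d) * Y d > 0" "d < 1" "d > 0"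
    using eventually_happens'[OF trivial_limit_at_right_real] by blast
  have "Y d > 0" using q4 s n d(5) by (simp add: Y_def)
  then show ?thesis using d q0 by (intro that[of "q0 - d" "q0 + d" "Y d"]) (auto simp: Y_def)
qed

context nonlinearity
begin

text \<open>With \<open>v = F(w)\<close> one has \<open>v' = - w' / f(w)\<close>, so
  \<open>z\<close> is \<open>r v' / v\<close>. The two limits put the start of the orbit at the
  origin of the plane.\<close>

lemma planar_system:
  assumes w: "radial_ivp N f \<alpha> w" and N: "N \<ge> 1" and \<alpha>: "\<alpha> > 0"
  defines "y \<equiv> \<lambda>r. r\<^sup>2 / tail_integral f (w r)"
    and "z \<equiv> \<lambda>r. - (r * deriv w r) / (f (w r) * tail_integral f (w r))"
  shows "0 < r \<Longrightarrow> w r > 0 \<Longrightarrow> (y has_real_derivative y r * (2 - z r) / r) (at r)"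
    and "0 < r \<Longrightarrow> w r > 0 \<Longrightarrow> (z has_real_derivative
      (y r - (real N - 2) * z r + (deriv f (w r) * tail_integral f (w r) - 1) * (z r)\<^sup>2) / r) (at r)"
    and "(y \<longlongrightarrow> 0) (at_right 0)" "(z \<longlongrightarrow> 0) (at_right 0)"
proof -
  assume r: "0 < r" "w r > 0"
  define a p v g where "a = f (w r)" and "p = deriv w r" and "v = tail_integral f (w r)" and "g = deriv f (w r)"
  have pos: "a > 0" "v > 0" using f_pos[OF r(2)] tail_integral_pos[OF r(2)] by (auto simp: a_def v_def)
  have dw: "(w has_real_derivative p) (at r)" "(deriv w has_real_derivative - ((real N - 1) / r * p) - a) (at r)"
    using radial_ivp_DERIV[OF w r(1)] by (auto simp: p_def a_def)
  have df: "((\<lambda>r. f (w r)) has_real_derivative g * p) (at r)"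
    unfolding g_def by (rule DERIV_chain2[OF DERIV_f dw(1)])
  have dv: "((\<lambda>r. tail_integral f (w r)) has_real_derivative - 1 / a * p) (at r)"
    unfolding a_def by (rule DERIV_chain2[OF DERIV_tail_integral[OF r(2)] dw(1)])
  have zr: "z r = - (r * p) / (a * v)" and yr: "y r = r\<^sup>2 / v" by (simp_all add: z_def y_def a_def p_def v_def)
  have sq: "((\<lambda>r. r\<^sup>2) has_real_derivative 2 * r) (at r)" by (auto intro!: derivative_eq_intros)
  show "(y has_real_derivative y r * (2 - z r) / r) (at r)"
    unfolding y_def
  proof (rule DERIV_cong[OF DERIV_divide[OF sq dv]])
    show "tail_integral f (w r) \<noteq> 0" using pos by (simp add: v_def)
    show "(2 * r * tail_integral f (w r) - r\<^sup>2 * (- 1 / a * p)) / (tail_integral f (w r) * tail_integral f (w r)) =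
        r\<^sup>2 / tail_integral f (w r) * (2 - z r) / r"
      unfolding v_def[symmetric] zr using r pos by (simp add: field_simps power2_eq_square)
  qed
  have num: "((\<lambda>r. - (r * deriv w r)) has_real_derivative - (r * (- ((real N - 1) / r * p) - a) + 1 * p)) (at r)"
    unfolding p_def by (intro DERIV_minus DERIV_mult' DERIV_ident dw(2)[unfolded p_def])
  have den: "((\<lambda>r. f (w r) * tail_integral f (w r)) has_real_derivative a * (- 1 / a * p) + g * p * v) (at r)"
    using DERIV_mult'[OF df dv] by (simp add: a_def v_def)
  show "(z has_real_derivative
      (y r - (real N - 2) * z r + (deriv f (w r) * tail_integral f (w r) - 1) * (z r)\<^sup>2) / r) (at r)"
    unfolding z_def
  proof (rule DERIV_cong[OF DERIV_divide[OF num den]])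
    show "f (w r) * tail_integral f (w r) \<noteq> 0" using pos by (simp add: v_def a_def)
    show "(- (r * (- ((real N - 1) / r * p) - a) + 1 * p) * (f (w r) * tail_integral f (w r)) -
         - (r * deriv w r) * (a * (- 1 / a * p) + g * p * v)) /
        (f (w r) * tail_integral f (w r) * (f (w r) * tail_integral f (w r))) =
        (y r - (real N - 2) * (- (r * deriv w r) / (f (w r) * tail_integral f (w r))) +
         (deriv f (w r) * tail_integral f (w r) - 1) * (- (r * deriv w r) / (f (w r) * tail_integral f (w r)))\<^sup>2) / r"
      unfolding yr v_def[symmetric] a_def[symmetric] p_def[symmetric] g_def[symmetric]
      using r pos by (simp add: field_simps power2_eq_square)
  qed
next
  have w0: "(w \<longlongrightarrow> \<alpha>) (at_right 0)" by (rule radial_ivp_tendsto_0[OF w])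
  have T: "((\<lambda>r. tail_integral f (w r)) \<longlongrightarrow> tail_integral f \<alpha>) (at_right 0)"
    by (rule isCont_tendsto_compose[OF DERIV_isCont[OF DERIV_tail_integral[OF \<alpha>]] w0])
  have T0: "tail_integral f \<alpha> \<noteq> 0" "f \<alpha> \<noteq> 0" using tail_integral_pos[OF \<alpha>] f_pos[OF \<alpha>] by auto
  have F: "((\<lambda>r. f (w r)) \<longlongrightarrow> f \<alpha>) (at_right 0)"
    by (rule isCont_tendsto_compose[OF DERIV_isCont[OF DERIV_f] w0])
  have D: "(deriv w \<longlongrightarrow> 0) (at_right 0)"
    by (rule radial_ivp_deriv_limit[OF w N DERIV_isCont[OF DERIV_f]])
  have "(y \<longlongrightarrow> 0\<^sup>2 / tail_integral f \<alpha>) (at_right 0)"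
    unfolding y_def by (intro tendsto_intros T T0)
  then show "(y \<longlongrightarrow> 0) (at_right 0)" by simp
  have "(z \<longlongrightarrow> - (0 * 0) / (f \<alpha> * tail_integral f \<alpha>)) (at_right 0)"
    unfolding z_def by (intro tendsto_intros T F D) (use T0 in auto)
  then show "(z \<longlongrightarrow> 0) (at_right 0)" by simp
qed

text \<open>Up to a first zero of \<open>w\<close> the barriers apply. There \<open>z < Z\<close>
  and \<open>f(w) F(w) \<le> f'(w) w F(w) \<le> qp w\<close> bound \<open>- w' / w\<close> by a
  multiple of \<open>1 / r\<close>, and such a function cannot vanish at a positive radius. Once
  \<open>w\<close> is positive, \<open>f'(w) r^2\<close> is the product of \<open>f'(w) F(w)\<close>
  and \<open>y\<close>.\<close>

lemma small_solution_bounds: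
  assumes w: "radial_ivp N f \<alpha> w" and N: "N \<ge> 1" and \<alpha>: "\<alpha> > 0"
    and q: "\<And>u. 0 < u \<Longrightarrow> u \<le> \<alpha> \<Longrightarrow> qm \<le> deriv f u * tail_integral f u \<and> deriv f u * tail_integral f u \<le> qp"
    and c: "0 \<le> qm" "1 < qp" "4 * qp < real N - 2" "2 * real N - 4 * qm < Y" "4 * Y \<le> (real N + 2 - 4 * qp)\<^sup>2"
      "qp * Y < (real N - 2)\<^sup>2 / 4" "0 < Y"
    and r: "r \<ge> 0"
  shows "w r > 0" "deriv f (w r) * r\<^sup>2 \<le> qp * Y"
proof -
  define y z where "y = (\<lambda>r. r\<^sup>2 / tail_integral f (w r))"
    and "z = (\<lambda>r. - (r * deriv w r) / (f (w r) * tail_integral f (w r)))"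
  define Z where "Z = (real N - 2) / 2 / (qp - 1)"
  have Z: "Z > 0" using c by (simp add: Z_def)
  have qw: "qm \<le> deriv f (w t) * tail_integral f (w t) \<and> deriv f (w t) * tail_integral f (w t) \<le> qp" if "0 \<le> t" "w t > 0" for t
    using q[OF that(2)] radial_ivp_abs_le[OF w N \<alpha> that(1)] by auto
  have planar: "(y has_real_derivative y s * (2 - z s) / s) (at s)"
    "(z has_real_derivative (y s - (real N - 2) * z s + (deriv f (w s) * tail_integral f (w s) - 1) * (z s)\<^sup>2) / s) (at s)"
    if "0 < s" "w s > 0" for s
    unfolding y_def z_def using planar_system(1,2)[OF w N \<alpha> that] .
  have planar0: "(y \<longlongrightarrow> 0) (at_right 0)" "(z \<longlongrightarrow> 0) (at_right 0)"
    unfolding y_def z_def using planar_system(3,4)[OF w N \<alpha>] .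
  \<comment> \<open>The endpoint \<open>R\<close> is left free: it is first the supposed first zero
    and later, when positivity is known, \<open>r + 1\<close>.\<close>
  have est: "y t < Y" "z t < Z" if "0 < t" "t < R" "\<And>s. 0 < s \<Longrightarrow> s < R \<Longrightarrow> w s > 0" for t R
  proof -
    note h = that
    have "(y has_real_derivative y s * (2 - z s) / s) (at s)"
      "(z has_real_derivative (y s - (real N - 2) * z s + (deriv f (w s) * tail_integral f (w s) - 1) * (z s)\<^sup>2) / s) (at s)"
      "qm \<le> deriv f (w s) * tail_integral f (w s) \<and> deriv f (w s) * tail_integral f (w s) \<le> qp"
      if s: "0 < s" "s < R" for s
      using planar(1,2)[OF s(1) h(3)[OF s]] qw[OF less_imp_le[OF s(1)] h(3)[OF s]] by auto
    from planar_barrier[where q="\<lambda>r. deriv f (w r) * tail_integral f (w r)", OF this planar0 c h(1,2)]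
    show "y t < Y" "z t < Z" unfolding Z_def by auto
  qed
  have pos: "w r > 0" if "r \<ge> 0" for r
  proof (rule ccontr)
    assume n: "\<not> w r > 0"
    have "w 0 > 0" "w r \<le> 0" using w \<alpha> n by (auto simp: radial_ivp_def)
    from first_zero[OF radial_ivp_continuous_on[OF w] this(1) that this(2)]
    obtain R where R: "0 < R" "w R = 0" "\<And>t. 0 \<le> t \<Longrightarrow> t < R \<Longrightarrow> w t > 0" by blast
    define k where "k = Z * qp"
    have k: "k > 0" using Z c by (simp add: k_def)
    \<comment> \<open>Gronwall weight: on \<open>[R/2, R]\<close> the rate \<open>k / t\<close> is
      at most \<open>2 k / R\<close>, so \<open>h\<close> is nondecreasing there and
      \<open>h R \<ge> h (R/2) > 0\<close> contradicts \<open>w R = 0\<close>.\<close>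
    define h where "h t = w t * exp (2 * k / R * t)" for t
    have "h (R / 2) \<le> h R"
    proof (rule DERIV_nonneg_imp_increasing_open[of "R / 2" R h])
      fix t assume t: "R / 2 < t" "t < R"
      then have t0: "0 < t" and wt: "w t > 0" using R by auto
      have fw: "f (w t) > 0" "tail_integral f (w t) > 0" using f_pos[OF wt] tail_integral_pos[OF wt] by auto
      have "z t < Z" using est(2)[OF t0 t(2)] R(3) by auto
      then have "- (t * deriv w t) < Z * (f (w t) * tail_integral f (w t))"
        unfolding z_def using pos_divide_less_eq[OF mult_pos_pos[OF fw]] by blast
      also have "\<dots> \<le> Z * (w t * qp)"
      proof -
        have "f (w t) \<le> deriv f (w t) * w t" using f_secant_le[of 0 "w t"] wt by simp
        then have "f (w t) * tail_integral f (w t) \<le> deriv f (w t) * w t * tail_integral f (w t)"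
          using fw by (intro mult_right_mono) auto
        also have "\<dots> = w t * (deriv f (w t) * tail_integral f (w t))" by simp
        also have "\<dots> \<le> w t * qp" using qw[of t] t0 wt by (intro mult_left_mono) auto
        finally show ?thesis using Z by simp
      qed
      finally have 1: "- deriv w t \<le> k * w t / t" using t0 by (simp add: k_def field_simps)
      also have "\<dots> \<le> k * w t / (R / 2)"
        using less_imp_le[OF mult_pos_pos[OF k wt]] t t0 R(1) by (intro divide_left_mono) auto
      finally have "deriv w t + w t * (2 * k / R) \<ge> 0" by (simp add: mult_ac)
      then have "(deriv w t + w t * (2 * k / R)) * exp (2 * k / R * t) \<ge> 0" by simp
      moreover have "(h has_real_derivative (deriv w t + w t * (2 * k / R)) * exp (2 * k / R * t)) (at t)"
        unfolding h_def using radial_ivp_DERIV(1)[OF w t0] R(1)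
        by (auto intro!: derivative_eq_intros simp: algebra_simps)
      ultimately show "\<exists>y. (h has_real_derivative y) (at t) \<and> 0 \<le> y" by blast
    next
      have "continuous_on {R / 2..R} w" by (rule continuous_on_subset[OF radial_ivp_continuous_on[OF w]]) (use R in auto)
      then show "continuous_on {R / 2..R} h" unfolding h_def using R(1) by (intro continuous_intros) auto
    qed (use R in auto)
    moreover have "h (R / 2) > 0" using R by (simp add: h_def)
    ultimately show False using R(2) by (simp add: h_def)
  qed
  show "w r > 0" using pos r by blast
  show "deriv f (w r) * r\<^sup>2 \<le> qp * Y"
  proof (cases "r = 0")
    case True
    then show ?thesis using c by simp
  next
    case False
    then have r0: "r > 0" using r by simp
    have wr: "w r > 0" using pos r by blast
    have T: "tail_integral f (w r) > 0" using tail_integral_pos[OF wr] .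
    have "y r < Y" using est(1)[of r "r + 1"] pos r0 by auto
    then have yY: "y r \<le> Y" by simp
    have "deriv f (w r) * r\<^sup>2 = (deriv f (w r) * tail_integral f (w r)) * y r" using T by (simp add: y_def)
    also have "\<dots> \<le> qp * Y" using qw[OF r wr] yY c T by (intro mult_mono) (auto simp: y_def)
    finally show ?thesis .
  qed
qed

lemma exists_stable_radial_sol:
  assumes N: "DIM('a::euclidean_space) \<ge> 3"
    and lim: "((\<lambda>u. deriv f u * tail_integral f u) \<longlongrightarrow> q0) (at_right 0)"
    and q0: "1 < q0" "q0 < q_JL DIM('a)"
  shows "\<exists>\<alpha>>0. stable_solution f (\<lambda>x::'a. radial_sol DIM('a) f (norm x) \<alpha>)"
proof -
  define n where "n = real DIM('a)"
  have n: "n > 2" using N by (simp add: n_def)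
  obtain qm qp Y where c: "0 \<le> qm" "1 < qp" "4 * qp < n - 2" "2 * n - 4 * qm < Y"
    "4 * Y \<le> (n + 2 - 4 * qp)\<^sup>2" "qp * Y < (n - 2)\<^sup>2 / 4" "0 < Y" and q: "qm < q0" "q0 < qp"
    using JL_constants[OF n q0(1)] q0(2) unfolding q_JL_def n_def by metis
  have "eventually (\<lambda>u. qm < deriv f u * tail_integral f u \<and> deriv f u * tail_integral f u < qp) (at_right 0)"
    using order_tendstoD[OF lim] q by (intro eventually_conj) auto
  then obtain b where b: "b > 0" "\<And>u. 0 < u \<Longrightarrow> u < b \<Longrightarrow> qm < deriv f u * tail_integral f u \<and> deriv f u * tail_integral f u < qp"
    by (auto simp: eventually_at_right_field)
  \<comment> \<open>The energy bound keeps \<open>|u| \<le> \<alpha> < b\<close>, so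
    \<open>f'(u) F(u)\<close> stays between \<open>qm\<close> and \<open>qp\<close> wherever
    \<open>u > 0\<close>.\<close>
  define \<alpha> where "\<alpha> = b / 2"
  have \<alpha>: "\<alpha> > 0" using b by (simp add: \<alpha>_def)
  have N1: "DIM('a) \<ge> 1" using N by simp
  note w = radial_sol_ivp[OF N1 \<alpha>]
  define U where "U = (\<lambda>x::'a. radial_sol DIM('a) f (norm x) \<alpha>)"
  have bounds: "U x > 0" "deriv f (U x) * (x \<bullet> x) \<le> qp * Y" for x
  proof -
    have "qm \<le> deriv f u * tail_integral f u \<and> deriv f u * tail_integral f u \<le> qp" if "0 < u" "u \<le> \<alpha>" for u
      using b(2)[of u] that b(1) by (auto simp: \<alpha>_def)
    from small_solution_bounds[OF w N1 \<alpha> this c[unfolded n_def], of "norm x"]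
    show "U x > 0" "deriv f (U x) * (x \<bullet> x) \<le> qp * Y" by (auto simp: U_def power2_norm_eq_inner)
  qed
  have "entire_solution f U" unfolding U_def by (rule radial_ivp_entire_solution[OF w continuous_f])
  moreover have "(\<integral>x. ((norm (grad \<phi> x))\<^sup>2 - deriv f (U x) * (\<phi> x)\<^sup>2) \<partial>lborel) \<ge> 0" if \<phi>: "C1_compact_support \<phi>" for \<phi>
  proof -
    \<comment> \<open>Spends the gap between \<open>qp * Y\<close> and the Hardy constant:
      \<open>f'(U) |x|^2\<close> is at most \<open>qp * Y\<close>, and
      \<open>f'(U) \<epsilon> \<le> f'(\<alpha>) \<epsilon>\<close> is at most exactly the
      gap.\<close>
    define \<epsilon> where "\<epsilon> = ((n - 2)\<^sup>2 / 4 - qp * Y) / deriv f \<alpha>"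
    have f': "deriv f \<alpha> > 0" using f'_pos[OF \<alpha>] .
    have \<epsilon>: "\<epsilon> > 0" using c f' by (simp add: \<epsilon>_def)
    have "C1 U" using \<open>entire_solution f U\<close> by (simp add: entire_solution_def C2_def)
    then have "continuous_on UNIV (\<lambda>x. deriv f (U x))"
      using C1_continuous_on by (intro continuous_on_compose2[OF continuous_f']) auto
    moreover have "deriv f (U x) \<le> (real DIM('a) - 2)\<^sup>2 / 4 / (x \<bullet> x + \<epsilon>)" for x
    proof -
      have "\<bar>U x\<bar> \<le> \<alpha>" unfolding U_def by (rule radial_ivp_abs_le[OF w N1 \<alpha>]) simp
      then have "deriv f (U x) * \<epsilon> \<le> deriv f \<alpha> * \<epsilon>" using \<epsilon> f'_mono by (intro mult_right_mono) auto
      also have "\<dots> = (n - 2)\<^sup>2 / 4 - qp * Y" using f' by (simp add: \<epsilon>_def)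
      finally have "deriv f (U x) * (x \<bullet> x + \<epsilon>) \<le> (n - 2)\<^sup>2 / 4"
        using bounds(2)[of x] by (simp add: algebra_simps)
      moreover have "x \<bullet> x + \<epsilon> > 0" using \<epsilon> by (intro add_nonneg_pos) auto
      ultimately show ?thesis unfolding n_def by (subst pos_le_divide_eq)
    qed
    ultimately show ?thesis using N by (intro stability_from_Hardy[OF \<phi> _ \<epsilon>]) auto
  qed
  ultimately have "stable_solution f U" by (simp add: stable_solution_def)
  then show ?thesis using \<alpha> unfolding U_def by blast
qed

end

section \<open>Ordering of stable solutions\<close>

text \<open>Strictness is asked at the origin alone, where it can be read off from the initial
  values.\<close>

lemma not_stable_if_radial_subsolution:
  fixes U :: "'a::euclidean_space \<Rightarrow> real"
  assumes st: "stable_solution f U" and V: "continuous_on UNIV (\<lambda>x. deriv f (U x))" and W: "C2 W"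
    and R: "R > 0" and pos: "\<And>x. norm x < R \<Longrightarrow> W x > 0" and zero: "\<And>x. norm x = R \<Longrightarrow> W x = 0"
    and sub: "\<And>x. norm x < R \<Longrightarrow> - laplacian W x \<le> deriv f (U x) * W x"
    and strict: "- laplacian W 0 < deriv f (U 0) * W 0"
  shows False
proof -
  have "\<exists>\<phi>. C1_compact_support \<phi> \<and> (\<integral>x. ((norm (grad \<phi> x))\<^sup>2 - deriv f (U x) * (\<phi> x)\<^sup>2) \<partial>lborel) < 0"
    by (rule exists_destabilizing_function[where \<Omega>="ball 0 R" and c=0, OF W])
       (use R pos zero sub strict V in \<open>auto simp: frontier_ball\<close>)
  then show False using st unfolding stable_solution_def by (meson not_le)
qed

context nonlinearity
begin

lemma radial_sol_entire:
  "\<alpha> > 0 \<Longrightarrow> entire_solution f (\<lambda>x::'a::euclidean_space. radial_sol DIM('a) f (norm x) \<alpha>)"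
  by (rule radial_ivp_entire_solution[OF radial_sol_ivp continuous_f]) (auto simp: Suc_le_eq)

lemma continuous_potential:
  assumes "entire_solution f U" shows "continuous_on UNIV (\<lambda>x. deriv f (U x))"
proof -
  have "C1 U" using assms by (simp add: entire_solution_def C2_def)
  then show ?thesis using C1_continuous_on by (intro continuous_on_compose2[OF continuous_f']) auto
qed

text \<open>As a by-product, a stable \<open>u(.,\<alpha>)\<close> is positive on
  \<open>[0,\<infinity>)\<close>, although neither sign is known beforehand.\<close>

lemma stable_radial_sol_dominates:
  assumes \<beta>: "0 < \<beta>" "\<beta> < \<alpha>" and st: "stable_solution f (\<lambda>x::'a::euclidean_space. radial_sol DIM('a) f (norm x) \<alpha>)"
    and r: "r \<ge> 0"
  shows "\<bar>radial_sol DIM('a) f r \<beta>\<bar> < radial_sol DIM('a) f r \<alpha>"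
proof (rule ccontr)
  assume neg: "\<not> \<bar>radial_sol DIM('a) f r \<beta>\<bar> < radial_sol DIM('a) f r \<alpha>"
  have N: "DIM('a) \<ge> 1" by (simp add: Suc_le_eq)
  have \<alpha>: "\<alpha> > 0" using \<beta> by simp
  define u v where "u = (\<lambda>r. radial_sol DIM('a) f r \<alpha>)" and "v = (\<lambda>r. radial_sol DIM('a) f r \<beta>)"
  have w: "radial_ivp DIM('a) f \<alpha> u" "radial_ivp DIM('a) f \<beta> v"
    unfolding u_def v_def by (rule radial_sol_ivp[OF N \<alpha>] radial_sol_ivp[OF N \<beta>(1)])+
  have c: "continuous_on {0..} u" "continuous_on {0..} v" using w by (auto intro: radial_ivp_continuous_on)
  have 0: "u 0 = \<alpha>" "v 0 = \<beta>" using w by (auto simp: radial_ivp_def)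
  have "continuous_on {0..} (\<lambda>r. u r - \<bar>v r\<bar>)" "u 0 - \<bar>v 0\<bar> > 0" "u r - \<bar>v r\<bar> \<le> 0"
    using c 0 \<beta> neg by (auto intro!: continuous_intros simp: u_def v_def)
  from first_zero[OF this(1,2) r this(3)]
  obtain R where R: "0 < R" "u R - \<bar>v R\<bar> = 0" "\<And>t. 0 \<le> t \<Longrightarrow> t < R \<Longrightarrow> u t - \<bar>v t\<bar> > 0" by blast
  have e: "entire_solution f (\<lambda>x::'a. u (norm x))" "entire_solution f (\<lambda>x::'a. v (norm x))"
    unfolding u_def v_def by (rule radial_sol_entire[OF \<alpha>] radial_sol_entire[OF \<beta>(1)])+
  then have C2: "C2 (\<lambda>x::'a. u (norm x))" "C2 (\<lambda>x::'a. v (norm x))" by (auto simp: entire_solution_def)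
  have lap: "laplacian (\<lambda>x::'a. u (norm x)) x = - f (u (norm x))" "laplacian (\<lambda>x::'a. v (norm x)) x = - f (v (norm x))" for x
    using e unfolding entire_solution_def by (simp_all add: eq_neg_iff_add_eq_0)
  have st: "stable_solution f (\<lambda>x::'a. u (norm x))" using st by (simp add: u_def)
  note contradiction = not_stable_if_radial_subsolution[OF st continuous_potential[OF e(1)]]
  show False
  proof (cases "v R \<ge> 0")
    case True
    show False
    proof (rule contradiction[OF C2_diff(1)[OF C2] R(1)])
      show "- laplacian (\<lambda>x. u (norm x) - v (norm x)) x \<le> deriv f (u (norm x)) * (u (norm x) - v (norm x))"
        if "norm x < R" for x :: 'a
        unfolding C2_diff(2)[OF C2] lap using f_secant_le[of "v (norm x)" "u (norm x)"] R(3)[of "norm x"] that by simp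
      show "- laplacian (\<lambda>x::'a. u (norm x) - v (norm x)) 0 < deriv f (u (norm (0::'a))) * (u (norm (0::'a)) - v (norm (0::'a)))"
        unfolding C2_diff(2)[OF C2] lap using f_secant_less[of \<beta> \<alpha>] \<beta> 0 by simp
      show "u (norm x) - v (norm x) > 0" if "norm x < R" for x :: 'a using R(3)[of "norm x"] that by auto
      show "u (norm x) - v (norm x) = 0" if "norm x = R" for x :: 'a using R(2) that True by auto
    qed
  next
    case False
    \<comment> \<open>Here \<open>u - v\<close> is positive at \<open>R\<close>, so it is not the
      function to test with. But \<open>v\<close> has changed sign before \<open>R\<close>, and on
      the ball up to its first zero \<open>0 < v < u\<close> gives
      \<open>f(v) \<le> f'(v) v \<le> f'(u) v\<close>.\<close>
    have "v 0 > 0" "R \<ge> 0" "v R \<le> 0" using False 0 \<beta> R(1) by auto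
    from first_zero[OF c(2) this]
    obtain S where S: "0 < S" "S \<le> R" "v S = 0" "\<And>t. 0 \<le> t \<Longrightarrow> t < S \<Longrightarrow> v t > 0" by blast
    have sub: "f (v t) \<le> deriv f (u t) * v t" if "0 \<le> t" "t < S" for t
    proof -
      have "f (v t) \<le> deriv f (v t) * v t" using f_secant_le[of 0 "v t"] S(4)[OF that] by simp
      also have "\<dots> \<le> deriv f (u t) * v t"
        using R(3)[of t] S(2) S(4)[OF that] that by (intro mult_right_mono f'_mono) auto
      finally show ?thesis .
    qed
    show False
    proof (rule contradiction[OF C2(2) S(1)])
      show "- laplacian (\<lambda>x. v (norm x)) x \<le> deriv f (u (norm x)) * v (norm x)" if "norm x < S" for x :: 'a
        unfolding lap using sub[of "norm x"] that by simp
      have "f \<beta> < deriv f \<beta> * \<beta>" using f_secant_less[of 0 \<beta>] \<beta> by simp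
      also have "\<dots> \<le> deriv f \<alpha> * \<beta>" using \<beta> by (intro mult_right_mono f'_mono) auto
      finally show "- laplacian (\<lambda>x::'a. v (norm x)) 0 < deriv f (u (norm (0::'a))) * v (norm (0::'a))"
        unfolding lap using 0 by simp
    qed (use S in auto)
  qed
qed

lemma stable_radial_sol_downward:
  assumes \<beta>: "0 < \<beta>" "\<beta> < \<alpha>" and st: "stable_solution f (\<lambda>x::'a::euclidean_space. radial_sol DIM('a) f (norm x) \<alpha>)"
  shows "stable_solution f (\<lambda>x::'a. radial_sol DIM('a) f (norm x) \<beta>)"
  unfolding stable_solution_def
proof (intro conjI allI impI)
  show e: "entire_solution f (\<lambda>x::'a. radial_sol DIM('a) f (norm x) \<beta>)" using \<beta> by (intro radial_sol_entire)
  have e': "entire_solution f (\<lambda>x::'a. radial_sol DIM('a) f (norm x) \<alpha>)" using \<beta> by (intro radial_sol_entire) auto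
  fix \<phi> :: "'a \<Rightarrow> real" assume \<phi>: "C1_compact_support \<phi>"
  have "0 \<le> (\<integral>x. ((norm (grad \<phi> x))\<^sup>2 - deriv f (radial_sol DIM('a) f (norm x) \<alpha>) * (\<phi> x)\<^sup>2) \<partial>lborel)"
    using st \<phi> by (simp add: stable_solution_def)
  also have "\<dots> \<le> (\<integral>x. ((norm (grad \<phi> x))\<^sup>2 - deriv f (radial_sol DIM('a) f (norm x) \<beta>) * (\<phi> x)\<^sup>2) \<partial>lborel)"
  proof (rule integral_mono)
    show "(norm (grad \<phi> x))\<^sup>2 - deriv f (radial_sol DIM('a) f (norm x) \<alpha>) * (\<phi> x)\<^sup>2
      \<le> (norm (grad \<phi> x))\<^sup>2 - deriv f (radial_sol DIM('a) f (norm x) \<beta>) * (\<phi> x)\<^sup>2" for x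
      using stable_radial_sol_dominates[OF \<beta> st, of "norm x"] by (intro diff_left_mono mult_right_mono f'_mono) auto
  qed (use \<phi> e e' in \<open>auto intro!: integrable_quadratic_form continuous_potential\<close>)
  finally show "0 \<le> (\<integral>x. ((norm (grad \<phi> x))\<^sup>2 - deriv f (radial_sol DIM('a) f (norm x) \<beta>) * (\<phi> x)\<^sup>2) \<partial>lborel)" .
qed

text \<open>The quadratic form of a fixed test function passes to the limit by dominated
  convergence: parameters below \<open>\<alpha>\<close> keep the solutions in
  \<open>[- \<alpha>, \<alpha>]\<close>, hence the potentials in
  \<open>[0, f' \<alpha>]\<close>.\<close>

lemma stable_radial_sol_limit:
  assumes \<beta>: "\<And>n. 0 < \<beta> n" "\<And>n. \<beta> n \<le> \<alpha>" "\<beta> \<longlonglongrightarrow> \<alpha>" and \<alpha>: "\<alpha> > 0"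
    and st: "\<And>n. stable_solution f (\<lambda>x::'a::euclidean_space. radial_sol DIM('a) f (norm x) (\<beta> n))"
  shows "stable_solution f (\<lambda>x::'a. radial_sol DIM('a) f (norm x) \<alpha>)"
  unfolding stable_solution_def
proof (intro conjI allI impI)
  have N: "DIM('a) \<ge> 1" by (simp add: Suc_le_eq)
  show e: "entire_solution f (\<lambda>x::'a. radial_sol DIM('a) f (norm x) \<alpha>)" using \<alpha> by (rule radial_sol_entire)
  have e': "entire_solution f (\<lambda>x::'a. radial_sol DIM('a) f (norm x) (\<beta> n))" for n using \<beta>(1) by (rule radial_sol_entire)
  fix \<phi> :: "'a \<Rightarrow> real" assume \<phi>: "C1_compact_support \<phi>"
  define s where "s b x = (norm (grad \<phi> x))\<^sup>2 - deriv f (radial_sol DIM('a) f (norm x) b) * (\<phi> x)\<^sup>2" for b x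
  have si: "integrable lborel (s (\<beta> n))" "integrable lborel (s \<alpha>)" for n
    unfolding s_def using \<phi> e e' by (auto intro!: integrable_quadratic_form continuous_potential)
  have "(\<lambda>n. \<integral>x. s (\<beta> n) x \<partial>lborel) \<longlonglongrightarrow> (\<integral>x. s \<alpha> x \<partial>lborel)"
  \<comment> \<open>The majorant \<open>|grad \<phi>|^2 + f'(\<alpha>) \<phi>^2\<close> is written
    with a double minus so that it is a quadratic form with constant potential.\<close>
  proof (rule integral_dominated_convergence[where w="\<lambda>x. (norm (grad \<phi> x))\<^sup>2 - (- deriv f \<alpha>) * (\<phi> x)\<^sup>2"])
    show "integrable lborel (\<lambda>x. (norm (grad \<phi> x))\<^sup>2 - (- deriv f \<alpha>) * (\<phi> x)\<^sup>2)"
      using \<phi> by (rule integrable_quadratic_form) simp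
    have "(\<lambda>n. s (\<beta> n) x) \<longlonglongrightarrow> s \<alpha> x" for x
    proof -
      have "isCont (deriv f) (radial_sol DIM('a) f (norm x) \<alpha>)"
        using continuous_f' by (simp add: continuous_on_eq_continuous_at)
      then have "(\<lambda>n. deriv f (radial_sol DIM('a) f (norm x) (\<beta> n))) \<longlonglongrightarrow> deriv f (radial_sol DIM('a) f (norm x) \<alpha>)"
        by (rule isCont_tendsto_compose) (rule radial_sol_tendsto[OF N \<alpha> \<beta>], simp)
      then show ?thesis unfolding s_def by (intro tendsto_intros)
    qed
    then show "AE x in lborel. (\<lambda>n. s (\<beta> n) x) \<longlonglongrightarrow> s \<alpha> x" by simp
    have "norm (s (\<beta> n) x) \<le> (norm (grad \<phi> x))\<^sup>2 - (- deriv f \<alpha>) * (\<phi> x)\<^sup>2" for n x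
    proof -
      define g where "g = deriv f (radial_sol DIM('a) f (norm x) (\<beta> n))"
      have "\<bar>radial_sol DIM('a) f (norm x) (\<beta> n)\<bar> \<le> \<alpha>"
        using radial_ivp_abs_le[OF radial_sol_ivp[OF N \<beta>(1)] N \<beta>(1), of "norm x" n] \<beta>(2)[of n] by simp
      then have "0 \<le> g" "g \<le> deriv f \<alpha>" unfolding g_def by (auto intro: f'_mono f'_nonneg)
      then have "0 \<le> g * (\<phi> x)\<^sup>2" "g * (\<phi> x)\<^sup>2 \<le> deriv f \<alpha> * (\<phi> x)\<^sup>2" by (auto intro: mult_right_mono)
      then show ?thesis
        unfolding s_def g_def[symmetric] real_norm_def mult_minus_left
        using zero_le_power2[of "norm (grad \<phi> x)"] by (intro abs_leI) linarith+
    qed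
    then show "AE x in lborel. norm (s (\<beta> n) x) \<le> (norm (grad \<phi> x))\<^sup>2 - (- deriv f \<alpha>) * (\<phi> x)\<^sup>2" for n by simp
  qed (use si in \<open>auto intro: borel_measurable_integrable\<close>)
  then have "(\<integral>x. s \<alpha> x \<partial>lborel) \<ge> 0"
    by (rule LIMSEQ_le_const) (use st \<phi> in \<open>auto simp: stable_solution_def s_def\<close>)
  then show "0 \<le> (\<integral>x. ((norm (grad \<phi> x))\<^sup>2 - deriv f (radial_sol DIM('a) f (norm x) \<alpha>) * (\<phi> x)\<^sup>2) \<partial>lborel)"
    by (simp add: s_def)
qed

text \<open>The stable parameters form an interval that starts at 0; whether its supremum is
  infinite or finite, and then attained, decides between the two alternatives.\<close>

lemma stable_dichotomy:
  assumes ex: "\<exists>\<alpha>>0. stable_solution f (\<lambda>x::'a::euclidean_space. radial_sol DIM('a) f (norm x) \<alpha>)"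
  shows "((\<forall>\<alpha>>0. stable_solution f (\<lambda>x::'a. radial_sol DIM('a) f (norm x) \<alpha>)) \<and>
      (\<forall>r>0. strict_mono_on {0<..} (\<lambda>\<alpha>. radial_sol DIM('a) f r \<alpha>)))
     \<or>
     (\<exists>\<alpha>s>0.
        (\<forall>\<alpha>\<in>{0<..\<alpha>s}. stable_solution f (\<lambda>x::'a. radial_sol DIM('a) f (norm x) \<alpha>)) \<and>
        (\<forall>\<alpha>>\<alpha>s. unstable_solution f (\<lambda>x::'a. radial_sol DIM('a) f (norm x) \<alpha>)) \<and>
        (\<forall>r>0. strict_mono_on {0<..<\<alpha>s} (\<lambda>\<alpha>. radial_sol DIM('a) f r \<alpha>)))"
proof -
  define S where "S = {\<alpha>. \<alpha> > 0 \<and> stable_solution f (\<lambda>x::'a. radial_sol DIM('a) f (norm x) \<alpha>)}"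
  have down: "\<beta> \<in> S" if "0 < \<beta>" "\<beta> < \<alpha>" "\<alpha> \<in> S" for \<alpha> \<beta>
    using stable_radial_sol_downward[OF that(1,2)] that by (simp add: S_def)
  have mono: "strict_mono_on A (\<lambda>\<alpha>. radial_sol DIM('a) f r \<alpha>)" if "A \<subseteq> S" "r > 0" for A r
  proof (rule strict_mono_onI)
    fix \<beta> \<alpha> assume "\<beta> \<in> A" "\<alpha> \<in> A" "\<beta> < \<alpha>"
    then have "\<bar>radial_sol DIM('a) f r \<beta>\<bar> < radial_sol DIM('a) f r \<alpha>"
      using that by (intro stable_radial_sol_dominates) (auto simp: S_def)
    then show "radial_sol DIM('a) f r \<beta> < radial_sol DIM('a) f r \<alpha>" by simp
  qed
  show ?thesis
  proof (cases "bdd_above S")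
    case False
    have "\<alpha> \<in> S" if "\<alpha> > 0" for \<alpha>
      using False down[OF that] unfolding bdd_above_def by (meson not_le)
    then have "{0<..} \<subseteq> S" by auto
    then have "(\<forall>\<alpha>>0. stable_solution f (\<lambda>x::'a. radial_sol DIM('a) f (norm x) \<alpha>)) \<and>
      (\<forall>r>0. strict_mono_on {0<..} (\<lambda>\<alpha>. radial_sol DIM('a) f r \<alpha>))"
      using mono by (auto simp: S_def)
    then show ?thesis by (rule disjI1)
  next
    case True
    obtain a where a: "a \<in> S" using ex by (auto simp: S_def)
    define m where "m = Sup S"
    have upper: "\<alpha> \<le> m" if "\<alpha> \<in> S" for \<alpha> unfolding m_def by (rule cSup_upper[OF that True])
    have m: "m > 0" using a upper[OF a] by (auto simp: S_def)
    have below: "\<beta> \<in> S" if "0 < \<beta>" "\<beta> < m" for \<beta>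
    proof -
      have "\<exists>\<alpha>\<in>S. \<beta> < \<alpha>" using less_cSupD[of S \<beta>] a that by (auto simp: m_def)
      then obtain \<alpha> where "\<alpha> \<in> S" "\<beta> < \<alpha>" by blast
      then show ?thesis using down that by blast
    qed
    have "stable_solution f (\<lambda>x::'a. radial_sol DIM('a) f (norm x) m)"
    proof (rule stable_radial_sol_limit[OF _ _ _ m])
      \<comment> \<open>Two successors are taken because \<open>1 - 1 / (n + 1)\<close> would make
        the first parameter 0, where no solution is available.\<close>
      define \<beta> where "\<beta> n = m * (1 - inverse (real (Suc (Suc n))))" for n
      have i: "0 < inverse (real (Suc (Suc n)))" "inverse (real (Suc (Suc n))) < 1" for n
        by (auto simp: field_simps)
      show \<beta>0: "0 < \<beta> n" for n unfolding \<beta>_def using m i[of n] by (intro mult_pos_pos) auto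
      have \<beta>m: "\<beta> n < m" for n unfolding \<beta>_def using m i[of n] by (simp add: algebra_simps)
      then show "\<beta> n \<le> m" for n by (simp add: less_imp_le)
      have "(\<lambda>n. inverse (real (Suc (Suc n)))) \<longlonglongrightarrow> 0" using LIMSEQ_Suc[OF LIMSEQ_inverse_real_of_nat] .
      then have "\<beta> \<longlonglongrightarrow> m * (1 - 0)" unfolding \<beta>_def by (intro tendsto_intros)
      then show "\<beta> \<longlonglongrightarrow> m" by simp
      show "stable_solution f (\<lambda>x::'a. radial_sol DIM('a) f (norm x) (\<beta> n))" for n
        using below[OF \<beta>0 \<beta>m] by (simp add: S_def)
    qed
    then have "m \<in> S" using m by (simp add: S_def)
    have "stable_solution f (\<lambda>x::'a. radial_sol DIM('a) f (norm x) \<alpha>)" if "\<alpha> \<in> {0<..m}" for \<alpha>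
      using below[of \<alpha>] \<open>m \<in> S\<close> that by (cases "\<alpha> = m") (auto simp: S_def)
    \<comment> \<open>Every positive parameter gives an entire solution, so lying outside
      \<open>S\<close> is genuine instability.\<close>
    moreover have "unstable_solution f (\<lambda>x::'a. radial_sol DIM('a) f (norm x) \<alpha>)" if "\<alpha> > m" for \<alpha>
      using upper[of \<alpha>] that m radial_sol_entire[of \<alpha>] by (auto simp: S_def unstable_solution_def)
    moreover have "strict_mono_on {0<..<m} (\<lambda>\<alpha>. radial_sol DIM('a) f r \<alpha>)" if "r > 0" for r
      using below that by (intro mono) auto
    ultimately show ?thesis using m by blast
  qed
qed

end

theorem corollary1p3:
  fixes f :: "real \<Rightarrow> real" and q0 :: real
  assumes "CARD('n::finite) \<ge> 11"
    and "standing_assumptions f"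
    and "((\<lambda>u. deriv f u * tail_integral f u) \<longlongrightarrow> q0) (at_right 0)"
    and "1 < q0" and "q0 < q_JL CARD('n)"
  shows "(\<exists>\<alpha>>0. stable_solution f (\<lambda>x::real^'n. radial_sol CARD('n) f (norm x) \<alpha>)) \<and>
    (((\<forall>\<alpha>>0. stable_solution f (\<lambda>x::real^'n. radial_sol CARD('n) f (norm x) \<alpha>)) \<and>
      (\<forall>r>0. strict_mono_on {0<..} (\<lambda>\<alpha>. radial_sol CARD('n) f r \<alpha>)))
     \<or>
     (\<exists>\<alpha>s>0.
        (\<forall>\<alpha>\<in>{0<..\<alpha>s}. stable_solution f (\<lambda>x::real^'n. radial_sol CARD('n) f (norm x) \<alpha>)) \<and>
        (\<forall>\<alpha>>\<alpha>s. unstable_solution f (\<lambda>x::real^'n. radial_sol CARD('n) f (norm x) \<alpha>)) \<and>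
        (\<forall>r>0. strict_mono_on {0<..<\<alpha>s} (\<lambda>\<alpha>. radial_sol CARD('n) f r \<alpha>))))"
proof -
  interpret nonlinearity f by unfold_locales (rule assms(2))
  have D: "DIM(real^'n) = CARD('n)" by simp
  have ex: "\<exists>\<alpha>>0. stable_solution f (\<lambda>x::real^'n. radial_sol DIM(real^'n) f (norm x) \<alpha>)"
    by (rule exists_stable_radial_sol[OF _ assms(3,4)]) (use assms(1,5) in \<open>simp_all only: D\<close>)
  from ex stable_dichotomy[OF ex] show ?thesis unfolding D by (rule conjI)
qed

end
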